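(* Let $G$ be a locally contractible topological group with open identity neighbourhood filterbase $\mathcal{U}_1$, and let $V$ be a loop contractible abelian topological group. Then the morphisms $A_c^*(\mathfrak{U}_U;V)\hookrightarrow A^*(\mathfrak{U}_U;V)$ and $C(\lambda^*_{\mathfrak{U}_U},V):A_c^*(\mathfrak{U}_U;V)\to S^*(\mathfrak{U}_U;V)$ for all $U\in\mathcal{U}_1$ induce isomorphisms $$\operatorname{colim}_{U\in\mathcal{U}_1}H_c(\mathfrak{U}_U;V)\cong\operatorname{colim}_{U\in\mathcal{U}_1}H(\mathfrak{U}_U;V)\cong H_{sing}(G;V)$$ in cohomology.
   Context: A topological group $G$ is loop contractible if there is a contraction $\Phi:G\times[0,1]\to G$ to the identity (a continuous homotopy between $\mathrm{id}_G$ and the constant map to the identity element) such that each $\Phi_t=\Phi(-,t)$ is a homomorphism of topological groups. For an open identity neighbourhood $U$ of $G$, $\mathfrak{U}_U:=\{gU\mid g\in G\}$ is the associated open covering of $G$. For an open covering $\mathfrak{U}$ of a space $X$ and $q\ge0$ put $\mathfrak{U}[q]:=\bigcup_{U\in\mathfrak{U}}U^{q+1}\subseteq X^{q+1}$. $A^q(\mathfrak{U};V)$ is the group of all functions $\mathfrak{U}[q]\to V$ and $A_c^q(\mathfrak{U};V)$ the subgroup of continuous ones; both form cochain complexes with $df(u_0,\dots,u_{q+1})=\sum_k(-1)^kf(u_0,\dots,\hat u_k,\dots,u_{q+1})$, with cohomologies $H(\mathfrak{U};V)$ and $H_c(\mathfrak{U};V)$. $S^*(\mathfrak{U};V)$ is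 the complex of $V$-valued cochains on $\mathfrak{U}$-small singular simplices of $X$ (those with image in some member of $\mathfrak{U}$); its cohomology is canonically (via restriction of cochains) the singular cohomology $H_{sing}(X;V)$. $C(\lambda_{\mathfrak{U}}^*,V)$ sends a cochain $f\in A^n(\mathfrak{U};V)$ to $\tau\mapsto f(\tau(\vec e_0),\dots,\tau(\vec e_n))$, where $\vec e_0,\dots,\vec e_n$ are the vertices of the standard simplex $\Delta^n$. The colimits are over $\mathcal{U}_1$ directed by reverse inclusion, with transition maps given by restriction of cochains. *)

theory Defs
  imports "HOL-Homology.Homology"
begin

section \<open>Topological hypotheses\<close>

text \<open>Topological groups are types of class \<^class>\<open>topological_group_add\<close>. The group operation is
  written additively, but it need not be commutative (in particular for the group \<open>G\<close>).\<close>

text \<open>Every neighbourhood of a point contains a neighbourhood whose inclusion is null-homotopic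
  (Borsuk, Spanier). This is implied by the existence of neighbourhood bases of contractible sets.
  The constant \<open>c\<close> lies in \<open>U\<close>, since the homotopy takes its values there.\<close>

definition locally_contractible_space :: "'a topology \<Rightarrow> bool" where
  "locally_contractible_space X \<longleftrightarrow>
    (\<forall>U x. openin X U \<and> x \<in> U \<longrightarrow>
      (\<exists>W. openin X W \<and> x \<in> W \<and> W \<subseteq> U \<and>
        (\<exists>c. homotopic_with (\<lambda>_. True) (subtopology X W) (subtopology X U) id (\<lambda>_. c))))"

definition loop_contractible :: "'a::topological_group_add itself \<Rightarrow> bool" where
  "loop_contractible _ \<longleftrightarrow>
    homotopic_with (\<lambda>h. continuous_on UNIV h \<and> (\<forall>v w. h (v + w) = h v + h w))
      (euclidean :: 'a topology) (euclidean :: 'a topology) id (\<lambda>_. 0)"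

definition identity_nhds :: "'g::topological_group_add set set" where
  "identity_nhds = {U. open U \<and> 0 \<in> U}"

definition translate_cover :: "'g::topological_group_add set \<Rightarrow> 'g set set" where
  "translate_cover U = (\<Union>g. {(+) g ` U})"


section \<open>Cochain complexes and their cohomology\<close>

record 'c cochain_complex =
  cochains :: "nat \<Rightarrow> 'c monoid"
  coboundary :: "nat \<Rightarrow> 'c \<Rightarrow> 'c"

definition cocycles :: "'c cochain_complex \<Rightarrow> nat \<Rightarrow> 'c set" where
  "cocycles K n = kernel (cochains K n) (cochains K (Suc n)) (coboundary K n)"

definition coboundaries :: "'c cochain_complex \<Rightarrow> nat \<Rightarrow> 'c set" where
  "coboundaries K n =
    (case n of 0 \<Rightarrow> {\<one>\<^bsub>cochains K 0\<^esub>} | Suc m \<Rightarrow> coboundary K m ` carrier (cochains K m))"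

definition cohomology :: "'c cochain_complex \<Rightarrow> nat \<Rightarrow> 'c set monoid" where
  "cohomology K n = (cochains K n)\<lparr>carrier := cocycles K n\<rparr> Mod coboundaries K n"

text \<open>The map on cohomology in degree \<open>n\<close> induced by a cochain map whose degree \<open>n\<close> component is \<open>h\<close>.
  If \<open>X\<close> is the class of \<open>z\<close>, then \<open>h ` X\<close> is in general only a subset of the class of \<open>h z\<close>;
  adding all coboundaries gives the whole class.\<close>

definition cohomology_map ::
    "nat \<Rightarrow> 'c cochain_complex \<Rightarrow> 'd cochain_complex \<Rightarrow> ('c \<Rightarrow> 'd) \<Rightarrow> 'c set \<Rightarrow> 'd set" where
  "cohomology_map n K L h X = coboundaries L n <#>\<^bsub>cochains L n\<^esub> (h ` X)"


section \<open>Colimits of directed systems of groups\<close>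

record ('i, 'a) group_system =
  Index :: "'i set"
  Le :: "'i \<Rightarrow> 'i \<Rightarrow> bool"
  Obj :: "'i \<Rightarrow> 'a monoid"
  Trans :: "'i \<Rightarrow> 'i \<Rightarrow> 'a \<Rightarrow> 'a"

definition colimit_rel :: "('i, 'a) group_system \<Rightarrow> (('i \<times> 'a) \<times> ('i \<times> 'a)) set" where
  "colimit_rel D =
    {((i, x), (j, y)) | i x j y.
      i \<in> Index D \<and> x \<in> carrier (Obj D i) \<and> j \<in> Index D \<and> y \<in> carrier (Obj D j) \<and>
      (\<exists>k \<in> Index D. Le D i k \<and> Le D j k \<and> Trans D i k x = Trans D j k y)}"

definition colimit :: "('i, 'a) group_system \<Rightarrow> ('i \<times> 'a) set monoid" where
  "colimit D =
    \<lparr>carrier = (SIGMA i:Index D. carrier (Obj D i)) // colimit_rel D,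
     monoid.mult = (\<lambda>X Y. colimit_rel D ``
       {(k, Trans D i k x \<otimes>\<^bsub>Obj D k\<^esub> Trans D j k y) | i x j y k.
         (i, x) \<in> X \<and> (j, y) \<in> Y \<and> k \<in> Index D \<and> Le D i k \<and> Le D j k}),
     one = colimit_rel D `` {(i, \<one>\<^bsub>Obj D i\<^esub>) | i. i \<in> Index D}\<rparr>"

text \<open>The map of colimits induced by a compatible family of maps \<open>\<phi> i\<close> from the objects of the first
  system to those of \<open>E\<close>, and the map out of a colimit induced by a compatible family of maps
  \<open>\<phi> i\<close> to a fixed group.\<close>

definition colimit_map ::
    "('i, 'b) group_system \<Rightarrow> ('i \<Rightarrow> 'a \<Rightarrow> 'b) \<Rightarrow> ('i \<times> 'a) set \<Rightarrow> ('i \<times> 'b) set" where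
  "colimit_map E \<phi> X = colimit_rel E `` ((\<lambda>(i, x). (i, \<phi> i x)) ` X)"

definition colimit_desc :: "('i \<Rightarrow> 'a \<Rightarrow> 'b) \<Rightarrow> ('i \<times> 'a) set \<Rightarrow> 'b" where
  "colimit_desc \<phi> X = the_elem ((\<lambda>(i, x). \<phi> i x) ` X)"


section \<open>The complexes \<open>A\<close>, \<open>A\<^sub>c\<close> and \<open>S\<close>\<close>

definition additive_group :: "'v::ab_group_add monoid" where
  "additive_group = \<lparr>carrier = UNIV, monoid.mult = (+), one = 0\<rparr>"

definition alternating_sum :: "nat \<Rightarrow> (nat \<Rightarrow> 'v::ab_group_add) \<Rightarrow> 'v" where
  "alternating_sum q a = (\<Sum>k\<le>q. if even k then a k else - a k)"

text \<open>The set \<open>\<UU>[q]\<close>; a point of \<open>X\<^sup>q\<^sup>+\<^sup>1\<close> is an extensional function on \<open>{..q}\<close>.\<close>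

definition cover_tuples :: "'a set set \<Rightarrow> nat \<Rightarrow> (nat \<Rightarrow> 'a) set" where
  "cover_tuples \<UU> q = (\<Union>U\<in>\<UU>. {..q} \<rightarrow>\<^sub>E U)"

definition tuple_face :: "nat \<Rightarrow> nat \<Rightarrow> (nat \<Rightarrow> 'a) \<Rightarrow> nat \<Rightarrow> 'a" where
  "tuple_face q k u = (\<lambda>i\<in>{..q}. u (if i < k then i else Suc i))"

definition tuple_complex :: "'a set set \<Rightarrow> ((nat \<Rightarrow> 'a) \<Rightarrow> 'v::ab_group_add) cochain_complex" where
  "tuple_complex \<UU> =
    \<lparr>cochains = (\<lambda>q. product_group (cover_tuples \<UU> q) (\<lambda>_. additive_group)),
     coboundary = (\<lambda>q f. \<lambda>u\<in>cover_tuples \<UU> (Suc q).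
       alternating_sum (Suc q) (\<lambda>k. f (tuple_face q k u)))\<rparr>"

definition continuous_tuple_complex ::
    "'a::topological_space set set \<Rightarrow> ((nat \<Rightarrow> 'a) \<Rightarrow> 'v::topological_ab_group_add) cochain_complex" where
  "continuous_tuple_complex \<UU> = (tuple_complex \<UU>)
    \<lparr>cochains := (\<lambda>q. (cochains (tuple_complex \<UU>) q)
      \<lparr>carrier := {f \<in> carrier (cochains (tuple_complex \<UU>) q).
        continuous_map
          (subtopology (product_topology (\<lambda>_. euclidean) {..q}) (cover_tuples \<UU> q)) euclidean f}\<rparr>)\<rparr>"

text \<open>Cochains on a family \<open>S\<close> of sets of singular simplices, closed under taking faces.\<close>

definition simplex_complex ::
    "(nat \<Rightarrow> ((nat \<Rightarrow> real) \<Rightarrow> 'a) set) \<Rightarrow> (((nat \<Rightarrow> real) \<Rightarrow> 'a) \<Rightarrow> 'v::ab_group_add) cochain_complex" where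
  "simplex_complex S =
    \<lparr>cochains = (\<lambda>q. product_group (S q) (\<lambda>_. additive_group)),
     coboundary = (\<lambda>q f. \<lambda>\<tau>\<in>S (Suc q).
       alternating_sum (Suc q) (\<lambda>k. f (singular_face (Suc q) k \<tau>)))\<rparr>"

definition small_simplices ::
    "'a::topological_space set set \<Rightarrow> nat \<Rightarrow> ((nat \<Rightarrow> real) \<Rightarrow> 'a) set" where
  "small_simplices \<UU> q =
    {\<tau>. singular_simplex q euclidean \<tau> \<and> (\<exists>U\<in>\<UU>. \<tau> ` standard_simplex q \<subseteq> U)}"

abbreviation small_complex ::
    "'a::topological_space set set \<Rightarrow> (((nat \<Rightarrow> real) \<Rightarrow> 'a) \<Rightarrow> 'v::ab_group_add) cochain_complex" where
  "small_complex \<UU> \<equiv> simplex_complex (small_simplices \<UU>)"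

abbreviation singular_complex ::
    "(((nat \<Rightarrow> real) \<Rightarrow> 'a::topological_space) \<Rightarrow> 'v::ab_group_add) cochain_complex" where
  "singular_complex \<equiv> simplex_complex (\<lambda>q. singular_simplex_set q euclidean)"

definition vertex_cochain ::
    "'a::topological_space set set \<Rightarrow> nat \<Rightarrow> ((nat \<Rightarrow> 'a) \<Rightarrow> 'v) \<Rightarrow> ((nat \<Rightarrow> real) \<Rightarrow> 'a) \<Rightarrow> 'v" where
  "vertex_cochain \<UU> n f = (\<lambda>\<tau>\<in>small_simplices \<UU> n. f (\<lambda>i\<in>{..n}. simplicial_vertex i \<tau>))"


section \<open>The maps in the theorem\<close>

text \<open>The cohomology groups of \<open>K \<UU>\<^sub>U\<close> for \<open>U\<close> an open identity neighbourhood, with the maps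
  induced by restriction; \<open>K\<close> is \<^const>\<open>tuple_complex\<close> or \<^const>\<open>continuous_tuple_complex\<close>.\<close>

definition nhd_system ::
    "('g::topological_group_add set set \<Rightarrow> ((nat \<Rightarrow> 'g) \<Rightarrow> 'v) cochain_complex) \<Rightarrow> nat \<Rightarrow>
      ('g set, ((nat \<Rightarrow> 'g) \<Rightarrow> 'v) set) group_system" where
  "nhd_system K n =
    \<lparr>Index = identity_nhds,
     Le = (\<lambda>U W. W \<subseteq> U),
     Obj = (\<lambda>U. cohomology (K (translate_cover U)) n),
     Trans = (\<lambda>U W. cohomology_map n (K (translate_cover U)) (K (translate_cover W))
       (\<lambda>f. restrict f (cover_tuples (translate_cover W) n)))\<rparr>"

definition inclusion_map ::
    "nat \<Rightarrow> 'g::topological_group_add set \<Rightarrow>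
      ((nat \<Rightarrow> 'g) \<Rightarrow> 'v::topological_ab_group_add) set \<Rightarrow> ((nat \<Rightarrow> 'g) \<Rightarrow> 'v) set" where
  "inclusion_map n U =
    cohomology_map n (continuous_tuple_complex (translate_cover U)) (tuple_complex (translate_cover U))
      (\<lambda>f. f)"

definition small_restriction ::
    "nat \<Rightarrow> 'a::topological_space set set \<Rightarrow>
      (((nat \<Rightarrow> real) \<Rightarrow> 'a) \<Rightarrow> 'v::ab_group_add) set \<Rightarrow> (((nat \<Rightarrow> real) \<Rightarrow> 'a) \<Rightarrow> 'v) set" where
  "small_restriction n \<UU> =
    cohomology_map n singular_complex (small_complex \<UU>) (\<lambda>f. restrict f (small_simplices \<UU> n))"

text \<open>The map \<open>H(K \<UU>\<^sub>U) \<rightarrow> H(S(\<UU>\<^sub>U;V)) \<cong> H\<^sub>s\<^sub>i\<^sub>n\<^sub>g(G;V)\<close> induced by evaluation at the vertices,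
  where the isomorphism is the inverse of \<^const>\<open>small_restriction\<close>.\<close>

definition vertex_map ::
    "('g::topological_group_add set set \<Rightarrow> ((nat \<Rightarrow> 'g) \<Rightarrow> 'v::ab_group_add) cochain_complex) \<Rightarrow> nat \<Rightarrow>
      'g set \<Rightarrow> ((nat \<Rightarrow> 'g) \<Rightarrow> 'v) set \<Rightarrow> (((nat \<Rightarrow> real) \<Rightarrow> 'g) \<Rightarrow> 'v) set" where
  "vertex_map K n U x =
    inv_into (carrier (cohomology singular_complex n)) (small_restriction n (translate_cover U))
      (cohomology_map n (K (translate_cover U)) (small_complex (translate_cover U))
        (vertex_cochain (translate_cover U) n) x)"

end

theory Submission
  imports Defs
begin

text \<open>The theorem compares continuous cochains, arbitrary cochains and singular cochains; the two
comparisons rest on different ideas.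

\<^bold>\<open>Continuous and arbitrary cochains.\<close> If \<open>V\<close> were a real vector space, a partition of unity \<open>\<rho>\<^sub>i\<close>
subordinate to translates \<open>g\<^sub>i + W\<close> would turn an arbitrary cochain \<open>f\<close> into the continuous cochain
\<open>(x\<^sub>0, \<dots>, x\<^sub>n) \<mapsto> \<Sum> \<rho>\<^sub>i\<^sub>0(x\<^sub>0) \<cdots> \<rho>\<^sub>i\<^sub>n(x\<^sub>n) f(g\<^sub>i\<^sub>0, \<dots>, g\<^sub>i\<^sub>n)\<close>. This is a cochain map, and a prism operator makes
it homotopic to the restriction; the prism operator preserves continuity, so smoothing inverts the
inclusion of continuous cochains in the colimit. A loop contraction \<open>\<Phi>\<close> of \<open>V\<close> supplies
the scalars: if \<open>s\<^sub>0 \<le> s\<^sub>1 \<le> \<dots>\<close> are continuous functions that start with \<open>0\<close> and are locally eventually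
\<open>1\<close>, then the endomorphisms \<open>T\<^sub>k(x) = \<Phi>(s\<^sub>k(x)) - \<Phi>(s\<^sub>k\<^sub>+\<^sub>1(x))\<close> of \<open>V\<close> sum to \<open>\<Phi>(0) - \<Phi>(1) = id\<close>. The locale
\<open>smoothing\<close> axiomatizes such weights. They exist on every topological group, because the cover by
translates is uniform: a continuous pseudometric refines it (\<open>uniform_pseudometric\<close>), and A. H. Stone's
paracompactness argument produces the functions \<open>s\<^sub>k\<close> (\<open>exists_ladder\<close>). The result is
\<open>inclusion_colimit_iso\<close>.

\<^bold>\<open>Cochains and singular cochains.\<close> The vertices of a small simplex form a small tuple. The mapping
cone of this map from singular chains to chains of tuples is acyclic up to shrinking neighbourhoods:
if a cycle of the cone lives in a translate of \<open>X\<close> and \<open>X\<close> is null-homotopic in \<open>Y\<close>, then its singular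
part bounds in the translate of \<open>Y\<close> by homotopy invariance, and what remains is a cycle of tuples, which
bounds the cone over it (\<open>cone_acyclic\<close>). The cone is free, so a contraction can be chosen on basis
elements, degree by degree. Each degree costs two steps in a chain of neighbourhoods, and a cocycle of
degree \<open>n\<close> involves only the degrees up to \<open>n\<close>, so finitely many neighbourhoods suffice. Evaluating cochains
on the contraction shows that every cocycle of the dual cone on the cover by translates of \<open>U\<close> becomes a
coboundary on the cover by translates of some \<open>W\<close> (\<open>cone_pro_acyclic\<close>). Injectivity and surjectivity in
the colimit are special cases of this.

The same choice of a contraction, applied to singular chains modulo small ones, which are acyclic by
iterated subdivision, shows that restriction to small simplices is an isomorphism in cohomology
(\<open>small_restriction_iso\<close>). Both applications are instances of the locale \<open>carried_acyclic\<close>.\<close>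


section \<open>Abelian cochain complexes and their cohomology classes\<close>

locale abelian_cochain_complex =
  fixes K :: "'c cochain_complex"
  assumes comm_group: "comm_group (cochains K n)"
    and coboundary_hom: "coboundary K n \<in> hom (cochains K n) (cochains K (Suc n))"
    and coboundary_coboundary:
      "x \<in> carrier (cochains K n) \<Longrightarrow> coboundary K (Suc n) (coboundary K n x) = \<one>\<^bsub>cochains K (Suc (Suc n))\<^esub>"
begin

abbreviation cocycle_group where "cocycle_group n \<equiv> (cochains K n)\<lparr>carrier := cocycles K n\<rparr>"

lemma coboundary_group_hom: "group_hom (cochains K n) (cochains K (Suc n)) (coboundary K n)"
  using comm_group coboundary_hom by (simp add: group_hom_def group_hom_axioms_def comm_group_def)

lemma subgroup_cocycles: "subgroup (cocycles K n) (cochains K n)"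
  unfolding cocycles_def by (rule group_hom.subgroup_kernel [OF coboundary_group_hom])

lemma cocycles_subset: "cocycles K n \<subseteq> carrier (cochains K n)"
  by (auto simp: cocycles_def kernel_def)

lemma comm_group_cocycles: "comm_group (cocycle_group n)"
proof -
  interpret comm_group "cochains K n" by (rule comm_group)
  have "group (cocycle_group n)"
    using subgroup_cocycles by (rule subgroup_imp_group)
  then show ?thesis
    using m_comm cocycles_subset by (intro group.group_comm_groupI) auto
qed

lemma coboundaries_subset: "coboundaries K n \<subseteq> cocycles K n"
proof (cases n)
  case 0
  then show ?thesis
    using subgroup_cocycles [of 0] by (simp add: coboundaries_def subgroup.one_closed)
next
  case (Suc m)
  then show ?thesis
    using coboundary_hom [of m] coboundary_coboundary
    by (auto simp: coboundaries_def cocycles_def kernel_def hom_def Pi_def)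
qed

lemma subgroup_coboundaries: "subgroup (coboundaries K n) (cochains K n)"
proof (cases n)
  case 0
  then show ?thesis
    using comm_group [of 0] by (simp add: coboundaries_def group.triv_subgroup comm_group_def)
next
  case (Suc m)
  then show ?thesis
    using group_hom.subgroup_img_is_subgroup [OF coboundary_group_hom group.subgroup_self]
      comm_group [of m] by (simp add: coboundaries_def comm_group_def)
qed

lemma subgroup_coboundaries': "subgroup (coboundaries K n) (cocycle_group n)"
  using subgroup_coboundaries subgroup_cocycles coboundaries_subset comm_group
  by (simp add: group.subgroup_incl comm_group_def)

lemma normal_coboundaries: "coboundaries K n \<lhd> cocycle_group n"
  using comm_group_cocycles subgroup_coboundaries' by (rule comm_group.subgroup_imp_normal)

definition cohomology_class :: "nat \<Rightarrow> 'c \<Rightarrow> 'c set" where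
  "cohomology_class n z = coboundaries K n #>\<^bsub>cochains K n\<^esub> z"

lemma cohomology_class_eq_coset: "cohomology_class n z = coboundaries K n #>\<^bsub>cocycle_group n\<^esub> z"
  by (simp add: cohomology_class_def r_coset_def)

lemma carrier_cohomology: "carrier (cohomology K n) = cohomology_class n ` cocycles K n"
  by (auto simp: cohomology_def cohomology_class_eq_coset FactGroup_def RCOSETS_def)

lemma class_closed: "z \<in> cocycles K n \<Longrightarrow> cohomology_class n z \<in> carrier (cohomology K n)"
  by (simp add: carrier_cohomology)

lemma comm_group_cohomology: "comm_group (cohomology K n)"
  unfolding cohomology_def
  by (rule comm_group.abelian_FactGroup [OF comm_group_cocycles subgroup_coboundaries'])

lemma class_mult:
  assumes "x \<in> cocycles K n" "y \<in> cocycles K n"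
  shows "cohomology_class n x \<otimes>\<^bsub>cohomology K n\<^esub> cohomology_class n y
      = cohomology_class n (x \<otimes>\<^bsub>cochains K n\<^esub> y)"
  using normal.rcos_sum [OF normal_coboundaries, of x n y] assms
  by (simp add: cohomology_def cohomology_class_eq_coset)

lemma class_eq_iff:
  assumes "x \<in> cocycles K n" "y \<in> cocycles K n"
  shows "cohomology_class n x = cohomology_class n y \<longleftrightarrow>
    x \<otimes>\<^bsub>cochains K n\<^esub> inv\<^bsub>cochains K n\<^esub> y \<in> coboundaries K n"
proof -
  have G: "group (cochains K n)" using comm_group by (simp add: comm_group_def)
  have xy: "x \<in> carrier (cochains K n)" "y \<in> carrier (cochains K n)"
    using assms cocycles_subset by auto
  show ?thesis
    unfolding cohomology_class_def
    using group.repr_independence [OF G _ xy(2) subgroup_coboundaries, of x]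
      group.repr_independenceD [OF G subgroup_coboundaries xy(1), of y]
      subgroup.rcos_module [OF subgroup_coboundaries G xy(2) xy(1)]
    by metis
qed

lemma one_cohomology: "\<one>\<^bsub>cohomology K n\<^esub> = cohomology_class n \<one>\<^bsub>cochains K n\<^esub>"
proof -
  have "group (cochains K n)" using comm_group by (simp add: comm_group_def)
  then show ?thesis
    unfolding cohomology_def cohomology_class_def one_FactGroup
    by (simp add: group.coset_mult_one subgroup.subset [OF subgroup_coboundaries])
qed

lemma class_eq_one_iff:
  assumes "x \<in> cocycles K n"
  shows "cohomology_class n x = \<one>\<^bsub>cohomology K n\<^esub> \<longleftrightarrow> x \<in> coboundaries K n"
proof -
  have G: "group (cochains K n)" using comm_group by (simp add: comm_group_def)
  have "\<one>\<^bsub>cochains K n\<^esub> \<in> cocycles K n"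
    using subgroup_cocycles by (rule subgroup.one_closed)
  moreover have "x \<in> carrier (cochains K n)" using assms cocycles_subset by auto
  ultimately show ?thesis
    using class_eq_iff [OF assms] G
    by (simp add: one_cohomology monoid.inv_one group.is_monoid monoid.r_one)
qed

lemma one_coboundary: "\<one>\<^bsub>cochains K n\<^esub> \<in> coboundaries K n"
  using subgroup_coboundaries by (rule subgroup.one_closed)

end

locale abelian_cochain_map = K: abelian_cochain_complex K + L: abelian_cochain_complex L
  for K :: "'c cochain_complex" and L :: "'d cochain_complex" +
  fixes h :: "nat \<Rightarrow> 'c \<Rightarrow> 'd"
  assumes map_hom: "h n \<in> hom (cochains K n) (cochains L n)"
    and map_coboundary: "x \<in> carrier (cochains K n) \<Longrightarrow> h (Suc n) (coboundary K n x) = coboundary L n (h n x)"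
begin

lemma map_one: "h n \<one>\<^bsub>cochains K n\<^esub> = \<one>\<^bsub>cochains L n\<^esub>"
  using hom_one [OF map_hom] K.comm_group L.comm_group by (simp add: comm_group_def)

lemma map_cocycle: "z \<in> cocycles K n \<Longrightarrow> h n z \<in> cocycles L n"
  using map_hom [of n] map_one [of "Suc n"] map_coboundary [of z n]
  by (auto simp: cocycles_def kernel_def hom_def)

lemma map_coboundaries: "z \<in> coboundaries K n \<Longrightarrow> h n z \<in> coboundaries L n"
proof (cases n)
  case 0
  then show "z \<in> coboundaries K n \<Longrightarrow> h n z \<in> coboundaries L n"
    using map_one [of 0] by (simp add: coboundaries_def)
next
  case (Suc m)
  then show "z \<in> coboundaries K n \<Longrightarrow> h n z \<in> coboundaries L n"
    using map_coboundary [of _ m] hom_carrier [OF map_hom [of m]]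
    by (auto simp: coboundaries_def image_iff) 
qed

text \<open>The image of a coset of the coboundaries under \<open>h\<close> may be a proper part of a coset; the
factor \<open>coboundaries L n\<close> in \<^const>\<open>cohomology_map\<close> fills it up.\<close>

lemma map_class:
  assumes "z \<in> cocycles K n"
  shows "cohomology_map n K L (h n) (K.cohomology_class n z) = L.cohomology_class n (h n z)"
proof -
  interpret G: comm_group "cochains L n" by (rule L.comm_group)
  have B: "subgroup (coboundaries L n) (cochains L n)" by (rule L.subgroup_coboundaries)
  have z: "z \<in> carrier (cochains K n)" using assms K.cocycles_subset by auto
  have hz: "h n z \<in> carrier (cochains L n)" using map_hom [of n] z by (auto simp: hom_def)
  have h_mult: "h n (b \<otimes>\<^bsub>cochains K n\<^esub> z) = h n b \<otimes>\<^bsub>cochains L n\<^esub> h n z" if "b \<in> coboundaries K n" for b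
    using map_hom [of n] z that K.subgroup_coboundaries [of n, THEN subgroup.subset] by (auto simp: hom_def)
  show ?thesis
  proof
    show "cohomology_map n K L (h n) (K.cohomology_class n z) \<subseteq> L.cohomology_class n (h n z)"
    proof
      fix y assume "y \<in> cohomology_map n K L (h n) (K.cohomology_class n z)"
      then obtain a b where ab: "a \<in> coboundaries L n" "b \<in> coboundaries K n"
        "y = a \<otimes>\<^bsub>cochains L n\<^esub> h n (b \<otimes>\<^bsub>cochains K n\<^esub> z)"
        by (auto simp: cohomology_map_def set_mult_def K.cohomology_class_def r_coset_def)
      then have "y = (a \<otimes>\<^bsub>cochains L n\<^esub> h n b) \<otimes>\<^bsub>cochains L n\<^esub> h n z"
        using h_mult hz map_coboundaries subgroup.subset [OF B] by (simp add: G.m_assoc subset_iff)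
      moreover have "a \<otimes>\<^bsub>cochains L n\<^esub> h n b \<in> coboundaries L n"
        using ab map_coboundaries by (simp add: subgroup.m_closed [OF B])
      ultimately show "y \<in> L.cohomology_class n (h n z)"
        by (auto simp: L.cohomology_class_def r_coset_def)
    qed
    show "L.cohomology_class n (h n z) \<subseteq> cohomology_map n K L (h n) (K.cohomology_class n z)"
    proof
      fix y assume "y \<in> L.cohomology_class n (h n z)"
      then obtain a where a: "a \<in> coboundaries L n" "y = a \<otimes>\<^bsub>cochains L n\<^esub> h n z"
        by (auto simp: L.cohomology_class_def r_coset_def)
      have "z = \<one>\<^bsub>cochains K n\<^esub> \<otimes>\<^bsub>cochains K n\<^esub> z"
        using K.comm_group [of n] z by (simp add: comm_group_def group.is_monoid monoid.l_one)
      then have "z \<in> K.cohomology_class n z"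
        using K.one_coboundary [of n] by (auto simp: K.cohomology_class_def r_coset_def)
      then show "y \<in> cohomology_map n K L (h n) (K.cohomology_class n z)"
        using a by (auto simp: cohomology_map_def set_mult_def)
    qed
  qed
qed

lemma cohomology_map_hom:
  "cohomology_map n K L (h n) \<in> hom (cohomology K n) (cohomology L n)"
proof (rule homI)
  fix X assume "X \<in> carrier (cohomology K n)"
  then show "cohomology_map n K L (h n) X \<in> carrier (cohomology L n)"
    by (auto simp: K.carrier_cohomology map_class L.class_closed map_cocycle)
next
  fix X Y assume "X \<in> carrier (cohomology K n)" "Y \<in> carrier (cohomology K n)"
  then obtain x y where xy: "x \<in> cocycles K n" "y \<in> cocycles K n"
    "X = K.cohomology_class n x" "Y = K.cohomology_class n y"
    by (auto simp: K.carrier_cohomology)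
  moreover have "x \<otimes>\<^bsub>cochains K n\<^esub> y \<in> cocycles K n"
    using xy K.subgroup_cocycles by (simp add: subgroup.m_closed)
  moreover have "h n (x \<otimes>\<^bsub>cochains K n\<^esub> y) = h n x \<otimes>\<^bsub>cochains L n\<^esub> h n y"
    using xy K.cocycles_subset by (intro hom_mult [OF map_hom]) auto
  ultimately show "cohomology_map n K L (h n) (X \<otimes>\<^bsub>cohomology K n\<^esub> Y)
     = cohomology_map n K L (h n) X \<otimes>\<^bsub>cohomology L n\<^esub> cohomology_map n K L (h n) Y"
    by (simp add: K.class_mult L.class_mult map_class map_cocycle)
qed

text \<open>The surjectivity condition asks for a cocycle only up to a coboundary.\<close>

lemma cohomology_map_iso:
  assumes inj: "\<And>z. z \<in> cocycles K n \<Longrightarrow> h n z \<in> coboundaries L n \<Longrightarrow> z \<in> coboundaries K n"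
    and surj: "\<And>w. w \<in> cocycles L n \<Longrightarrow>
      \<exists>z\<in>cocycles K n. h n z \<otimes>\<^bsub>cochains L n\<^esub> inv\<^bsub>cochains L n\<^esub> w \<in> coboundaries L n"
  shows "cohomology_map n K L (h n) \<in> iso (cohomology K n) (cohomology L n)"
proof -
  interpret group_hom "cohomology K n" "cohomology L n" "cohomology_map n K L (h n)"
    using cohomology_map_hom K.comm_group_cohomology L.comm_group_cohomology
    by (simp add: group_hom_def group_hom_axioms_def comm_group_def)
  have "inj_on (cohomology_map n K L (h n)) (carrier (cohomology K n))"
    unfolding inj_on_one_iff
  proof (intro allI impI)
    fix X assume X: "X \<in> carrier (cohomology K n)" "cohomology_map n K L (h n) X = \<one>\<^bsub>cohomology L n\<^esub>"
    then obtain z where z: "z \<in> cocycles K n" "X = K.cohomology_class n z"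
      by (auto simp: K.carrier_cohomology)
    then have "h n z \<in> coboundaries L n"
      using X(2) L.class_eq_one_iff [OF map_cocycle [OF z(1)]] by (simp add: map_class)
    then show "X = \<one>\<^bsub>cohomology K n\<^esub>"
      using inj z by (simp add: K.class_eq_one_iff)
  qed
  moreover have "Y \<in> cohomology_map n K L (h n) ` carrier (cohomology K n)"
    if "Y \<in> carrier (cohomology L n)" for Y
  proof -
    obtain w where w: "w \<in> cocycles L n" "Y = L.cohomology_class n w"
      using \<open>Y \<in> carrier (cohomology L n)\<close> by (auto simp: L.carrier_cohomology)
    from surj [OF w(1)] obtain z where z: "z \<in> cocycles K n"
      "h n z \<otimes>\<^bsub>cochains L n\<^esub> inv\<^bsub>cochains L n\<^esub> w \<in> coboundaries L n" by blast
    then have "cohomology_map n K L (h n) (K.cohomology_class n z) = Y"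
      using w by (simp add: map_class L.class_eq_iff map_cocycle)
    then show ?thesis
      using z(1) K.class_closed by blast
  qed
  ultimately show ?thesis
    using hom_closed by (auto simp: iso_def bij_betw_def homh)
qed

end


section \<open>Directed systems and colimits\<close>

locale directed_system =
  fixes D :: "('i, 'a) group_system"
  assumes group: "i \<in> Index D \<Longrightarrow> group (Obj D i)"
    and nonempty: "Index D \<noteq> {}"
    and le_refl: "i \<in> Index D \<Longrightarrow> Le D i i"
    and le_trans: "Le D i j \<Longrightarrow> Le D j k \<Longrightarrow> Le D i k"
    and directed: "i \<in> Index D \<Longrightarrow> j \<in> Index D \<Longrightarrow> \<exists>k\<in>Index D. Le D i k \<and> Le D j k"
    and trans_hom: "i \<in> Index D \<Longrightarrow> j \<in> Index D \<Longrightarrow> Le D i j \<Longrightarrow> Trans D i j \<in> hom (Obj D i) (Obj D j)"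
    and trans_refl: "i \<in> Index D \<Longrightarrow> x \<in> carrier (Obj D i) \<Longrightarrow> Trans D i i x = x"
    and trans_trans: "i \<in> Index D \<Longrightarrow> j \<in> Index D \<Longrightarrow> k \<in> Index D \<Longrightarrow> Le D i j \<Longrightarrow> Le D j k \<Longrightarrow>
       x \<in> carrier (Obj D i) \<Longrightarrow> Trans D j k (Trans D i j x) = Trans D i k x"
begin

lemma trans_closed:
  "i \<in> Index D \<Longrightarrow> j \<in> Index D \<Longrightarrow> Le D i j \<Longrightarrow> x \<in> carrier (Obj D i) \<Longrightarrow> Trans D i j x \<in> carrier (Obj D j)"
  using trans_hom by (auto simp: hom_def)

abbreviation elements where "elements \<equiv> SIGMA i:Index D. carrier (Obj D i)"

lemma colimit_rel_iff:
  "((i, x), (j, y)) \<in> colimit_rel D \<longleftrightarrow> (i, x) \<in> elements \<and> (j, y) \<in> elements \<and>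
    (\<exists>k \<in> Index D. Le D i k \<and> Le D j k \<and> Trans D i k x = Trans D j k y)"
  by (auto simp: colimit_rel_def)

lemma equiv_colimit_rel: "equiv elements (colimit_rel D)"
proof (rule equivI)
  show "colimit_rel D \<subseteq> elements \<times> elements"
    by (auto simp: colimit_rel_def)
  show "refl_on elements (colimit_rel D)"
    using le_refl by (auto simp: refl_on_def colimit_rel_iff)
  show "sym (colimit_rel D)"
    by (rule symI) (auto simp: colimit_rel_def, metis)
  show "trans (colimit_rel D)"
  proof (rule transI)
    fix p q r assume pq: "(p, q) \<in> colimit_rel D" and qr: "(q, r) \<in> colimit_rel D"
    obtain i x j y l z where eqs: "p = (i, x)" "q = (j, y)" "r = (l, z)"
      by (cases p, cases q, cases r)
    obtain k m where km: "k \<in> Index D" "Le D i k" "Le D j k" "Trans D i k x = Trans D j k y"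
        "m \<in> Index D" "Le D j m" "Le D l m" "Trans D j m y = Trans D l m z"
      using pq qr unfolding eqs colimit_rel_iff by blast
    have mem: "(i, x) \<in> elements" "(j, y) \<in> elements" "(l, z) \<in> elements"
      using pq qr unfolding eqs colimit_rel_iff by auto
    obtain u where u: "u \<in> Index D" "Le D k u" "Le D m u"
      using directed km by meson
    have "Trans D k u (Trans D i k x) = Trans D i u x" "Trans D k u (Trans D j k y) = Trans D j u y"
      "Trans D m u (Trans D j m y) = Trans D j u y" "Trans D m u (Trans D l m z) = Trans D l u z"
      using km(1-3,5-7) u mem by (auto intro!: trans_trans)
    then have "Trans D i u x = Trans D l u z"
      using km by metis
    moreover have "Le D i u" "Le D l u"
      using km u le_trans by blast+
    ultimately show "(p, r) \<in> colimit_rel D"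
      unfolding eqs colimit_rel_iff using mem u by blast
  qed
qed

definition germ :: "'i \<Rightarrow> 'a \<Rightarrow> ('i \<times> 'a) set" where
  "germ i x = colimit_rel D `` {(i, x)}"

lemma germ_eq_iff:
  assumes "(i, x) \<in> elements" "(j, y) \<in> elements"
  shows "germ i x = germ j y \<longleftrightarrow> (\<exists>k \<in> Index D. Le D i k \<and> Le D j k \<and> Trans D i k x = Trans D j k y)"
  unfolding germ_def
  using eq_equiv_class_iff [OF equiv_colimit_rel assms] assms by (simp add: colimit_rel_iff)

lemma mem_germ_iff: "p \<in> germ i x \<longleftrightarrow> ((i, x), p) \<in> colimit_rel D"
  by (simp add: germ_def)

lemma germ_mem_eq: "(j, y) \<in> germ i x \<Longrightarrow> germ j y = germ i x"
  unfolding germ_def using equiv_class_eq [OF equiv_colimit_rel] by fastforce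

lemma self_mem_germ: "(i, x) \<in> elements \<Longrightarrow> (i, x) \<in> germ i x"
  unfolding germ_def using equiv_class_self [OF equiv_colimit_rel] by fastforce

lemma germ_trans:
  assumes "(i, x) \<in> elements" "j \<in> Index D" "Le D i j"
  shows "germ j (Trans D i j x) = germ i x"
  using assms le_refl trans_closed
  by (subst germ_eq_iff) (auto intro!: bexI [of _ j] simp: trans_refl)

lemma carrier_colimit: "carrier (colimit D) = (\<lambda>(i, x). germ i x) ` elements"
  by (force simp: colimit_def quotient_def germ_def)

lemma germ_closed: "(i, x) \<in> elements \<Longrightarrow> germ i x \<in> carrier (colimit D)"
  by (force simp: carrier_colimit)

text \<open>The product in a colimit and the map induced between colimits are defined by saturating
a set of representatives. This lemma evaluates them: if all representatives belong to one class, the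
saturation is that class.\<close>

lemma Image_subset_germ:
  assumes "S \<subseteq> germ i x" "S \<noteq> {}"
  shows "colimit_rel D `` S = germ i x"
proof -
  have "colimit_rel D `` S = (\<Union>p\<in>S. germ (fst p) (snd p))"
    by (auto simp: germ_def)
  also have "\<dots> = (\<Union>p\<in>S. germ i x)"
  proof (rule SUP_cong [OF HOL.refl])
    fix p assume "p \<in> S"
    then have "(fst p, snd p) \<in> germ i x" using assms(1) by auto
    then show "germ (fst p) (snd p) = germ i x" by (rule germ_mem_eq)
  qed
  also have "\<dots> = germ i x" using assms(2) by simp
  finally show ?thesis .
qed

text \<open>Any two representatives of a class agree at a later index, so all the products that enter
the definition of the multiplication represent the same class.\<close>

lemma germ_mult:
  assumes x: "(i, x) \<in> elements" and y: "(i, y) \<in> elements"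
  shows "germ i x \<otimes>\<^bsub>colimit D\<^esub> germ i y = germ i (x \<otimes>\<^bsub>Obj D i\<^esub> y)"
proof -
  let ?S = "{(k, Trans D j k x' \<otimes>\<^bsub>Obj D k\<^esub> Trans D l k y') | j x' l y' k.
         (j, x') \<in> germ i x \<and> (l, y') \<in> germ i y \<and> k \<in> Index D \<and> Le D j k \<and> Le D l k}"
  have xy: "(i, x \<otimes>\<^bsub>Obj D i\<^esub> y) \<in> elements"
    using x y group by (auto simp: group.is_monoid monoid.m_closed)
  have "(k, Trans D j k x' \<otimes>\<^bsub>Obj D k\<^esub> Trans D l k y') \<in> germ i (x \<otimes>\<^bsub>Obj D i\<^esub> y)"
    if j: "(j, x') \<in> germ i x" and l: "(l, y') \<in> germ i y" and k: "k \<in> Index D" "Le D j k" "Le D l k"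
    for j x' l y' k
  proof -
    have mem: "(j, x') \<in> elements" "(l, y') \<in> elements"
      using j l by (auto simp: mem_germ_iff colimit_rel_iff)
    let ?x = "Trans D j k x'" and ?y = "Trans D l k y'"
    have k_mem: "(k, ?x) \<in> elements" "(k, ?y) \<in> elements"
      using mem k trans_closed by auto
    have "germ k ?x = germ i x" "germ k ?y = germ i y"
      using germ_trans mem k germ_mem_eq j l by metis+
    then obtain a b where a: "a \<in> Index D" "Le D k a" "Le D i a" "Trans D k a ?x = Trans D i a x"
      and b: "b \<in> Index D" "Le D k b" "Le D i b" "Trans D k b ?y = Trans D i b y"
      using germ_eq_iff [OF k_mem(1) x] germ_eq_iff [OF k_mem(2) y] by auto
    obtain u where u: "u \<in> Index D" "Le D a u" "Le D b u"
      using directed a b by meson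
    have ku: "Le D k u" and iu: "Le D i u" using a u le_trans by blast+
    have "Trans D a u (Trans D k a ?x) = Trans D k u ?x" "Trans D a u (Trans D i a x) = Trans D i u x"
      using a(1-3) u k_mem x by (auto intro!: trans_trans)
    then have 1: "Trans D k u ?x = Trans D i u x"
      using a(4) by metis
    have "Trans D b u (Trans D k b ?y) = Trans D k u ?y" "Trans D b u (Trans D i b y) = Trans D i u y"
      using b(1-3) u k_mem y by (auto intro!: trans_trans)
    then have 2: "Trans D k u ?y = Trans D i u y"
      using b(4) by metis
    have "Trans D k u (?x \<otimes>\<^bsub>Obj D k\<^esub> ?y) = Trans D k u ?x \<otimes>\<^bsub>Obj D u\<^esub> Trans D k u ?y"
      using k_mem u ku by (intro hom_mult [OF trans_hom]) auto
    also have "\<dots> = Trans D i u (x \<otimes>\<^bsub>Obj D i\<^esub> y)"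
      unfolding 1 2 using x y u iu by (intro hom_mult [OF trans_hom, symmetric]) auto
    finally have "germ k (?x \<otimes>\<^bsub>Obj D k\<^esub> ?y) = germ i (x \<otimes>\<^bsub>Obj D i\<^esub> y)"
      using k_mem xy u ku iu group by (subst germ_eq_iff) (auto simp: group.is_monoid monoid.m_closed)
    moreover have "(k, ?x \<otimes>\<^bsub>Obj D k\<^esub> ?y) \<in> elements"
      using k_mem group by (auto simp: group.is_monoid monoid.m_closed)
    ultimately show ?thesis
      using self_mem_germ by metis
  qed
  then have "?S \<subseteq> germ i (x \<otimes>\<^bsub>Obj D i\<^esub> y)" by blast
  moreover have "?S \<noteq> {}"
    using self_mem_germ [OF x] self_mem_germ [OF y] x le_refl by blast
  ultimately have "colimit_rel D `` ?S = germ i (x \<otimes>\<^bsub>Obj D i\<^esub> y)"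
    by (rule Image_subset_germ)
  then show ?thesis by (simp add: colimit_def)
qed

lemma germ_common:
  assumes "X \<in> carrier (colimit D)" "Y \<in> carrier (colimit D)"
  obtains i x y where "(i, x) \<in> elements" "(i, y) \<in> elements" "X = germ i x" "Y = germ i y"
proof -
  obtain i x j y where X: "(i, x) \<in> elements" "X = germ i x" and Y: "(j, y) \<in> elements" "Y = germ j y"
    using assms by (auto simp: carrier_colimit)
  obtain k where k: "k \<in> Index D" "Le D i k" "Le D j k"
    using directed X Y by blast
  show thesis
  proof
    show "(k, Trans D i k x) \<in> elements" "(k, Trans D j k y) \<in> elements"
      using X Y k trans_closed by auto
    show "X = germ k (Trans D i k x)" "Y = germ k (Trans D j k y)"
      using germ_trans X Y k by auto
  qed
qed

text \<open>Two elements of a colimit have representatives at a common index, so being an isomorphism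
can be tested on the objects of the system.\<close>

lemma colimit_iso:
  assumes germ_F: "\<And>i x. (i, x) \<in> elements \<Longrightarrow> F (germ i x) = \<phi> i x"
    and closed: "\<And>i x. (i, x) \<in> elements \<Longrightarrow> \<phi> i x \<in> carrier H"
    and mult: "\<And>i x y. (i, x) \<in> elements \<Longrightarrow> (i, y) \<in> elements \<Longrightarrow>
        \<phi> i (x \<otimes>\<^bsub>Obj D i\<^esub> y) = \<phi> i x \<otimes>\<^bsub>H\<^esub> \<phi> i y"
    and inj: "\<And>i x y. (i, x) \<in> elements \<Longrightarrow> (i, y) \<in> elements \<Longrightarrow> \<phi> i x = \<phi> i y \<Longrightarrow> germ i x = germ i y"
    and surj: "\<And>h. h \<in> carrier H \<Longrightarrow> \<exists>i x. (i, x) \<in> elements \<and> \<phi> i x = h"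
  shows "F \<in> iso (colimit D) H"
  unfolding iso_def bij_betw_def
proof (intro CollectI conjI)
  have mult_closed: "(i, x \<otimes>\<^bsub>Obj D i\<^esub> y) \<in> elements" if "(i, x) \<in> elements" "(i, y) \<in> elements" for i x y
    using that group by (auto simp: group.is_monoid monoid.m_closed)
  show "F \<in> hom (colimit D) H"
  proof (rule homI)
    show "F X \<in> carrier H" if "X \<in> carrier (colimit D)" for X
      using that germ_F closed by (auto simp: carrier_colimit)
    fix X Y assume "X \<in> carrier (colimit D)" "Y \<in> carrier (colimit D)"
    then obtain i x y where *: "(i, x) \<in> elements" "(i, y) \<in> elements" "X = germ i x" "Y = germ i y"
      by (rule germ_common)
    show "F (X \<otimes>\<^bsub>colimit D\<^esub> Y) = F X \<otimes>\<^bsub>H\<^esub> F Y"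
      unfolding *(3,4) germ_mult [OF *(1,2)] germ_F [OF mult_closed [OF *(1,2)]]
        germ_F [OF *(1)] germ_F [OF *(2)] by (rule mult [OF *(1,2)])
  qed
  show "inj_on F (carrier (colimit D))"
  proof (rule inj_onI)
    fix X Y assume "X \<in> carrier (colimit D)" "Y \<in> carrier (colimit D)" and eq: "F X = F Y"
    then obtain i x y where *: "(i, x) \<in> elements" "(i, y) \<in> elements" "X = germ i x" "Y = germ i y"
      by (blast intro: germ_common)
    then show "X = Y" using inj eq germ_F by metis
  qed
  show "F ` carrier (colimit D) = carrier H"
  proof
    show "F ` carrier (colimit D) \<subseteq> carrier H"
      using germ_F closed by (auto simp: carrier_colimit)
    show "carrier H \<subseteq> F ` carrier (colimit D)"
    proof
      fix h assume "h \<in> carrier H"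
      then obtain i x where ix: "(i, x) \<in> elements" "\<phi> i x = h" using surj by blast
      then have "h = F (germ i x)" using germ_F [OF ix(1)] by simp
      then show "h \<in> F ` carrier (colimit D)" using germ_closed [OF ix(1)] by (rule image_eqI)
    qed
  qed
qed

lemma colimit_mult_closed:
  assumes "X \<in> carrier (colimit D)" "Y \<in> carrier (colimit D)"
  shows "X \<otimes>\<^bsub>colimit D\<^esub> Y \<in> carrier (colimit D)"
proof -
  obtain i x y where *: "(i, x) \<in> elements" "(i, y) \<in> elements" "X = germ i x" "Y = germ i y"
    using assms by (rule germ_common)
  then have "(i, x \<otimes>\<^bsub>Obj D i\<^esub> y) \<in> elements"
    using group by (auto simp: group.is_monoid monoid.m_closed)
  then show ?thesis
    unfolding *(3,4) germ_mult [OF *(1,2)] by (rule germ_closed)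
qed

lemma colimit_iso_cong:
  assumes F: "F \<in> iso (colimit D) H" and eq: "\<And>X. X \<in> carrier (colimit D) \<Longrightarrow> F' X = F X"
  shows "F' \<in> iso (colimit D) H"
proof -
  have "F' \<in> hom (colimit D) H"
    using F eq colimit_mult_closed by (simp add: iso_def hom_def Pi_iff)
  moreover have "bij_betw F' (carrier (colimit D)) (carrier H)"
    using F bij_betw_cong [of "carrier (colimit D)" F' F] eq by (simp add: iso_def)
  ultimately show ?thesis by (simp add: iso_def)
qed

lemma colimit_desc_germ:
  assumes "\<And>i j x. i \<in> Index D \<Longrightarrow> j \<in> Index D \<Longrightarrow> Le D i j \<Longrightarrow> x \<in> carrier (Obj D i) \<Longrightarrow> \<phi> j (Trans D i j x) = \<phi> i x"
    and x: "(i, x) \<in> elements"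
  shows "colimit_desc \<phi> (germ i x) = \<phi> i x"
proof -
  have eq: "\<phi> j y = \<phi> i x" if jy: "(j, y) \<in> germ i x" for j y
  proof -
    obtain k where "(j, y) \<in> elements" "k \<in> Index D" "Le D i k" "Le D j k" "Trans D i k x = Trans D j k y"
      using jy by (auto simp: mem_germ_iff colimit_rel_iff)
    then show ?thesis
      using assms(1) [of i k x] assms(1) [of j k y] x by auto
  qed
  have "(\<lambda>(i, x). \<phi> i x) ` germ i x = {\<phi> i x}"
  proof
    show "(\<lambda>(i, x). \<phi> i x) ` germ i x \<subseteq> {\<phi> i x}"
      using eq by auto
    show "{\<phi> i x} \<subseteq> (\<lambda>(i, x). \<phi> i x) ` germ i x"
      using self_mem_germ [OF x] by (auto intro: image_eqI [of _ _ "(i, x)"])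
  qed
  then show ?thesis by (simp add: colimit_desc_def)
qed

text \<open>By directedness, injectivity on the colimit is a condition on kernels: whatever \<open>\<phi> i\<close> kills
must vanish at some later index.\<close>

lemma colimit_desc_iso:
  assumes hom: "\<And>i. i \<in> Index D \<Longrightarrow> \<phi> i \<in> hom (Obj D i) H" and H: "group H"
    and natural: "\<And>i j x. i \<in> Index D \<Longrightarrow> j \<in> Index D \<Longrightarrow> Le D i j \<Longrightarrow> x \<in> carrier (Obj D i) \<Longrightarrow>
        \<phi> j (Trans D i j x) = \<phi> i x"
    and inj: "\<And>i x. i \<in> Index D \<Longrightarrow> x \<in> carrier (Obj D i) \<Longrightarrow> \<phi> i x = \<one>\<^bsub>H\<^esub> \<Longrightarrow>
        \<exists>k\<in>Index D. Le D i k \<and> Trans D i k x = \<one>\<^bsub>Obj D k\<^esub>"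
    and surj: "\<And>h. h \<in> carrier H \<Longrightarrow> \<exists>i\<in>Index D. \<exists>x\<in>carrier (Obj D i). \<phi> i x = h"
  shows "colimit_desc \<phi> \<in> iso (colimit D) H"
proof (rule colimit_iso)
  show "colimit_desc \<phi> (germ i x) = \<phi> i x" if "(i, x) \<in> elements" for i x
    using natural that by (rule colimit_desc_germ)
  show "\<phi> i x \<in> carrier H" if "(i, x) \<in> elements" for i x
    using hom that by (auto simp: hom_def)
  show "\<phi> i (x \<otimes>\<^bsub>Obj D i\<^esub> y) = \<phi> i x \<otimes>\<^bsub>H\<^esub> \<phi> i y" if "(i, x) \<in> elements" "(i, y) \<in> elements" for i x y
    using that by (intro hom_mult [OF hom]) auto
  show "\<exists>i x. (i, x) \<in> elements \<and> \<phi> i x = h" if "h \<in> carrier H" for h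
    using surj [OF that] by blast
  show "germ i x = germ i y" if x: "(i, x) \<in> elements" and y: "(i, y) \<in> elements" and eq: "\<phi> i x = \<phi> i y" for i x y
  proof -
    have i: "i \<in> Index D" and xy: "x \<in> carrier (Obj D i)" "y \<in> carrier (Obj D i)" using x y by auto
    interpret G: group "Obj D i" using i by (rule group)
    interpret f: group_hom "Obj D i" H "\<phi> i"
      using hom [OF i] H G.group_axioms by (simp add: group_hom_def group_hom_axioms_def)
    have one: "\<phi> i (x \<otimes>\<^bsub>Obj D i\<^esub> inv\<^bsub>Obj D i\<^esub> y) = \<one>\<^bsub>H\<^esub>"
      using xy eq by simp
    have "x \<otimes>\<^bsub>Obj D i\<^esub> inv\<^bsub>Obj D i\<^esub> y \<in> carrier (Obj D i)"
      using xy by simp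
    from inj [OF i this one] obtain k where k: "k \<in> Index D" "Le D i k"
        "Trans D i k (x \<otimes>\<^bsub>Obj D i\<^esub> inv\<^bsub>Obj D i\<^esub> y) = \<one>\<^bsub>Obj D k\<^esub>"
      by blast
    interpret T: group_hom "Obj D i" "Obj D k" "Trans D i k"
      using trans_hom [OF i k(1,2)] G.group_axioms group [OF k(1)] by (simp add: group_hom_def group_hom_axioms_def)
    have "Trans D i k x \<otimes>\<^bsub>Obj D k\<^esub> inv\<^bsub>Obj D k\<^esub> Trans D i k y = \<one>\<^bsub>Obj D k\<^esub>"
      using k(3) xy by simp
    then have "Trans D i k x = Trans D i k y"
      using T.H.inv_equality [of "Trans D i k x" "inv\<^bsub>Obj D k\<^esub> Trans D i k y"] xy by simp
    then show ?thesis
      using germ_eq_iff [OF x y] k by blast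
  qed
qed

end

lemma colimit_map_germ:
  assumes D: "directed_system D" and E: "directed_system E"
    and same: "Index E = Index D" "Le E = Le D"
    and hom: "\<And>i. i \<in> Index D \<Longrightarrow> \<phi> i \<in> hom (Obj D i) (Obj E i)"
    and natural: "\<And>i j x. i \<in> Index D \<Longrightarrow> j \<in> Index D \<Longrightarrow> Le D i j \<Longrightarrow> x \<in> carrier (Obj D i) \<Longrightarrow>
        \<phi> j (Trans D i j x) = Trans E i j (\<phi> i x)"
    and x: "i \<in> Index D" "x \<in> carrier (Obj D i)"
  shows "colimit_map E \<phi> (directed_system.germ D i x) = directed_system.germ E i (\<phi> i x)"
proof -
  interpret D: directed_system D by fact
  interpret E: directed_system E by fact
  have mem: "(i, \<phi> i x) \<in> E.elements" if "(i, x) \<in> D.elements" for i x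
    using that hom same by (auto simp: hom_def)
  have x: "(i, x) \<in> D.elements" using x by simp
  show ?thesis
    unfolding colimit_map_def
  proof (rule E.Image_subset_germ)
    show "(\<lambda>(i, x). (i, \<phi> i x)) ` D.germ i x \<noteq> {}"
      using D.self_mem_germ [OF x] by blast
    show "(\<lambda>(i, x). (i, \<phi> i x)) ` D.germ i x \<subseteq> E.germ i (\<phi> i x)"
    proof clarify
      fix j y assume "(j, y) \<in> D.germ i x"
      then obtain k where y: "(j, y) \<in> D.elements" and k: "k \<in> Index D" "Le D i k" "Le D j k"
          "Trans D i k x = Trans D j k y"
        by (auto simp: D.mem_germ_iff D.colimit_rel_iff)
      then have "Trans E i k (\<phi> i x) = Trans E j k (\<phi> j y)"
        using natural [of i k x] natural [of j k y] x by auto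
      then show "(j, \<phi> j y) \<in> E.germ i (\<phi> i x)"
        using mem [OF x] mem [OF y] k same by (auto simp: E.mem_germ_iff E.colimit_rel_iff)
    qed
  qed
qed

text \<open>The individual maps \<open>\<phi> i\<close> may be far from bijective: kernels need to vanish, and elements
need to acquire preimages, only at a later index. This is what an inverse up to shrinking the
neighbourhood, such as smoothing, provides.\<close>

lemma colimit_map_iso:
  assumes D: "directed_system D" and E: "directed_system E"
    and same: "Index E = Index D" "Le E = Le D"
    and hom: "\<And>i. i \<in> Index D \<Longrightarrow> \<phi> i \<in> hom (Obj D i) (Obj E i)"
    and natural: "\<And>i j x. i \<in> Index D \<Longrightarrow> j \<in> Index D \<Longrightarrow> Le D i j \<Longrightarrow> x \<in> carrier (Obj D i) \<Longrightarrow>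
        \<phi> j (Trans D i j x) = Trans E i j (\<phi> i x)"
    and inj: "\<And>i x. i \<in> Index D \<Longrightarrow> x \<in> carrier (Obj D i) \<Longrightarrow> \<phi> i x = \<one>\<^bsub>Obj E i\<^esub> \<Longrightarrow>
        \<exists>k\<in>Index D. Le D i k \<and> Trans D i k x = \<one>\<^bsub>Obj D k\<^esub>"
    and surj: "\<And>i y. i \<in> Index D \<Longrightarrow> y \<in> carrier (Obj E i) \<Longrightarrow>
        \<exists>k\<in>Index D. Le D i k \<and> (\<exists>x\<in>carrier (Obj D k). \<phi> k x = Trans E i k y)"
  shows "colimit_map E \<phi> \<in> iso (colimit D) (colimit E)"
proof -
  interpret D: directed_system D by fact
  interpret E: directed_system E by fact
  have mem: "(i, \<phi> i x) \<in> E.elements" if "(i, x) \<in> D.elements" for i x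
    using that hom same by (auto simp: hom_def)
  have germ: "colimit_map E \<phi> (D.germ i x) = E.germ i (\<phi> i x)" if "(i, x) \<in> D.elements" for i x
    using colimit_map_germ [OF D E same hom natural] that by blast
  show ?thesis
  proof (rule D.colimit_iso [where \<phi> = "\<lambda>i x. E.germ i (\<phi> i x)"])
    show "colimit_map E \<phi> (D.germ i x) = E.germ i (\<phi> i x)" if "(i, x) \<in> D.elements" for i x
      using that by (rule germ)
    show "E.germ i (\<phi> i x) \<in> carrier (colimit E)" if "(i, x) \<in> D.elements" for i x
      using mem [OF that] by (rule E.germ_closed)
    show "E.germ i (\<phi> i (x \<otimes>\<^bsub>Obj D i\<^esub> y)) = E.germ i (\<phi> i x) \<otimes>\<^bsub>colimit E\<^esub> E.germ i (\<phi> i y)"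
      if "(i, x) \<in> D.elements" "(i, y) \<in> D.elements" for i x y
      using that E.germ_mult [OF mem mem] hom_mult [OF hom] by auto
    show "\<exists>i x. (i, x) \<in> D.elements \<and> E.germ i (\<phi> i x) = h" if h: "h \<in> carrier (colimit E)" for h
    proof -
      obtain i y where y: "(i, y) \<in> E.elements" "h = E.germ i y"
        using h by (auto simp: E.carrier_colimit)
      then obtain k x where "k \<in> Index D" "Le D i k" "x \<in> carrier (Obj D k)" "\<phi> k x = Trans E i k y"
        using surj [of i y] same by auto
      then show ?thesis
        using E.germ_trans [OF y(1), of k] y(2) same by (intro exI [of _ k] exI [of _ x]) auto
    qed
    show "D.germ i x = D.germ i y"
      if x: "(i, x) \<in> D.elements" and y: "(i, y) \<in> D.elements" and eq: "E.germ i (\<phi> i x) = E.germ i (\<phi> i y)" for i x y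
    proof -
      have i: "i \<in> Index D" and xy: "x \<in> carrier (Obj D i)" "y \<in> carrier (Obj D i)" using x y by auto
      obtain k where k: "k \<in> Index D" "Le D i k" "Trans E i k (\<phi> i x) = Trans E i k (\<phi> i y)"
        using eq E.germ_eq_iff [OF mem [OF x] mem [OF y]] same by auto
      let ?x = "Trans D i k x" and ?y = "Trans D i k y"
      have xy': "?x \<in> carrier (Obj D k)" "?y \<in> carrier (Obj D k)"
        using D.trans_closed i k xy by auto
      have eq': "\<phi> k ?x = \<phi> k ?y"
        using k natural [OF i k(1,2)] xy by simp
      interpret G: group "Obj D k" using k(1) by (rule D.group)
      interpret f: group_hom "Obj D k" "Obj E k" "\<phi> k"
        using hom [OF k(1)] G.group_axioms E.group [of k] k same by (simp add: group_hom_def group_hom_axioms_def)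
      have one: "\<phi> k (?x \<otimes>\<^bsub>Obj D k\<^esub> inv\<^bsub>Obj D k\<^esub> ?y) = \<one>\<^bsub>Obj E k\<^esub>"
        using xy' eq' by simp
      have "?x \<otimes>\<^bsub>Obj D k\<^esub> inv\<^bsub>Obj D k\<^esub> ?y \<in> carrier (Obj D k)"
        using xy' by simp
      from inj [OF k(1) this one] obtain l where l: "l \<in> Index D" "Le D k l"
          "Trans D k l (?x \<otimes>\<^bsub>Obj D k\<^esub> inv\<^bsub>Obj D k\<^esub> ?y) = \<one>\<^bsub>Obj D l\<^esub>"
        by blast
      interpret T: group_hom "Obj D k" "Obj D l" "Trans D k l"
        using D.trans_hom [OF k(1) l(1,2)] G.group_axioms D.group [OF l(1)] by (simp add: group_hom_def group_hom_axioms_def)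
      have "Trans D k l ?x \<otimes>\<^bsub>Obj D l\<^esub> inv\<^bsub>Obj D l\<^esub> Trans D k l ?y = \<one>\<^bsub>Obj D l\<^esub>"
        using l(3) xy' by simp
      then have "Trans D k l ?x = Trans D k l ?y"
        using T.H.inv_equality [of "Trans D k l ?x" "inv\<^bsub>Obj D l\<^esub> Trans D k l ?y"] xy' by simp
      then have "D.germ k ?x = D.germ k ?y"
        using D.germ_eq_iff xy' k l by auto
      then show ?thesis
        using D.germ_trans [OF x k(1,2)] D.germ_trans [OF y k(1,2)] by simp
    qed
  qed
qed


section \<open>Smoothing functions on lists\<close>

text \<open>A cochain of degree \<open>q\<close> is regarded as a function on lists of length \<open>q + 1\<close>. Splitting
off the first entry gives a recursion for the coboundary, which turns the usual calculations with
indices into inductions on lists. The complex is augmented: on a one-element list the coboundary is the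
value at the empty list.\<close>

fun list_coboundary :: "('a list \<Rightarrow> 'v::ab_group_add) \<Rightarrow> 'a list \<Rightarrow> 'v" where
  "list_coboundary f [] = 0"
| "list_coboundary f (x # xs) = f xs - list_coboundary (\<lambda>ys. f (x # ys)) xs"

lemma list_coboundary_diff:
  "list_coboundary (\<lambda>ys. f ys - g ys) xs = list_coboundary f xs - list_coboundary g xs"
proof (induction xs arbitrary: f g)
  case (Cons x xs)
  show ?case by (simp add: Cons.IH)
qed simp

definition delete_nth :: "nat \<Rightarrow> 'a list \<Rightarrow> 'a list" where
  "delete_nth k xs = take k xs @ drop (Suc k) xs"

lemma set_delete_nth: "set (delete_nth k xs) \<subseteq> set xs"
  by (auto simp: delete_nth_def dest: in_set_takeD in_set_dropD)

lemma list_coboundary_eq_sum: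
  "list_coboundary f xs =
    (\<Sum>k<length xs. if even k then f (delete_nth k xs)
                                else - f (delete_nth k xs))"
proof (induction xs arbitrary: f)
  case (Cons x xs)
  have "(\<Sum>k<length xs. if even k then - f (x # delete_nth k xs)
            else f (x # delete_nth k xs)) =
      - (\<Sum>k<length xs. if even k then f (x # delete_nth k xs)
            else - f (x # delete_nth k xs))"
    unfolding sum_negf [symmetric] by (rule sum.cong) auto
  also have "(\<Sum>k<length xs. if even k then - f (x # delete_nth k xs)
            else f (x # delete_nth k xs)) = 
       (\<Sum>k<length xs. if odd k then f (x # delete_nth k xs)
            else - f (x # delete_nth k xs))"
    by (rule sum.cong) auto
  finally show ?case
    by (simp add: delete_nth_def Cons.IH sum.lessThan_Suc_shift del: sum.lessThan_Suc cong: if_cong)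
qed simp

text \<open>The endomorphism \<open>T k x\<close> of \<open>V\<close> is the weight at \<open>x\<close> of the \<open>k\<close>-th layer of a partition of unity, and
\<open>c k x\<close> is the point at which functions are sampled on that layer. The last assumption expresses that
a layer consists of separated pieces with one sample point each: near \<open>x\<close>, the weight vanishes wherever
the sample point differs from a fixed point close to \<open>x\<close>.\<close>

locale smoothing =
  fixes T :: "nat \<Rightarrow> 'g::topological_space \<Rightarrow> 'v::topological_ab_group_add \<Rightarrow> 'v"
    and c :: "nat \<Rightarrow> 'g \<Rightarrow> 'g" and near :: "'g \<Rightarrow> 'g \<Rightarrow> bool"
  assumes T_add: "T k x (v + w) = T k x v + T k x w"
    and T_cont: "((\<lambda>(y, w). T k y w) \<longlongrightarrow> T k x v) (nhds (x, v))"
    and T_locally_finite: "\<exists>M. \<forall>\<^sub>F y in nhds x. \<forall>k\<ge>M. \<forall>v. T k y v = 0"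
    and T_sum: "(\<forall>k\<ge>M. \<forall>v. T k x v = 0) \<Longrightarrow> (\<Sum>k<M. T k x v) = v"
    and c_local: "(\<forall>\<^sub>F y in nhds x. \<forall>v. T k y v = 0) \<or>
      (\<exists>z. near x z \<and> (\<forall>\<^sub>F y in nhds x. (\<forall>v. T k y v = 0) \<or> c k y = z))"
begin

lemma T_zero [simp]: "T k x 0 = 0"
  using T_add [of k x 0 0] by simp

lemma T_diff: "T k x (v - w) = T k x v - T k x w"
  using T_add [of k x "v - w" w] by simp

definition avg :: "('g \<Rightarrow> 'v) \<Rightarrow> 'g \<Rightarrow> 'v" where
  "avg F x = (\<Sum>k | \<exists>v. T k x v \<noteq> 0. T k x (F (c k x)))"

lemma avg_eq:
  assumes "\<forall>k\<ge>M. \<forall>v. T k x v = 0"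
  shows "avg F x = (\<Sum>k<M. T k x (F (c k x)))"
  unfolding avg_def
proof (rule sum.mono_neutral_left)
  show "{k. \<exists>v. T k x v \<noteq> 0} \<subseteq> {..<M}"
    using assms not_le by auto
qed auto

lemma bound: obtains M where "\<forall>k\<ge>M. \<forall>v. T k x v = 0"
proof -
  obtain M where M: "\<forall>\<^sub>F y in nhds x. \<forall>k\<ge>M. \<forall>v. T k y v = 0"
    using T_locally_finite by blast
  show thesis
    by (rule that [OF eventually_nhds_x_imp_x [OF M]])
qed

lemma near_center:
  assumes "T k x v \<noteq> 0" shows "near x (c k x)"
  using c_local [where x=x and k=k]
proof (elim disjE exE conjE)
  assume "\<forall>\<^sub>F y in nhds x. \<forall>v. T k y v = 0"
  from eventually_nhds_x_imp_x [OF this] show ?thesis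
    using assms by blast
next
  fix z assume "near x z" and "\<forall>\<^sub>F y in nhds x. (\<forall>v. T k y v = 0) \<or> c k y = z"
  from eventually_nhds_x_imp_x [OF this(2)] show ?thesis
    using assms \<open>near x z\<close> by blast
qed

lemma avg_const: "avg (\<lambda>_. v) x = v"
proof -
  obtain M where "\<forall>k\<ge>M. \<forall>v. T k x v = 0"
    by (rule bound)
  then show ?thesis
    by (simp add: avg_eq T_sum)
qed

lemma avg_diff: "avg (\<lambda>y. F y - G y) x = avg F x - avg G x"
  unfolding avg_def by (simp add: T_diff sum_subtractf)

lemma avg_cong:
  assumes "\<And>y. near x y \<Longrightarrow> F y = G y" shows "avg F x = avg G x"
  unfolding avg_def
proof (intro sum.cong refl)
  fix k assume "k \<in> {k. \<exists>v. T k x v \<noteq> 0}"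
  then obtain v where "T k x v \<noteq> 0"
    by blast
  then show "T k x (F (c k x)) = T k x (G (c k x))"
    by (simp add: assms [OF near_center])
qed

text \<open>Every entry is averaged separately. The weights of different entries need not commute; the
weight of the first entry is applied last.\<close>

fun smooth :: "('g list \<Rightarrow> 'v) \<Rightarrow> 'g list \<Rightarrow> 'v" where
  "smooth f [] = f []"
| "smooth f (x # xs) = avg (\<lambda>y. smooth (\<lambda>ys. f (y # ys)) xs) x"

text \<open>This is the prism operator: the alternating sum over \<open>k\<close> of \<open>f\<close> evaluated at the entries up to the
\<open>k\<close>-th followed by the averages of the entries from the \<open>k\<close>-th on. The recursion separates the
summand for the first entry, which is both kept and averaged.\<close>

fun smooth_homotopy :: "('g list \<Rightarrow> 'v) \<Rightarrow> 'g list \<Rightarrow> 'v" where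
  "smooth_homotopy f [] = 0"
| "smooth_homotopy f (x # xs) =
    smooth (\<lambda>ys. f (x # ys)) (x # xs) - smooth_homotopy (\<lambda>ys. f (x # ys)) xs"

lemma smooth_diff: "smooth (\<lambda>ys. f ys - g ys) xs = smooth f xs - smooth g xs"
proof (induction xs arbitrary: f g)
  case (Cons x xs)
  show ?case by (simp add: Cons.IH avg_diff)
qed simp

lemma smooth_homotopy_diff:
  "smooth_homotopy (\<lambda>ys. f ys - g ys) xs = smooth_homotopy f xs - smooth_homotopy g xs"
proof (induction xs arbitrary: f g)
  case (Cons x xs)
  have "smooth (\<lambda>ys. f (x # ys) - g (x # ys)) (x # xs) =
        smooth (\<lambda>ys. f (x # ys)) (x # xs) - smooth (\<lambda>ys. g (x # ys)) (x # xs)"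
    by (rule smooth_diff)
  then show ?case by (simp add: Cons.IH del: smooth.simps)
qed simp

text \<open>A face of the averaged cochain is an average over a deleted entry, of which \<open>f\<close> is then independent,
so it has no effect because the weights sum to the identity.\<close>

lemma smooth_coboundary: "smooth (list_coboundary f) xs = list_coboundary (smooth f) xs"
proof (induction xs arbitrary: f)
  case (Cons x xs)
  have *: "list_coboundary (\<lambda>ys. avg (\<lambda>y. smooth (\<lambda>zs. f (y # zs)) ys) x) xs
      = avg (\<lambda>y. list_coboundary (smooth (\<lambda>zs. f (y # zs))) xs) x" for f :: "'g list \<Rightarrow> 'v" and xs
  proof -
    have "list_coboundary (\<lambda>ys. avg (\<lambda>y. F y ys) x) xs = avg (\<lambda>y. list_coboundary (F y) xs) x"
      for F :: "'g \<Rightarrow> 'g list \<Rightarrow> 'v"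
    proof (induction xs arbitrary: F)
      case Nil
      then show ?case using avg_const [of 0 x] by simp
    next
      case (Cons z xs)
      show ?case by (simp add: Cons.IH avg_diff)
    qed
    from this [of "\<lambda>y. smooth (\<lambda>zs. f (y # zs))"] show ?thesis by simp
  qed
  have "smooth (list_coboundary f) (x # xs) =
      avg (\<lambda>y. smooth f xs - list_coboundary (smooth (\<lambda>zs. f (y # zs))) xs) x"
    by (simp add: smooth_diff Cons.IH)
  also have "\<dots> = smooth f xs - avg (\<lambda>y. list_coboundary (smooth (\<lambda>zs. f (y # zs))) xs) x"
    by (simp add: avg_diff avg_const)
  also have "\<dots> = list_coboundary (smooth f) (x # xs)"
    unfolding * [symmetric] by simp
  finally show ?case .
qed simp

text \<open>In the induction step the summands in which the first entry is only kept are covered by the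
induction hypothesis for \<open>\<lambda>ys. f (x # ys)\<close>. The coboundary of the one in which it is kept and
averaged is expanded by \<open>smooth_coboundary\<close>; its face without the kept \<open>x\<close> is the smoothing of \<open>f\<close>, and its
other faces cancel.\<close>

lemma smooth_homotopy:
  "list_coboundary (smooth_homotopy f) xs + smooth_homotopy (list_coboundary f) xs = smooth f xs - f xs"
proof (induction xs arbitrary: f)
  case (Cons x xs)
  let ?f = "\<lambda>ys. f (x # ys)"
  have 1: "list_coboundary (smooth_homotopy f) (x # xs) = smooth_homotopy f xs
     - (list_coboundary (\<lambda>ys. smooth ?f (x # ys)) xs - list_coboundary (smooth_homotopy ?f) xs)"
    by (simp add: list_coboundary_diff del: smooth.simps)
  have 2: "smooth_homotopy (list_coboundary f) (x # xs)
     = (smooth f (x # xs) - smooth (list_coboundary ?f) (x # xs))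
       - (smooth_homotopy f xs - smooth_homotopy (list_coboundary ?f) xs)"
    by (simp add: smooth_diff smooth_homotopy_diff del: smooth.simps)
  have 3: "smooth (list_coboundary ?f) (x # xs)
      = smooth ?f xs - list_coboundary (\<lambda>ys. smooth ?f (x # ys)) xs"
    unfolding smooth_coboundary by simp
  show ?case
    unfolding 1 2 3 using Cons.IH [of ?f] by (simp add: algebra_simps)
qed simp

lemma smooth_cong:
  assumes "\<And>ys. list_all2 near xs ys \<Longrightarrow> f ys = g ys" shows "smooth f xs = smooth g xs"
  using assms
proof (induction xs arbitrary: f g)
  case (Cons x xs)
  have "smooth (\<lambda>ys. f (y # ys)) xs = smooth (\<lambda>ys. g (y # ys)) xs" if "near x y" for y
    using Cons.prems that by (intro Cons.IH) simp
  then show ?case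
    unfolding smooth.simps by (rule avg_cong)
qed simp

lemma smooth_homotopy_cong:
  assumes "\<And>k ys. k < length xs \<Longrightarrow> list_all2 near (drop k xs) ys \<Longrightarrow>
      f (take (Suc k) xs @ ys) = g (take (Suc k) xs @ ys)"
  shows "smooth_homotopy f xs = smooth_homotopy g xs"
  using assms
proof (induction xs arbitrary: f g)
  case (Cons x xs)
  have "smooth (\<lambda>ys. f (x # ys)) (x # xs) = smooth (\<lambda>ys. g (x # ys)) (x # xs)"
    using Cons.prems [of 0] by (intro smooth_cong) auto
  moreover have "smooth_homotopy (\<lambda>ys. f (x # ys)) xs = smooth_homotopy (\<lambda>ys. g (x # ys)) xs"
    using Cons.prems [of "Suc k" for k] by (intro Cons.IH) auto
  ultimately show ?case by (simp del: smooth.simps)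
qed simp

lemma tendsto_T:
  assumes "(a \<longlongrightarrow> x) F" "(g \<longlongrightarrow> v) F"
  shows "((\<lambda>z. T k (a z) (g z)) \<longlongrightarrow> T k x v) F"
proof -
  have "((\<lambda>z. (a z, g z)) \<longlongrightarrow> (x, v)) F"
    using assms by (rule tendsto_Pair)
  from filterlim_compose [OF T_cont this] show ?thesis
    by simp
qed

text \<open>Near \<open>x\<close> only finitely many layers have non-zero weight, and on each of them the sample point is
constant. Hence convergence of \<open>f\<close> at constant arguments suffices.\<close>

lemma tendsto_avg:
  assumes a: "(a \<longlongrightarrow> x) F" and f: "\<And>y. near x y \<Longrightarrow> ((\<lambda>z. f z y) \<longlongrightarrow> f0 y) F"
  shows "((\<lambda>z. avg (f z) (a z)) \<longlongrightarrow> avg f0 x) F"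
proof -
  obtain M where M: "\<forall>\<^sub>F y in nhds x. \<forall>k\<ge>M. \<forall>v. T k y v = 0"
    using T_locally_finite by blast
  have Mx: "\<forall>k\<ge>M. \<forall>v. T k x v = 0"
    by (rule eventually_nhds_x_imp_x [OF M])
  have summand: "((\<lambda>z. T k (a z) (f z (c k (a z)))) \<longlongrightarrow> T k x (f0 (c k x))) F" for k
    using c_local [where x=x and k=k]
  proof (elim disjE exE conjE)
    assume *: "\<forall>\<^sub>F y in nhds x. \<forall>v. T k y v = 0"
    from filterlim_iff [THEN iffD1, OF a, rule_format, OF this]
    have "\<forall>\<^sub>F z in F. T k (a z) (f z (c k (a z))) = 0"
      by (rule eventually_mono) blast
    moreover have "T k x (f0 (c k x)) = 0"
      using eventually_nhds_x_imp_x [OF *] by blast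
    ultimately show ?thesis
      by (simp add: tendsto_eventually)
  next
    fix y assume y: "near x y" and *: "\<forall>\<^sub>F u in nhds x. (\<forall>v. T k u v = 0) \<or> c k u = y"
    from filterlim_iff [THEN iffD1, OF a, rule_format, OF *]
    have ev: "\<forall>\<^sub>F z in F. T k (a z) (f z y) = T k (a z) (f z (c k (a z)))"
      by (rule eventually_mono) auto
    have lim: "((\<lambda>z. T k (a z) (f z y)) \<longlongrightarrow> T k x (f0 y)) F"
      by (intro tendsto_T a f y)
    have "T k x (f0 y) = T k x (f0 (c k x))"
      using eventually_nhds_x_imp_x [OF *] by auto
    then show ?thesis
      using Lim_transform_eventually [OF lim ev] by simp
  qed
  have lim: "((\<lambda>z. \<Sum>k<M. T k (a z) (f z (c k (a z)))) \<longlongrightarrow> (\<Sum>k<M. T k x (f0 (c k x)))) F"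
    by (intro tendsto_sum summand)
  from filterlim_iff [THEN iffD1, OF a, rule_format, OF M]
  have ev: "\<forall>\<^sub>F z in F. (\<Sum>k<M. T k (a z) (f z (c k (a z)))) = avg (f z) (a z)"
    by (rule eventually_mono) (simp add: avg_eq)
  show ?thesis
    using Lim_transform_eventually [OF lim ev] by (simp add: avg_eq [OF Mx])
qed

text \<open>Since \<open>f\<close> is sampled only at locally constant lists, the smoothing of an arbitrary function is
continuous: take \<open>f\<close> independent of \<open>z\<close>.\<close>

lemma tendsto_smooth:
  assumes "list_all2 (\<lambda>a x. (a \<longlongrightarrow> x) F) gs xs"
    and "\<And>ys. list_all2 near xs ys \<Longrightarrow> ((\<lambda>z. f z ys) \<longlongrightarrow> f0 ys) F"
  shows "((\<lambda>z. smooth (f z) (map (\<lambda>a. a z) gs)) \<longlongrightarrow> smooth f0 xs) F"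
  using assms
proof (induction gs xs arbitrary: f f0)
  case (Cons a gs x xs)
  have "((\<lambda>z. avg (\<lambda>y. smooth (\<lambda>ys. f z (y # ys)) (map (\<lambda>a. a z) gs)) (a z)) \<longlongrightarrow>
      avg (\<lambda>y. smooth (\<lambda>ys. f0 (y # ys)) xs) x) F"
    using Cons by (intro tendsto_avg Cons.IH) auto
  then show ?case by simp
qed simp

lemma tendsto_smooth_homotopy:
  assumes "list_all2 (\<lambda>a x. (a \<longlongrightarrow> x) F) gs xs"
    and "\<And>k ys. k < length xs \<Longrightarrow> list_all2 near (drop k xs) ys \<Longrightarrow>
      ((\<lambda>z. f z (map (\<lambda>a. a z) (take (Suc k) gs) @ ys)) \<longlongrightarrow> f0 (take (Suc k) xs @ ys)) F"
  shows "((\<lambda>z. smooth_homotopy (f z) (map (\<lambda>a. a z) gs)) \<longlongrightarrow> smooth_homotopy f0 xs) F"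
  using assms
proof (induction gs xs arbitrary: f f0)
  case (Cons a gs x xs)
  have "((\<lambda>z. smooth (\<lambda>ys. f z (a z # ys)) (map (\<lambda>a. a z) (a # gs))) \<longlongrightarrow>
      smooth (\<lambda>ys. f0 (x # ys)) (x # xs)) F"
    using Cons.hyps Cons.prems [of 0] by (intro tendsto_smooth) auto
  moreover have "((\<lambda>z. smooth_homotopy (\<lambda>ys. f z (a z # ys)) (map (\<lambda>a. a z) gs)) \<longlongrightarrow>
      smooth_homotopy (\<lambda>ys. f0 (x # ys)) xs) F"
    using Cons.prems [of "Suc k" for k] by (intro Cons.IH) auto
  ultimately show ?case
    by (simp add: tendsto_diff del: smooth.simps)
qed simp

end


section \<open>Uniform pseudometrics and layered partitions\<close>

lemma identity_nhd_third:
  fixes W :: "'g::topological_group_add set"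
  assumes "open W" "0 \<in> W"
  obtains Z where "open Z" "0 \<in> Z" "\<And>x. x \<in> Z \<Longrightarrow> - x \<in> Z"
    "\<And>x y z. x \<in> Z \<Longrightarrow> y \<in> Z \<Longrightarrow> z \<in> Z \<Longrightarrow> x + y + z \<in> W"
proof -
  let ?S = "(\<lambda>p::'g \<times> 'g \<times> 'g. fst p + fst (snd p) + snd (snd p)) -` W"
  have "open ?S"
    by (intro open_vimage assms continuous_intros)
  moreover have "(0, 0, 0) \<in> ?S"
    using assms by simp
  ultimately obtain A B where AB: "open A" "open B" "(0, 0, 0) \<in> A \<times> B" "A \<times> B \<subseteq> ?S"
    by (rule open_prod_elim)
  from AB(2) have "(0, 0) \<in> B" using AB(3) by simp
  with AB(2) obtain C D where CD: "open C" "open D" "(0, 0) \<in> C \<times> D" "C \<times> D \<subseteq> B"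
    by (rule open_prod_elim)
  let ?Y = "A \<inter> C \<inter> D" and ?Z = "A \<inter> C \<inter> D \<inter> uminus -` (A \<inter> C \<inter> D)"
  have 3: "x + y + z \<in> W" if "x \<in> ?Y" "y \<in> ?Y" "z \<in> ?Y" for x y z
  proof -
    have "(y, z) \<in> B" using CD(4) that by blast
    then have "(x, y, z) \<in> ?S" using AB(4) that by blast
    then show ?thesis by simp
  qed
  show thesis
  proof
    show "open ?Z"
      using AB CD by (intro open_Int open_vimage continuous_intros)
    show "0 \<in> ?Z" using AB(3) CD(3) by simp
    show "- x \<in> ?Z" if "x \<in> ?Z" for x using that by simp
    show "x + y + z \<in> W" if "x \<in> ?Z" "y \<in> ?Z" "z \<in> ?Z" for x y z
      using that by (intro 3) auto
  qed
qed

text \<open>A list of pairs \<open>(n, w)\<close> with \<open>w \<in> V n\<close>, for a sequence of identity neighbourhoods \<open>V n\<close>, is an expression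
of a group element as a sum, of cost \<open>\<Sum> 2\<^sup>-\<^sup>n\<close>.\<close>

definition chain_weight :: "(nat \<times> 'g) list \<Rightarrow> real" where
  "chain_weight ps = (\<Sum>(n, w)\<leftarrow>ps. (1/2) ^ n)"

lemma chain_weight_simps [simp]:
  "chain_weight [] = 0"
  "chain_weight (p # ps) = (1/2) ^ fst p + chain_weight ps"
  "chain_weight (ps @ qs) = chain_weight ps + chain_weight qs"
  "chain_weight (rev ps) = chain_weight ps"
  by (simp_all add: chain_weight_def case_prod_unfold rev_map [symmetric] sum_list_rev)

lemma chain_weight_nonneg: "0 \<le> chain_weight ps"
  by (induction ps) auto

lemma chain_weight_split:
  assumes "0 \<le> t" "t < chain_weight ps"
  obtains qs p rs where "ps = qs @ p # rs" "chain_weight qs \<le> t" "t < chain_weight qs + (1/2) ^ fst p"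
  using assms
proof (induction ps arbitrary: t thesis)
  case (Cons a ps)
  show ?case
  proof (cases "t < (1/2) ^ fst a")
    case True
    then show ?thesis using Cons.prems(1) [of "[]" a ps] Cons.prems(2) by simp
  next
    case False
    then have "0 \<le> t - (1/2) ^ fst a" "t - (1/2) ^ fst a < chain_weight ps"
      using Cons.prems(3) by auto
    then obtain qs p rs where "ps = qs @ p # rs" "chain_weight qs \<le> t - (1/2) ^ fst a"
        "t - (1/2) ^ fst a < chain_weight qs + (1/2) ^ fst p"
      by (rule Cons.IH [rotated 1])
    then show ?thesis using Cons.prems(1) [of "a # qs" p rs] by simp
  qed
qed simp

locale nhd_chain =
  fixes V :: "nat \<Rightarrow> 'g::group_add set"
  assumes zero_mem: "0 \<in> V n" and uminus_mem: "x \<in> V n \<Longrightarrow> - x \<in> V n"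
    and third: "x \<in> V (Suc n) \<Longrightarrow> y \<in> V (Suc n) \<Longrightarrow> z \<in> V (Suc n) \<Longrightarrow> x + y + z \<in> V n"
    and UNIV: "V 0 = UNIV"
begin

lemma decreasing: "m \<le> n \<Longrightarrow> V n \<subseteq> V m"
proof (induction n rule: dec_induct)
  case (step n)
  have "V (Suc n) \<subseteq> V n"
    using third [of _ n 0 0] zero_mem by auto
  with step show ?case by blast
qed simp

definition is_chain :: "(nat \<times> 'g) list \<Rightarrow> bool" where
  "is_chain ps \<longleftrightarrow> (\<forall>(n, w) \<in> set ps. w \<in> V n)"

text \<open>Cut the chain where half of its weight is reached. The parts before and after the cut and the
summand at the cut all belong to \<open>V (Suc m)\<close>, and three elements of that set add up to an element of \<open>V m\<close>.\<close>

lemma chain_sum_mem: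
  assumes "is_chain ps" "chain_weight ps < (1/2) ^ m"
  shows "sum_list (map snd ps) \<in> V m"
  using assms
proof (induction "length ps" arbitrary: ps m rule: less_induct)
  case less
  show ?case
  proof (cases "ps = []")
    case False
    then have pos: "0 < chain_weight ps"
      by (cases ps) (simp_all add: add_pos_nonneg chain_weight_nonneg)
    with chain_weight_split [of "chain_weight ps / 2" ps]
    obtain qs p rs where ps: "ps = qs @ p # rs" and q: "chain_weight qs \<le> chain_weight ps / 2"
        and p: "chain_weight ps / 2 < chain_weight qs + (1/2) ^ fst p"
      by (metis field_sum_of_halves half_gt_zero less_add_same_cancel1 less_eq_real_def)
    have chains: "is_chain qs" "is_chain rs" "snd p \<in> V (fst p)"
      using less.prems(1) ps by (auto simp: is_chain_def)
    have "chain_weight qs < (1/2) ^ Suc m" "chain_weight rs < (1/2) ^ Suc m"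
      using q p less.prems(2) ps by auto
    then have "sum_list (map snd qs) \<in> V (Suc m)" "sum_list (map snd rs) \<in> V (Suc m)"
      using less.hyps chains ps by auto
    moreover have "snd p \<in> V (Suc m)"
    proof -
      have "(1/2::real) ^ fst p \<le> chain_weight ps"
        using ps chain_weight_nonneg [of qs] chain_weight_nonneg [of rs] by simp
      then have "(1/2::real) ^ fst p < (1/2) ^ m"
        using less.prems(2) by linarith
      then have "Suc m \<le> fst p"
        by (simp add: power_strict_decreasing_iff Suc_le_eq)
      then show ?thesis using decreasing chains(3) by blast
    qed
    ultimately show ?thesis
      using third ps by (simp add: add.assoc)
  qed (simp add: zero_mem)
qed

text \<open>Because \<open>V 0\<close> is the whole group, every element has an expression of cost \<open>1\<close>, so the infimum is over a
non-empty set.\<close>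

definition len :: "'g \<Rightarrow> real" where
  "len x = Inf {chain_weight ps |ps. is_chain ps \<and> sum_list (map snd ps) = x}"

lemma len_le: "is_chain ps \<Longrightarrow> len (sum_list (map snd ps)) \<le> chain_weight ps"
  unfolding len_def using chain_weight_nonneg by (intro cInf_lower bdd_belowI [of _ 0]) auto

lemma len_less:
  assumes "len x < e"
  obtains ps where "is_chain ps" "sum_list (map snd ps) = x" "chain_weight ps < e"
proof -
  have "chain_weight [(0, x)] \<in> {chain_weight ps |ps. is_chain ps \<and> sum_list (map snd ps) = x}"
    unfolding is_chain_def using UNIV by (intro CollectI exI [of _ "[(0, x)]"]) auto
  then show thesis
    using cInf_lessD [OF _ assms [unfolded len_def]] that by blast
qed

lemma len_nonneg: "0 \<le> len x"
  using len_less [of x 0] chain_weight_nonneg by (meson not_le)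

lemma len_mem: "len x < (1/2) ^ m \<Longrightarrow> x \<in> V m"
  using len_less chain_sum_mem by metis

lemma len_le_power: "x \<in> V n \<Longrightarrow> len x \<le> (1/2) ^ n"
  using len_le [of "[(n, x)]"] by (simp add: is_chain_def)

lemma len_zero: "len 0 = 0"
  using len_le [of "[]"] len_nonneg [of 0] by (simp add: is_chain_def)

lemma len_add: "len (x + y) \<le> len x + len y"
proof (rule field_le_epsilon)
  fix e :: real assume "0 < e"
  obtain ps where ps: "is_chain ps" "sum_list (map snd ps) = x" "chain_weight ps < len x + e/2"
    using len_less [of x "len x + e/2"] \<open>0 < e\<close> by auto
  obtain qs where qs: "is_chain qs" "sum_list (map snd qs) = y" "chain_weight qs < len y + e/2"
    using len_less [of y "len y + e/2"] \<open>0 < e\<close> by auto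
  have "len (x + y) \<le> chain_weight (ps @ qs)"
    using len_le [of "ps @ qs"] ps qs by (auto simp: is_chain_def)
  then show "len (x + y) \<le> len x + len y + e"
    using ps(3) qs(3) by simp
qed

lemma len_uminus: "len (- x) = len x"
proof -
  have "len (- x) \<le> len x" for x
  proof (rule field_le_epsilon)
    fix e :: real assume "0 < e"
    obtain ps where ps: "is_chain ps" "sum_list (map snd ps) = x" "chain_weight ps < len x + e"
      using len_less [of x "len x + e"] \<open>0 < e\<close> by auto
    let ?qs = "rev (map (\<lambda>(n, w). (n, - w)) ps)"
    have "chain_weight (map (\<lambda>(n, w). (n, - w)) ps) = chain_weight ps"
      by (induction ps) auto
    moreover have "sum_list (map snd ?qs) = - sum_list (map snd ps)"
      by (induction ps) (auto simp: minus_add)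
    moreover have "is_chain ?qs"
      using ps(1) uminus_mem by (auto simp: is_chain_def)
    ultimately have "len (- x) \<le> chain_weight ps"
      using len_le [of ?qs] ps(2) by simp
    then show "len (- x) \<le> len x + e"
      using ps(3) by simp
  qed
  from this [of x] this [of "- x"] show ?thesis by simp
qed

end

locale continuous_pseudometric =
  fixes d :: "'g::topological_space \<Rightarrow> 'g \<Rightarrow> real"
  assumes refl: "d x x = 0" and sym: "d x y = d y x" and tri: "d x z \<le> d x y + d y z"
    and nonneg: "0 \<le> d x y" and nbhd: "0 < e \<Longrightarrow> \<forall>\<^sub>F y in nhds x. d x y < e"

text \<open>Birkhoff and Kakutani: with neighbourhoods that shrink quickly enough, the cost of the
difference \<open>- x + y\<close> is a pseudometric whose small balls are small.\<close>

lemma uniform_pseudometric: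
  fixes W :: "'g::topological_group_add set"
  assumes "open W" "0 \<in> W"
  obtains d :: "'g::topological_group_add \<Rightarrow> 'g \<Rightarrow> real" where "continuous_pseudometric d"
    "\<And>x y. d x y < 1/2 \<Longrightarrow> - x + y \<in> W"
proof -
  \<comment> \<open>The first set is the whole group and the second lies in \<open>W\<close>, so that length below \<open>1/2\<close> forces membership in \<open>W\<close>.\<close>
  define P where "P \<equiv> \<lambda>n (X::'g set). open X \<and> 0 \<in> X \<and> (\<forall>x\<in>X. - x \<in> X) \<and> (n = (0::nat) \<longrightarrow> X = UNIV)"
  define Q where "Q \<equiv> \<lambda>n X (Y::'g set). (\<forall>x\<in>Y. \<forall>y\<in>Y. \<forall>z\<in>Y. x + y + z \<in> X) \<and> (n = (0::nat) \<longrightarrow> Y \<subseteq> W)"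
  have "\<exists>V. \<forall>n. P n (V n) \<and> Q n (V n) (V (Suc n))"
  proof (rule dependent_nat_choice)
    show "\<exists>X. P 0 X" unfolding P_def by (intro exI [of _ UNIV]) auto
  next
    fix X n assume X: "P n X"
    then have "open (X \<inter> W)" "0 \<in> X \<inter> W"
      using assms by (auto simp: P_def)
    then obtain Z where Z: "open Z" "0 \<in> Z" "\<And>x. x \<in> Z \<Longrightarrow> - x \<in> Z"
      "\<And>x y z. x \<in> Z \<Longrightarrow> y \<in> Z \<Longrightarrow> z \<in> Z \<Longrightarrow> x + y + z \<in> X \<inter> W"
      using identity_nhd_third by metis
    moreover have "Z \<subseteq> W"
      using Z(4) [OF _ Z(2) Z(2)] by auto
    ultimately show "\<exists>Y. P (Suc n) Y \<and> Q n X Y"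
      unfolding P_def Q_def by (intro exI [of _ Z]) auto
  qed
  then obtain V where V: "\<And>n. P n (V n)" "\<And>n. Q n (V n) (V (Suc n))"
    by blast
  interpret nhd_chain V
  proof
    show "0 \<in> V n" "x \<in> V n \<Longrightarrow> - x \<in> V n" for n x
      using V(1) [of n] by (simp_all add: P_def)
    show "x + y + z \<in> V n" if "x \<in> V (Suc n)" "y \<in> V (Suc n)" "z \<in> V (Suc n)" for n x y z
      using V(2) [of n] that by (simp add: Q_def)
    show "V 0 = UNIV"
      using V(1) [of 0] by (simp add: P_def)
  qed
  let ?d = "\<lambda>x y. len (- x + y)"
  have "continuous_pseudometric ?d"
  proof
    show "?d x x = 0" "0 \<le> ?d x y" for x y
      by (simp_all add: len_zero len_nonneg)
    show "?d x y = ?d y x" for x y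
      using len_uminus [of "- x + y"] by (simp add: minus_add)
    show "?d x z \<le> ?d x y + ?d y z" for x y z
      using len_add [of "- x + y" "- y + z"] by (simp add: add.assoc)
    show "\<forall>\<^sub>F y in nhds x. ?d x y < e" if e: "0 < e" for x and e :: real
    proof -
      obtain n where n: "(1/2) ^ n < e"
        using real_arch_pow_inv [OF e, of "1/2"] by auto
      have "((\<lambda>y. - x + y) \<longlongrightarrow> - x + x) (nhds x)"
        by (intro tendsto_intros) (simp add: filterlim_ident)
      moreover have "open (V n)" "- x + x \<in> V n"
        using V(1) [of n] by (auto simp: P_def)
      ultimately have "\<forall>\<^sub>F y in nhds x. - x + y \<in> V n"
        by (rule topological_tendstoD)
      then show ?thesis
        by (rule eventually_mono) (meson len_le_power n order_le_less_trans)
    qed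
  qed
  then show thesis
  proof (rule that)
    show "- x + y \<in> W" if "?d x y < 1/2" for x y
      using len_mem [of "- x + y" 1] that V(2) [of 0] by (auto simp: Q_def)
  qed
qed

text \<open>Between \<open>s n\<close> and \<open>s (Suc n)\<close> lies the \<open>n\<close>-th layer of a partition of unity; \<open>c n\<close> sends a point of the layer to
a nearby centre.\<close>

locale ladder =
  fixes d :: "'g::topological_space \<Rightarrow> 'g \<Rightarrow> real" and s :: "nat \<Rightarrow> 'g \<Rightarrow> real" and c :: "nat \<Rightarrow> 'g \<Rightarrow> 'g"
  assumes s_zero: "s 0 x = 0" and s_range: "s n x \<in> {0..1}" and s_continuous: "continuous_on UNIV (s n)"
    and s_locally_one: "\<exists>M. \<forall>\<^sub>F y in nhds x. \<forall>k\<ge>M. s k y = 1"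
    and c_local: "(\<forall>\<^sub>F y in nhds x. s n y = s (Suc n) y) \<or>
       (\<exists>z. d x z < 1/2 \<and> (\<forall>\<^sub>F y in nhds x. s n y = s (Suc n) y \<or> c n y = z))"

text \<open>Stone's argument for paracompactness of metric spaces. Well-order the points and let \<open>a x\<close> be the
first point at distance less than \<open>1/2\<close> from \<open>x\<close>. Let \<open>E n\<close> consist of the points whose ball of radius \<open>2\<^sup>-\<^sup>n\<close>
stays within that distance of \<open>a x\<close>. If \<open>x\<close> and \<open>y\<close> in \<open>E n\<close> have different centres, say \<open>a x\<close> comes first, then
\<open>y\<close> is at distance at least \<open>1/2\<close> from \<open>a x\<close>, hence at least \<open>2\<^sup>-\<^sup>n\<close> from \<open>x\<close>. So the pieces of
\<open>E n\<close> with a fixed centre stay separated after a small thickening, and the sets \<open>E n\<close> exhaust the space. The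
running maximum of bump functions around \<open>E 0, E 1, \<dots>\<close> is the ladder.\<close>

lemma (in continuous_pseudometric) exists_ladder: obtains s c where "ladder d s c"
proof -
  obtain r :: "('g \<times> 'g) set" where r: "well_order_on UNIV r"
    using well_order_on by blast
  then have wf: "wf (r - Id)" and total: "\<And>x y. x \<noteq> y \<Longrightarrow> (x, y) \<in> r - Id \<or> (y, x) \<in> r - Id"
    by (auto simp: well_order_on_def linear_order_on_def total_on_def)
  have "\<exists>g. d g x < 1/2 \<and> (\<forall>g'. (g', g) \<in> r - Id \<longrightarrow> \<not> d g' x < 1/2)" for x
  proof -
    have "x \<in> {g. d g x < 1/2}" using refl [of x] by simp
    from wfE_min [OF wf this] show ?thesis by (metis mem_Collect_eq)
  qed
  then obtain a where a: "\<And>x. d (a x) x < 1/2" "\<And>x g. (g, a x) \<in> r - Id \<Longrightarrow> \<not> d g x < 1/2"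
    by metis
  define E where "E n = {x. d (a x) x + (1/2) ^ n \<le> 1/2}" for n :: nat
  have separated: "a x = a y" if xy: "x \<in> E n" "y \<in> E n" "d x y < (1/2) ^ n" for x y n
  proof -
    have "\<not> (a x, a y) \<in> r - Id" if "x \<in> E n" "y \<in> E n" "d x y < (1/2) ^ n" for x y
    proof
      assume "(a x, a y) \<in> r - Id"
      then have "1/2 \<le> d (a x) y" using a(2) by force
      with that tri [of "a x" y x] show False by (simp add: E_def)
    qed
    then show ?thesis using total xy sym [of x y] by metis
  qed
  \<comment> \<open>Distance to \<open>E n\<close>, capped at \<open>1\<close> because \<open>E n\<close> may be empty.\<close>
  define D where "D n x = Inf (insert 1 (d x ` E n))" for n x
  have bdd: "bdd_below (insert 1 (d x ` E n))" for x n
    using nonneg by (intro bdd_belowI [of _ 0]) auto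
  have D_le: "D n x \<le> d x y" if "y \<in> E n" for n x y
    unfolding D_def using that by (intro cInf_lower bdd) auto
  have D_ge: "t \<le> D n x" if "t \<le> 1" "\<And>y. y \<in> E n \<Longrightarrow> t \<le> d x y" for n x t
    unfolding D_def using that by (intro cInf_greatest) auto
  have D_lipschitz: "D n x \<le> D n y + d x y" for n x y
  proof -
    have "D n x - d x y \<le> D n y"
    proof (rule D_ge)
      have "D n x \<le> 1" unfolding D_def by (intro cInf_lower bdd) auto
      then show "D n x - d x y \<le> 1" using nonneg [of x y] by linarith
      show "D n x - d x y \<le> d y z" if "z \<in> E n" for z
        using D_le [OF that, of x] tri [of x z y] by linarith
    qed
    then show ?thesis by linarith
  qed
  have cont_D: "continuous_on UNIV (D n)" for n
    unfolding continuous_on_def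
  proof (intro ballI tendstoI)
    fix x :: 'g and e :: real assume "0 < e"
    from nbhd [OF this, of x] have "\<forall>\<^sub>F y in nhds x. dist (D n y) (D n x) < e"
    proof (rule eventually_mono)
      fix y assume "d x y < e"
      then show "dist (D n y) (D n x) < e"
        using D_lipschitz [of n x y] D_lipschitz [of n y x] sym [of x y]
        by (simp add: dist_real_def)
    qed
    then show "\<forall>\<^sub>F y in at x. dist (D n y) (D n x) < e"
      by (simp add: eventually_nhds_conv_at)
  qed
  \<comment> \<open>The bump is \<open>1\<close> within \<open>2\<^sup>-\<^sup>n/8\<close> of \<open>E n\<close>, hence near every point of \<open>E n\<close>, and \<open>0\<close> from \<open>2\<^sup>-\<^sup>n/4\<close> on.\<close>
  define q where "q n x = max 0 (min 1 (2 - 8 * 2 ^ n * D n x))" for n x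
  define s where "s = rec_nat (\<lambda>x. 0) (\<lambda>n f x. max (f x) (q n x))"
  have s_simps [simp]: "s 0 x = 0" "s (Suc n) x = max (s n x) (q n x)" for n x
    by (simp_all add: s_def)
  have s_range: "0 \<le> s n x \<and> s n x \<le> 1" for n x
    by (induction n) (auto simp: q_def)
  have s_mono: "s m x \<le> s n x" if "m \<le> n" for m n x
    using that by (induction n rule: dec_induct) auto
  have cont_s: "continuous_on UNIV (s n)" for n
  proof (induction n)
    case 0
    then show ?case by (simp add: s_def)
  next
    case (Suc n)
    have "continuous_on UNIV (\<lambda>x. max (s n x) (q n x))"
      unfolding q_def by (intro continuous_intros Suc cont_D)
    then show ?case by (simp add: s_def)
  qed
  define c where "c n x = a (SOME y. y \<in> E n \<and> d x y < (1/2) ^ n / 4)" for n x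
  have "ladder d s c"
  proof
    show "s 0 x = 0" "s n x \<in> {0..1}" "continuous_on UNIV (s n)" for n x
      using s_range cont_s by auto
  next
    fix x
    have "0 < 1/2 - d (a x) x" using a(1) [of x] by simp
    from real_arch_pow_inv [OF this, of "1/2"] obtain n where n: "(1/2) ^ n < 1/2 - d (a x) x"
      by auto
    then have x: "x \<in> E n" by (simp add: E_def)
    have pos: "0 < (1/2::real) ^ n / 8" by simp
    have "\<forall>\<^sub>F y in nhds x. \<forall>k\<ge>Suc n. s k y = 1"
      using nbhd [OF pos, of x]
    proof (rule eventually_mono)
      fix y assume y: "d x y < (1/2) ^ n / 8"
      have "D n y < (1/2) ^ n / 8"
        using D_le [OF x, of y] y sym [of x y] by simp
      then have "8 * 2 ^ n * D n y < 8 * 2 ^ n * ((1/2) ^ n / 8)"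
        by (intro mult_strict_left_mono) auto
      then have "q n y = 1"
        by (simp add: q_def power_one_over)
      then have "1 \<le> s (Suc n) y" by simp
      then show "\<forall>k\<ge>Suc n. s k y = 1"
        using s_mono [of "Suc n" _ y] s_range by (meson order_antisym order_trans)
    qed
    then show "\<exists>M. \<forall>\<^sub>F y in nhds x. \<forall>k\<ge>M. s k y = 1" by blast
  next
    fix n :: nat and x
    define e where "e = (1/2::real) ^ n"
    have e: "0 < e" "e \<le> 1" by (simp_all add: e_def power_le_one)
    then have pos: "0 < e / 8" by simp
    have near_E: "\<exists>z\<in>E n. d y z < e / 4" if "s n y \<noteq> s (Suc n) y" for y
    proof (rule ccontr)
      assume "\<not> (\<exists>z\<in>E n. d y z < e / 4)"
      then have "e / 4 \<le> D n y"
        using e by (intro D_ge) auto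
      then have "8 * 2 ^ n * (e / 4) \<le> 8 * 2 ^ n * D n y"
        by (intro mult_left_mono) auto
      then have "2 \<le> 8 * 2 ^ n * D n y"
        by (simp add: e_def power_one_over)
      then have "min 1 (2 - 8 * 2 ^ n * D n y) \<le> 0"
        by (intro min.coboundedI2) linarith
      then have "q n y = 0"
        unfolding q_def by (rule max_absorb1)
      then show False using that s_range [of n y] by simp
    qed
    show "(\<forall>\<^sub>F y in nhds x. s n y = s (Suc n) y) \<or>
       (\<exists>z. d x z < 1/2 \<and> (\<forall>\<^sub>F y in nhds x. s n y = s (Suc n) y \<or> c n y = z))"
    \<comment> \<open>Within \<open>e/8\<close> of \<open>x\<close> the bump involves only points of \<open>E n\<close> closer to \<open>x\<close> than \<open>3e/8\<close>, and \<open>e/4 + e/8 + 3e/8 < e\<close>.\<close>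
    proof (cases "\<exists>z\<in>E n. d x z < 3 * e / 8")
      case True
      then obtain z where z: "z \<in> E n" "d x z < 3 * e / 8" by blast
      have "d (a z) z + e \<le> 1/2"
        using z(1) by (simp add: E_def e_def)
      then have "d x (a z) < 1/2"
        using z(2) tri [of x "a z" z] sym [of z "a z"] e(1) by linarith
      moreover have "\<forall>\<^sub>F y in nhds x. s n y = s (Suc n) y \<or> c n y = a z"
        using nbhd [OF pos, of x]
      proof (rule eventually_mono)
        fix y assume y: "d x y < e / 8"
        have "c n y = a z" if "s n y \<noteq> s (Suc n) y"
        proof -
          define w where "w = (SOME w. w \<in> E n \<and> d y w < e / 4)"
          have w: "w \<in> E n \<and> d y w < e / 4"
            unfolding w_def by (rule someI_ex) (use near_E [OF that] in blast)
          have "d w y < e / 4" "d y x < e / 8"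
            using w y sym [of w y] sym [of y x] by linarith+
          moreover have "d w z \<le> d w y + (d y x + d x z)"
            using tri [of w z y] tri [of y z x] by linarith
          ultimately have "d w z < e"
            using z(2) e(1) by linarith
          then show ?thesis
            using separated [of w n z] w z by (simp add: c_def w_def e_def)
        qed
        then show "s n y = s (Suc n) y \<or> c n y = a z" by blast
      qed
      ultimately show ?thesis by blast
    next
      case False
      have "\<forall>\<^sub>F y in nhds x. s n y = s (Suc n) y"
        using nbhd [OF pos, of x]
      proof (rule eventually_mono)
        fix y assume y: "d x y < e / 8"
        show "s n y = s (Suc n) y"
        proof (rule ccontr)
          assume "s n y \<noteq> s (Suc n) y"
          then obtain z where "z \<in> E n" "d y z < e / 4" using near_E by blast
          then show False using False tri [of x z y] y by force
        qed
      qed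
      then show ?thesis by blast
    qed
  qed
  then show thesis by (rule that)
qed


section \<open>Tuple cochains as functions on lists\<close>

lemma comm_group_functions:
  "comm_group (product_group I (\<lambda>_. additive_group) :: ('a \<Rightarrow> 'v::ab_group_add) monoid)"
proof -
  have add: "group (additive_group :: 'v monoid)"
    by (rule groupI) (auto simp: additive_group_def add.assoc intro: exI [of _ "- x" for x])
  show ?thesis
    using add
    by (intro group.group_comm_groupI product_group)
      (auto simp: product_group_def additive_group_def add.commute)
qed

lemma inv_functions:
  fixes f :: "'a \<Rightarrow> 'v::ab_group_add"
  assumes "f \<in> extensional I"
  shows "inv\<^bsub>product_group I (\<lambda>_. additive_group)\<^esub> f = (\<lambda>i\<in>I. - f i)"
proof -
  interpret comm_group "product_group I (\<lambda>_. additive_group) :: ('a \<Rightarrow> 'v) monoid"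
    by (rule comm_group_functions)
  show ?thesis
    using assms
    by (intro inv_equality) (auto simp: product_group_def additive_group_def PiE_def)
qed

definition small_list :: "'a set set \<Rightarrow> 'a list \<Rightarrow> bool" where
  "small_list \<UU> xs \<longleftrightarrow> (\<exists>U\<in>\<UU>. set xs \<subseteq> U)"

definition tuple_list :: "nat \<Rightarrow> (nat \<Rightarrow> 'a) \<Rightarrow> 'a list" where
  "tuple_list q u = map u [0..<Suc q]"

definition list_tuple :: "nat \<Rightarrow> 'a list \<Rightarrow> nat \<Rightarrow> 'a" where
  "list_tuple q xs = (\<lambda>i\<in>{..q}. xs ! i)"

lemma length_tuple_list [simp]: "length (tuple_list q u) = Suc q"
  by (simp add: tuple_list_def)

lemma set_tuple_list: "set (tuple_list q u) = u ` {..q}"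
  by (simp add: tuple_list_def atLeast0LessThan lessThan_Suc_atMost del: upt_Suc)

lemma list_tuple_tuple_list: "u \<in> extensional {..q} \<Longrightarrow> list_tuple q (tuple_list q u) = u"
  by (rule ext) (auto simp: list_tuple_def tuple_list_def extensional_def simp del: upt_Suc)

lemma tuple_list_list_tuple: "length xs = Suc q \<Longrightarrow> tuple_list q (list_tuple q xs) = xs"
  by (rule nth_equalityI) (auto simp: list_tuple_def tuple_list_def simp del: upt_Suc)

lemma mem_cover_tuples_iff:
  "u \<in> cover_tuples \<UU> q \<longleftrightarrow> u \<in> extensional {..q} \<and> small_list \<UU> (tuple_list q u)"
  by (auto simp: cover_tuples_def small_list_def set_tuple_list PiE_def Pi_def image_subset_iff)

lemma list_tuple_mem_cover_tuples:
  "length xs = Suc q \<Longrightarrow> small_list \<UU> xs \<Longrightarrow> list_tuple q xs \<in> cover_tuples \<UU> q"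
  by (simp add: mem_cover_tuples_iff tuple_list_list_tuple) (simp add: list_tuple_def)

lemma small_list_subset: "small_list \<UU> xs \<Longrightarrow> set ys \<subseteq> set xs \<Longrightarrow> small_list \<UU> ys"
  by (auto simp: small_list_def)

lemma tuple_list_face:
  assumes "k \<le> Suc q"
  shows "tuple_list q (tuple_face q k u) = delete_nth k (tuple_list (Suc q) u)"
  using assms
  by (intro nth_equalityI)
    (auto simp: tuple_list_def tuple_face_def delete_nth_def nth_append min_def simp del: upt_Suc)

lemma tuple_face_extensional: "tuple_face q k u \<in> extensional {..q}"
  by (simp add: tuple_face_def)

lemma tuple_face_mem_cover_tuples:
  assumes "u \<in> cover_tuples \<UU> (Suc q)" "k \<le> Suc q"
  shows "tuple_face q k u \<in> cover_tuples \<UU> q"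
  using assms small_list_subset [OF _ set_delete_nth]
  by (auto simp: mem_cover_tuples_iff tuple_face_extensional tuple_list_face)

text \<open>Tuple cochains live on extensional functions. This is the passage from functions on lists; every
tuple cochain arises in this way (\<open>cochain_eq_list_cochain\<close>), and the coboundary becomes
\<^const>\<open>list_coboundary\<close>.\<close>

definition list_cochain :: "'a set set \<Rightarrow> nat \<Rightarrow> ('a list \<Rightarrow> 'v) \<Rightarrow> (nat \<Rightarrow> 'a) \<Rightarrow> 'v" where
  "list_cochain \<UU> q F = (\<lambda>u\<in>cover_tuples \<UU> q. F (tuple_list q u))"

lemma list_cochain_cong:
  assumes "\<And>xs. length xs = Suc q \<Longrightarrow> small_list \<UU> xs \<Longrightarrow> F xs = G xs"
  shows "list_cochain \<UU> q F = list_cochain \<UU> q G"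
  using assms by (auto simp: list_cochain_def mem_cover_tuples_iff intro!: restrict_ext)

lemma list_cochain_eqD:
  assumes "list_cochain \<UU> q F = list_cochain \<UU> q G" "length xs = Suc q" "small_list \<UU> xs"
  shows "F xs = G xs"
  using fun_cong [OF assms(1), of "list_tuple q xs"] list_tuple_mem_cover_tuples [OF assms(2,3)] assms(2)
  by (simp add: list_cochain_def tuple_list_list_tuple)

lemma carrier_tuple_complex: "carrier (cochains (tuple_complex \<UU>) q) = extensional (cover_tuples \<UU> q)"
  by (auto simp: tuple_complex_def additive_group_def PiE_def)

lemma cochain_eq_list_cochain:
  assumes "f \<in> extensional (cover_tuples \<UU> q)"
  shows "f = list_cochain \<UU> q (\<lambda>xs. f (list_tuple q xs))"
  using assms
  by (intro ext) (auto simp: list_cochain_def mem_cover_tuples_iff list_tuple_tuple_list extensional_def)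

lemma list_cochain_extensional: "list_cochain \<UU> q F \<in> extensional (cover_tuples \<UU> q)"
  by (simp add: list_cochain_def)

lemma coboundary_list_cochain:
  "coboundary (tuple_complex \<UU>) q (list_cochain \<UU> q F) = list_cochain \<UU> (Suc q) (list_coboundary F)"
proof -
  have "alternating_sum (Suc q) (\<lambda>k. list_cochain \<UU> q F (tuple_face q k u)) = list_coboundary F (tuple_list (Suc q) u)"
    if u: "u \<in> cover_tuples \<UU> (Suc q)" for u
    unfolding alternating_sum_def list_coboundary_eq_sum length_tuple_list lessThan_Suc_atMost
  proof (rule sum.cong [OF refl])
    fix k assume "k \<in> {..Suc q}"
    then show "(if even k then list_cochain \<UU> q F (tuple_face q k u) else - list_cochain \<UU> q F (tuple_face q k u)) =
        (if even k then F (delete_nth k (tuple_list (Suc q) u))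
         else - F (delete_nth k (tuple_list (Suc q) u)))"
      using tuple_face_mem_cover_tuples [OF u, of k]
      by (simp add: list_cochain_def tuple_list_face)
  qed
  then show ?thesis
    by (simp add: tuple_complex_def list_cochain_def cong: restrict_cong)
qed

lemma mult_list_cochain:
  "list_cochain \<UU> q F \<otimes>\<^bsub>cochains (tuple_complex \<UU>) q\<^esub> list_cochain \<UU> q G = list_cochain \<UU> q (\<lambda>xs. F xs + G xs)"
  by (auto simp: tuple_complex_def additive_group_def list_cochain_def intro!: restrict_ext)

lemma one_list_cochain: "\<one>\<^bsub>cochains (tuple_complex \<UU>) q\<^esub> = list_cochain \<UU> q (\<lambda>_. 0)"
  by (simp add: tuple_complex_def additive_group_def list_cochain_def)

lemma list_coboundary_zero: "list_coboundary (\<lambda>_. 0) xs = 0"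
  by (induction xs) auto

lemma list_coboundary_add:
  "list_coboundary (\<lambda>ys. f ys + g ys) xs = list_coboundary f xs + list_coboundary g xs"
proof (induction xs arbitrary: f g)
  case (Cons x xs)
  show ?case by (simp add: Cons.IH)
qed simp

lemma list_coboundary_list_coboundary: "list_coboundary (list_coboundary f) xs = 0"
proof (induction xs arbitrary: f)
  case (Cons x xs)
  show ?case by (simp add: list_coboundary_diff Cons.IH)
qed simp

lemma tuple_complex:
  "abelian_cochain_complex (tuple_complex \<UU> :: ((nat \<Rightarrow> 'a) \<Rightarrow> 'v::ab_group_add) cochain_complex)"
proof (rule abelian_cochain_complex.intro)
  let ?K = "tuple_complex \<UU> :: ((nat \<Rightarrow> 'a) \<Rightarrow> 'v::ab_group_add) cochain_complex"
  fix n
  show "comm_group (cochains ?K n)"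
    by (simp add: tuple_complex_def comm_group_functions)
  show "coboundary ?K n \<in> hom (cochains ?K n) (cochains ?K (Suc n))"
  proof (rule homI)
    fix x assume "x \<in> carrier (cochains ?K n)"
    then show "coboundary ?K n x \<in> carrier (cochains ?K (Suc n))"
      unfolding carrier_tuple_complex by (simp add: tuple_complex_def)
  next
    fix x y assume "x \<in> carrier (cochains ?K n)" "y \<in> carrier (cochains ?K n)"
    then obtain F G where "x = list_cochain \<UU> n F" "y = list_cochain \<UU> n G"
      unfolding carrier_tuple_complex by (metis cochain_eq_list_cochain)
    then show "coboundary ?K n (x \<otimes>\<^bsub>cochains ?K n\<^esub> y)
        = coboundary ?K n x \<otimes>\<^bsub>cochains ?K (Suc n)\<^esub> coboundary ?K n y"
      by (simp add: mult_list_cochain coboundary_list_cochain list_coboundary_add cong: list_cochain_cong)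
  qed
  fix x assume "x \<in> carrier (cochains ?K n)"
  then obtain F where "x = list_cochain \<UU> n F"
    unfolding carrier_tuple_complex by (metis cochain_eq_list_cochain)
  then show "coboundary ?K (Suc n) (coboundary ?K n x) = \<one>\<^bsub>cochains ?K (Suc (Suc n))\<^esub>"
    by (simp add: coboundary_list_cochain one_list_cochain list_coboundary_list_coboundary cong: list_cochain_cong)
qed

abbreviation tuple_topology :: "nat \<Rightarrow> (nat \<Rightarrow> 'a::topological_space) topology" where
  "tuple_topology q \<equiv> product_topology (\<lambda>_. euclidean) {..q}"

abbreviation continuous_cochain :: "'a::topological_space set set \<Rightarrow> nat \<Rightarrow> ((nat \<Rightarrow> 'a) \<Rightarrow> 'v::topological_space) \<Rightarrow> bool" where
  "continuous_cochain \<UU> q f \<equiv> continuous_map (subtopology (tuple_topology q) (cover_tuples \<UU> q)) euclidean f"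

lemma carrier_continuous_tuple_complex:
  "carrier (cochains (continuous_tuple_complex \<UU>) q)
    = {f \<in> extensional (cover_tuples \<UU> q). continuous_cochain \<UU> q f}"
  by (simp add: continuous_tuple_complex_def carrier_tuple_complex)

lemma continuous_tuple_complex_simps:
  "coboundary (continuous_tuple_complex \<UU>) = coboundary (tuple_complex \<UU>)"
  "monoid.mult (cochains (continuous_tuple_complex \<UU>) q) = monoid.mult (cochains (tuple_complex \<UU>) q)"
  "\<one>\<^bsub>cochains (continuous_tuple_complex \<UU>) q\<^esub> = \<one>\<^bsub>cochains (tuple_complex \<UU>) q\<^esub>"
  by (simp_all add: continuous_tuple_complex_def)

lemma continuous_map_tuple_face:
  assumes "k \<le> Suc q"
  shows "continuous_map (subtopology (tuple_topology (Suc q)) (cover_tuples \<UU> (Suc q)))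
    (subtopology (tuple_topology q) (cover_tuples \<UU> q)) (tuple_face q k)"
  unfolding continuous_map_in_subtopology
proof
  show "continuous_map (subtopology (tuple_topology (Suc q)) (cover_tuples \<UU> (Suc q))) (tuple_topology q) (tuple_face q k)"
    unfolding continuous_map_componentwise
    using assms
    by (auto simp: tuple_face_def intro!: continuous_map_from_subtopology continuous_map_product_projection)
  show "tuple_face q k \<in> topspace (subtopology (tuple_topology (Suc q)) (cover_tuples \<UU> (Suc q))) \<rightarrow> cover_tuples \<UU> q"
    using assms tuple_face_mem_cover_tuples by auto
qed

lemma continuous_map_sum_of:
  fixes f :: "'i \<Rightarrow> 'a \<Rightarrow> 'v::topological_ab_group_add"
  assumes "\<And>i. i \<in> A \<Longrightarrow> continuous_map X euclidean (f i)"
  shows "continuous_map X euclidean (\<lambda>x. \<Sum>i\<in>A. f i x)"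
  using assms by (auto simp: continuous_map_atin intro!: tendsto_sum)

lemma continuous_coboundary:
  fixes f :: "(nat \<Rightarrow> 'a::topological_space) \<Rightarrow> 'v::topological_ab_group_add"
  assumes "continuous_cochain \<UU> q f"
  shows "continuous_cochain \<UU> (Suc q) (coboundary (tuple_complex \<UU>) q f)"
proof -
  let ?X = "subtopology (tuple_topology (Suc q)) (cover_tuples \<UU> (Suc q))"
  have face: "continuous_map ?X euclidean (\<lambda>u. f (tuple_face q k u))" if "k \<le> Suc q" for k
    using continuous_map_compose [OF continuous_map_tuple_face [OF that] assms] unfolding o_def .
  have "continuous_map ?X euclidean (\<lambda>u. if even k then f (tuple_face q k u) else - f (tuple_face q k u))"
    if "k \<in> {..Suc q}" for k
    using face [of k] that by (cases "even k") (auto simp: continuous_map_atin simp del: topspace_subtopology intro!: tendsto_minus)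
  then have "continuous_map ?X euclidean (\<lambda>u. alternating_sum (Suc q) (\<lambda>k. f (tuple_face q k u)))"
    unfolding alternating_sum_def by (rule continuous_map_sum_of)
  then show ?thesis
    by (rule continuous_map_eq) (auto simp: tuple_complex_def)
qed

lemma continuous_tuple_complex:
  "abelian_cochain_complex (continuous_tuple_complex \<UU> ::
     ((nat \<Rightarrow> 'a::topological_space) \<Rightarrow> 'v::topological_ab_group_add) cochain_complex)"
proof (rule abelian_cochain_complex.intro)
  let ?A = "tuple_complex \<UU> :: ((nat \<Rightarrow> 'a::topological_space) \<Rightarrow> 'v::topological_ab_group_add) cochain_complex"
  let ?K = "continuous_tuple_complex \<UU> :: ((nat \<Rightarrow> 'a::topological_space) \<Rightarrow> 'v::topological_ab_group_add) cochain_complex"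
  interpret A: abelian_cochain_complex ?A by (rule tuple_complex)
  fix n
  interpret comm_group "cochains ?A n" by (rule A.comm_group)
  have "subgroup (carrier (cochains ?K n)) (cochains ?A n)"
  proof (rule subgroupI)
    show "carrier (cochains ?K n) \<subseteq> carrier (cochains ?A n)"
      by (auto simp: carrier_continuous_tuple_complex carrier_tuple_complex)
    have "continuous_cochain \<UU> n (\<one>\<^bsub>cochains ?A n\<^esub>)"
      by (rule continuous_map_eq [of _ _ "\<lambda>_. 0"]) (auto simp: one_list_cochain list_cochain_def)
    then show "carrier (cochains ?K n) \<noteq> {}"
      using one_list_cochain list_cochain_extensional by (auto simp: carrier_continuous_tuple_complex)
    fix f assume f: "f \<in> carrier (cochains ?K n)"
    then have "continuous_cochain \<UU> n (\<lambda>u. - f u)"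
      by (auto simp: carrier_continuous_tuple_complex continuous_map_atin intro!: tendsto_minus)
    then have "continuous_cochain \<UU> n (\<lambda>u\<in>cover_tuples \<UU> n. - f u)"
      by (rule continuous_map_eq) auto
    then show "inv\<^bsub>cochains ?A n\<^esub> f \<in> carrier (cochains ?K n)"
      using f by (simp add: tuple_complex_def carrier_continuous_tuple_complex inv_functions)
    fix g assume g: "g \<in> carrier (cochains ?K n)"
    have "continuous_cochain \<UU> n (\<lambda>u. f u + g u)"
      using f g by (auto simp: carrier_continuous_tuple_complex continuous_map_atin intro!: tendsto_add)
    then have "continuous_cochain \<UU> n (\<lambda>u\<in>cover_tuples \<UU> n. f u + g u)"
      by (rule continuous_map_eq) auto
    then show "f \<otimes>\<^bsub>cochains ?A n\<^esub> g \<in> carrier (cochains ?K n)"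
      by (simp add: tuple_complex_def carrier_continuous_tuple_complex additive_group_def)
  qed
  then have "group (cochains ?K n)"
    using subgroup_imp_group by (fastforce simp: continuous_tuple_complex_def)
  then show "comm_group (cochains ?K n)"
    using m_comm
    by (intro group.group_comm_groupI)
      (auto simp: continuous_tuple_complex_simps carrier_continuous_tuple_complex carrier_tuple_complex)
  show "coboundary ?K n \<in> hom (cochains ?K n) (cochains ?K (Suc n))"
  proof (rule homI)
    fix x assume "x \<in> carrier (cochains ?K n)"
    then have x: "x \<in> carrier (cochains ?A n)" "continuous_cochain \<UU> n x"
      by (auto simp: carrier_continuous_tuple_complex carrier_tuple_complex)
    have "coboundary ?A n x \<in> carrier (cochains ?A (Suc n))"
      using hom_carrier [OF A.coboundary_hom] x(1) by blast
    then show "coboundary ?K n x \<in> carrier (cochains ?K (Suc n))"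
      using continuous_coboundary [OF x(2)]
      by (simp add: continuous_tuple_complex_simps carrier_continuous_tuple_complex carrier_tuple_complex)
  next
    fix x y assume "x \<in> carrier (cochains ?K n)" "y \<in> carrier (cochains ?K n)"
    then have "x \<in> carrier (cochains ?A n)" "y \<in> carrier (cochains ?A n)"
      by (auto simp: carrier_continuous_tuple_complex carrier_tuple_complex)
    then show "coboundary ?K n (x \<otimes>\<^bsub>cochains ?K n\<^esub> y)
        = coboundary ?K n x \<otimes>\<^bsub>cochains ?K (Suc n)\<^esub> coboundary ?K n y"
      unfolding continuous_tuple_complex_simps by (rule hom_mult [OF A.coboundary_hom])
  qed
  show "coboundary ?K (Suc n) (coboundary ?K n x) = \<one>\<^bsub>cochains ?K (Suc (Suc n))\<^esub>"
    if "x \<in> carrier (cochains ?K n)" for x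
    unfolding continuous_tuple_complex_simps
    using that by (intro A.coboundary_coboundary) (simp add: carrier_continuous_tuple_complex carrier_tuple_complex)
qed

lemma carrier_continuous_subset:
  "carrier (cochains (continuous_tuple_complex \<UU>) q) \<subseteq> carrier (cochains (tuple_complex \<UU>) q)"
  by (auto simp: carrier_continuous_tuple_complex carrier_tuple_complex)


section \<open>Restriction and smoothing on translate covers\<close>

definition refines :: "'a set set \<Rightarrow> 'a set set \<Rightarrow> bool" where
  "refines \<VV> \<UU> \<longleftrightarrow> (\<forall>V\<in>\<VV>. \<exists>U\<in>\<UU>. V \<subseteq> U)"

lemma small_list_refines: "refines \<VV> \<UU> \<Longrightarrow> small_list \<VV> xs \<Longrightarrow> small_list \<UU> xs"
  unfolding refines_def small_list_def by (meson subset_trans)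

lemma cover_tuples_refines: "refines \<VV> \<UU> \<Longrightarrow> cover_tuples \<VV> q \<subseteq> cover_tuples \<UU> q"
  by (auto simp: mem_cover_tuples_iff small_list_refines)

lemma refines_translate_cover: "W \<subseteq> U \<Longrightarrow> refines (translate_cover W) (translate_cover U)"
  by (force simp: refines_def translate_cover_def)

lemma restrict_list_cochain:
  assumes "refines \<VV> \<UU>"
  shows "restrict (list_cochain \<UU> q F) (cover_tuples \<VV> q) = list_cochain \<VV> q F"
  using cover_tuples_refines [OF assms] by (auto simp: list_cochain_def fun_eq_iff restrict_def)

lemma tuple_restriction:
  assumes "refines \<VV> \<UU>"
  shows "abelian_cochain_map (tuple_complex \<UU> :: ((nat \<Rightarrow> 'a) \<Rightarrow> 'v::ab_group_add) cochain_complex)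
     (tuple_complex \<VV>) (\<lambda>q f. restrict f (cover_tuples \<VV> q))"
proof (intro abelian_cochain_map.intro abelian_cochain_map_axioms.intro tuple_complex)
  let ?K = "tuple_complex \<UU> :: ((nat \<Rightarrow> 'a) \<Rightarrow> 'v::ab_group_add) cochain_complex"
  let ?L = "tuple_complex \<VV> :: ((nat \<Rightarrow> 'a) \<Rightarrow> 'v::ab_group_add) cochain_complex"
  fix n
  show "(\<lambda>f. restrict f (cover_tuples \<VV> n)) \<in> hom (cochains ?K n) (cochains ?L n)"
  proof (rule homI)
    show "restrict x (cover_tuples \<VV> n) \<in> carrier (cochains ?L n)" for x
      by (simp add: carrier_tuple_complex)
    fix x y assume "x \<in> carrier (cochains ?K n)" "y \<in> carrier (cochains ?K n)"
    then obtain F G where "x = list_cochain \<UU> n F" "y = list_cochain \<UU> n G"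
      unfolding carrier_tuple_complex by (metis cochain_eq_list_cochain)
    then show "restrict (x \<otimes>\<^bsub>cochains ?K n\<^esub> y) (cover_tuples \<VV> n) =
        restrict x (cover_tuples \<VV> n) \<otimes>\<^bsub>cochains ?L n\<^esub> restrict y (cover_tuples \<VV> n)"
      by (simp add: mult_list_cochain restrict_list_cochain [OF assms])
  qed
  fix x assume "x \<in> carrier (cochains ?K n)"
  then obtain F where "x = list_cochain \<UU> n F"
    unfolding carrier_tuple_complex by (metis cochain_eq_list_cochain)
  then show "restrict (coboundary ?K n x) (cover_tuples \<VV> (Suc n)) = coboundary ?L n (restrict x (cover_tuples \<VV> n))"
    by (simp add: coboundary_list_cochain restrict_list_cochain [OF assms])
qed

lemma continuous_restriction:
  assumes "refines \<VV> \<UU>"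
  shows "abelian_cochain_map
     (continuous_tuple_complex \<UU> :: ((nat \<Rightarrow> 'a::topological_space) \<Rightarrow> 'v::topological_ab_group_add) cochain_complex)
     (continuous_tuple_complex \<VV>) (\<lambda>q f. restrict f (cover_tuples \<VV> q))"
proof (intro abelian_cochain_map.intro abelian_cochain_map_axioms.intro continuous_tuple_complex)
  let ?K = "continuous_tuple_complex \<UU> :: ((nat \<Rightarrow> 'a) \<Rightarrow> 'v) cochain_complex"
  let ?L = "continuous_tuple_complex \<VV> :: ((nat \<Rightarrow> 'a) \<Rightarrow> 'v) cochain_complex"
  interpret A: abelian_cochain_map "tuple_complex \<UU> :: ((nat \<Rightarrow> 'a) \<Rightarrow> 'v) cochain_complex"
    "tuple_complex \<VV>" "\<lambda>q f. restrict f (cover_tuples \<VV> q)"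
    using assms by (rule tuple_restriction)
  fix n
  show "(\<lambda>f. restrict f (cover_tuples \<VV> n)) \<in> hom (cochains ?K n) (cochains ?L n)"
  proof (rule homI)
    fix x assume "x \<in> carrier (cochains ?K n)"
    then have "continuous_cochain \<UU> n x"
      by (simp add: carrier_continuous_tuple_complex)
    then have "continuous_cochain \<VV> n x"
      using cover_tuples_refines [OF assms] by (rule continuous_map_from_subtopology_mono)
    then have "continuous_cochain \<VV> n (restrict x (cover_tuples \<VV> n))"
      by (rule continuous_map_eq) auto
    then show "restrict x (cover_tuples \<VV> n) \<in> carrier (cochains ?L n)"
      by (simp add: carrier_continuous_tuple_complex)
  next
    fix x y assume "x \<in> carrier (cochains ?K n)" "y \<in> carrier (cochains ?K n)"
    then show "restrict (x \<otimes>\<^bsub>cochains ?K n\<^esub> y) (cover_tuples \<VV> n) =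
        restrict x (cover_tuples \<VV> n) \<otimes>\<^bsub>cochains ?L n\<^esub> restrict y (cover_tuples \<VV> n)"
      unfolding continuous_tuple_complex_simps
      using carrier_continuous_subset by (intro hom_mult [OF A.map_hom]) blast+
  qed
  show "restrict (coboundary ?K n x) (cover_tuples \<VV> (Suc n)) = coboundary ?L n (restrict x (cover_tuples \<VV> n))"
    if "x \<in> carrier (cochains ?K n)" for x
    unfolding continuous_tuple_complex_simps
    using that carrier_continuous_subset by (intro A.map_coboundary) blast
qed

lemma continuous_inclusion:
  "abelian_cochain_map
     (continuous_tuple_complex \<UU> :: ((nat \<Rightarrow> 'a::topological_space) \<Rightarrow> 'v::topological_ab_group_add) cochain_complex)
     (tuple_complex \<UU>) (\<lambda>q f. f)"
  by (intro abelian_cochain_map.intro abelian_cochain_map_axioms.intro continuous_tuple_complex tuple_complex)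
    (auto simp: continuous_tuple_complex_simps intro!: homI subsetD [OF carrier_continuous_subset])

lemma nhd_system_directed:
  fixes K :: "'g::topological_group_add set set \<Rightarrow> ((nat \<Rightarrow> 'g) \<Rightarrow> 'v) cochain_complex"
  assumes cx: "\<And>\<UU>. abelian_cochain_complex (K \<UU>)"
    and restr: "\<And>\<UU> \<VV>. refines \<VV> \<UU> \<Longrightarrow> abelian_cochain_map (K \<UU>) (K \<VV>) (\<lambda>q f. restrict f (cover_tuples \<VV> q))"
    and ext: "\<And>\<UU> q. carrier (cochains (K \<UU>) q) \<subseteq> extensional (cover_tuples \<UU> q)"
  shows "directed_system (nhd_system K n)"
proof (rule directed_system.intro)
  interpret K: abelian_cochain_complex "K \<UU>" for \<UU> by (rule cx)
  have R: "abelian_cochain_map (K (translate_cover U)) (K (translate_cover W))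
      (\<lambda>q f. restrict f (cover_tuples (translate_cover W) q))" if "W \<subseteq> U" for U W
    using that by (intro restr refines_translate_cover)
  have ext': "x \<in> extensional (cover_tuples \<UU> n)" if "x \<in> cocycles (K \<UU>) n" for x \<UU>
    using that K.cocycles_subset ext by blast
  show "group (Obj (nhd_system K n) U)" for U
    using K.comm_group_cohomology by (simp add: nhd_system_def comm_group_def)
  have "UNIV \<in> Index (nhd_system K n)"
    by (simp add: nhd_system_def identity_nhds_def)
  then show "Index (nhd_system K n) \<noteq> {}" by blast
  show "Le (nhd_system K n) U U" for U by (simp add: nhd_system_def)
  show "Le (nhd_system K n) U W" if "Le (nhd_system K n) U Z" "Le (nhd_system K n) Z W" for U W Z
    using that by (auto simp: nhd_system_def)
  show "\<exists>Z\<in>Index (nhd_system K n). Le (nhd_system K n) U Z \<and> Le (nhd_system K n) W Z"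
    if "U \<in> Index (nhd_system K n)" "W \<in> Index (nhd_system K n)" for U W
    using that by (intro bexI [of _ "U \<inter> W"]) (auto simp: nhd_system_def identity_nhds_def)
  show "Trans (nhd_system K n) U W \<in> hom (Obj (nhd_system K n) U) (Obj (nhd_system K n) W)"
    if "Le (nhd_system K n) U W" for U W
    using abelian_cochain_map.cohomology_map_hom [OF R] that by (auto simp: nhd_system_def)
  show "Trans (nhd_system K n) U U x = x" if x: "x \<in> carrier (Obj (nhd_system K n) U)" for U x
  proof -
    obtain z where z: "z \<in> cocycles (K (translate_cover U)) n" "x = K.cohomology_class (translate_cover U) n z"
      using x by (auto simp: nhd_system_def K.carrier_cohomology)
    then show ?thesis
      using abelian_cochain_map.map_class [OF R [OF subset_refl] z(1)] ext' [OF z(1)]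
      by (simp add: nhd_system_def extensional_restrict)
  qed
  show "Trans (nhd_system K n) Z W (Trans (nhd_system K n) U Z x) = Trans (nhd_system K n) U W x"
    if le: "Le (nhd_system K n) U Z" "Le (nhd_system K n) Z W" and x: "x \<in> carrier (Obj (nhd_system K n) U)" for U W Z x
  proof -
    have sub: "Z \<subseteq> U" "W \<subseteq> Z" "W \<subseteq> U" using le by (auto simp: nhd_system_def)
    obtain z where z: "z \<in> cocycles (K (translate_cover U)) n" "x = K.cohomology_class (translate_cover U) n z"
      using x by (auto simp: nhd_system_def K.carrier_cohomology)
    have "cover_tuples (translate_cover Z) n \<inter> cover_tuples (translate_cover W) n = cover_tuples (translate_cover W) n"
      using cover_tuples_refines [OF refines_translate_cover [OF sub(2)]] by blast
    then show ?thesis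
      using abelian_cochain_map.map_class [OF R [OF sub(1)] z(1)]
        abelian_cochain_map.map_class [OF R [OF sub(3)] z(1)]
        abelian_cochain_map.map_class [OF R [OF sub(2)] abelian_cochain_map.map_cocycle [OF R [OF sub(1)] z(1)]] z(2)
      by (simp add: nhd_system_def restrict_restrict)
  qed
qed

lemma directed_tuple_system:
  "directed_system (nhd_system (tuple_complex :: 'g::topological_group_add set set \<Rightarrow>
     ((nat \<Rightarrow> 'g) \<Rightarrow> 'v::ab_group_add) cochain_complex) n)"
  by (intro nhd_system_directed tuple_complex tuple_restriction) (auto simp: carrier_tuple_complex)

lemma directed_continuous_system:
  "directed_system (nhd_system (continuous_tuple_complex :: 'g::topological_group_add set set \<Rightarrow>
     ((nat \<Rightarrow> 'g) \<Rightarrow> 'v::topological_ab_group_add) cochain_complex) n)"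
  by (intro nhd_system_directed continuous_tuple_complex continuous_restriction) (auto simp: carrier_continuous_tuple_complex)

lemma open_translate_cover:
  fixes U :: "'g::topological_group_add set"
  assumes "open U" "Z \<in> translate_cover U" shows "open Z"
proof -
  obtain g where g: "Z = (+) g ` U" using assms(2) by (auto simp: translate_cover_def)
  have "(+) g ` U = (\<lambda>x. - g + x) -` U"
    by (force simp: image_iff add.assoc [symmetric])
  moreover have "open ((\<lambda>x. - g + x) -` U)"
    using assms(1) by (intro open_vimage continuous_intros)
  ultimately show ?thesis using g by simp
qed

text \<open>The tuples within one member of the cover form an open set, so continuity may be tested on
each of these sets separately.\<close>

lemma continuous_cochain_local:
  assumes opn: "\<And>U. U \<in> \<UU> \<Longrightarrow> open U"
    and cont: "\<And>U. U \<in> \<UU> \<Longrightarrow> continuous_map (subtopology (tuple_topology q) ({..q} \<rightarrow>\<^sub>E U)) euclidean f"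
  shows "continuous_cochain \<UU> q f"
proof (rule pasting_lemma [where I = \<UU> and T = "\<lambda>U. {..q} \<rightarrow>\<^sub>E U" and f = "\<lambda>_. f"])
  fix U assume U: "U \<in> \<UU>"
  have "openin (tuple_topology q) ({..q} \<rightarrow>\<^sub>E U)"
    using opn [OF U] by (simp add: openin_PiE)
  moreover have "({..q} \<rightarrow>\<^sub>E U) \<subseteq> cover_tuples \<UU> q"
    using U by (auto simp: cover_tuples_def)
  ultimately show "openin (subtopology (tuple_topology q) (cover_tuples \<UU> q)) ({..q} \<rightarrow>\<^sub>E U)"
    by (metis openin_subtopology_Int inf.absorb_iff1)
  show "continuous_map (subtopology (subtopology (tuple_topology q) (cover_tuples \<UU> q)) ({..q} \<rightarrow>\<^sub>E U)) euclidean f"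
    using cont [OF U] \<open>({..q} \<rightarrow>\<^sub>E U) \<subseteq> cover_tuples \<UU> q\<close>
    by (simp add: subtopology_subtopology inf.absorb2)
qed (auto simp: cover_tuples_def)

text \<open>Sample points are at distance \<open>W\<close>. Since \<open>W + W \<subseteq> U\<close>, a tuple that is small of order \<open>W\<close>, together with
sample points for its entries, is small of order \<open>U\<close>. So smoothing maps cochains on the cover by translates
of \<open>U\<close> to cochains on the cover by translates of \<open>W\<close>.\<close>

locale group_smoothing = smoothing T c "\<lambda>x y. - x + y \<in> W"
  for T :: "nat \<Rightarrow> 'g::topological_group_add \<Rightarrow> 'v::topological_ab_group_add \<Rightarrow> 'v" and c W +
  fixes U :: "'g set"
  assumes W: "open W" "0 \<in> W" and add_W: "x \<in> W \<Longrightarrow> y \<in> W \<Longrightarrow> x + y \<in> U"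
begin

lemma W_subset_U: "W \<subseteq> U"
  using add_W [OF _ W(2)] by auto

lemma small_append:
  assumes "set xs \<subseteq> (+) g ` W" "list_all2 (\<lambda>x y. - x + y \<in> W) xs ys" "set zs \<subseteq> (+) g ` W"
  shows "set (zs @ ys) \<subseteq> (+) g ` U"
proof -
  have "y \<in> (+) g ` U" if "y \<in> set ys" for y
  proof -
    obtain x where x: "x \<in> set xs" "- x + y \<in> W"
      using assms(2) \<open>y \<in> set ys\<close> by (metis in_set_conv_nth list_all2_conv_all_nth)
    then have "- g + x \<in> W" using assms(1) by (force simp: add.assoc [symmetric])
    then have "- g + x + (- x + y) \<in> U" using x(2) by (rule add_W)
    then have "- g + y \<in> U" by (simp add: add.assoc)
    then show ?thesis by (intro image_eqI [of _ _ "- g + y"]) (auto simp: add.assoc [symmetric])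
  qed
  then have "set ys \<subseteq> (+) g ` U" by blast
  moreover have "set zs \<subseteq> (+) g ` U" using assms(3) W_subset_U by blast
  ultimately show ?thesis by simp
qed

abbreviation large where "large \<equiv> translate_cover U"
abbreviation small where "small \<equiv> translate_cover W"

lemma refines: "refines small large"
  using W_subset_U by (rule refines_translate_cover)

lemma small_near:
  assumes "small_list small xs" "list_all2 (\<lambda>x y. - x + y \<in> W) xs ys"
  shows "small_list large ys"
proof -
  obtain g where "set xs \<subseteq> (+) g ` W" using assms(1) by (auto simp: small_list_def translate_cover_def)
  from small_append [OF this assms(2), of "[]"] show ?thesis
    by (auto simp: small_list_def translate_cover_def)
qed

lemma small_mixed:
  assumes "small_list small xs" "list_all2 (\<lambda>x y. - x + y \<in> W) (drop k xs) ys"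
  shows "small_list large (take (Suc k) xs @ ys)"
proof -
  obtain g where g: "set xs \<subseteq> (+) g ` W" using assms(1) by (auto simp: small_list_def translate_cover_def)
  then have "set (drop k xs) \<subseteq> (+) g ` W" "set (take (Suc k) xs) \<subseteq> (+) g ` W"
    by (auto dest: in_set_dropD in_set_takeD)
  from small_append [OF this(1) assms(2) this(2)] show ?thesis
    by (auto simp: small_list_def translate_cover_def)
qed

lemma tendsto_coordinates:
  assumes "u \<in> topspace (subtopology (tuple_topology q) S)"
  shows "list_all2 (\<lambda>a x. (a \<longlongrightarrow> x) (atin (subtopology (tuple_topology q) S) u))
    (map (\<lambda>i u. u i) [0..<Suc q]) (tuple_list q u)"
proof -
  have "((\<lambda>u. u i) \<longlongrightarrow> u i) (atin (subtopology (tuple_topology q) S) u)" if i: "i \<le> q" for i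
  proof -
    have "continuous_map (subtopology (tuple_topology q) S) euclidean (\<lambda>u. u i)"
      using i by (intro continuous_map_from_subtopology continuous_map_product_projection) simp
    then show ?thesis
      using assms by (simp only: continuous_map_atin limitin_canonical_iff)
  qed
  then show ?thesis
    by (auto simp: list_all2_conv_all_nth tuple_list_def simp del: upt_Suc)
qed

lemma map_coordinates: "map (\<lambda>a. a u) (map (\<lambda>i u. u i) [0..<Suc q]) = tuple_list q u"
  by (simp add: tuple_list_def del: upt_Suc)

lemma continuous_smooth: "continuous_cochain small q (list_cochain small q (smooth F))"
proof (rule continuous_cochain_local)
  show "open Z" if "Z \<in> small" for Z using W(1) that by (rule open_translate_cover)
  fix Z assume "Z \<in> small"
  let ?X = "subtopology (tuple_topology q) ({..q} \<rightarrow>\<^sub>E Z)"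
  have "continuous_map ?X euclidean (\<lambda>u. smooth F (tuple_list q u))"
    unfolding continuous_map_atin limitin_canonical_iff
  proof
    fix u assume u: "u \<in> topspace ?X"
    show "((\<lambda>u. smooth F (tuple_list q u)) \<longlongrightarrow> smooth F (tuple_list q u)) (atin ?X u)"
      using tendsto_smooth [OF tendsto_coordinates [OF u], of "\<lambda>_. F" F]
      unfolding map_coordinates by simp
  qed
  then show "continuous_map ?X euclidean (list_cochain small q (smooth F))"
    by (rule continuous_map_eq)
      (use \<open>Z \<in> small\<close> in \<open>auto simp: list_cochain_def cover_tuples_def\<close>)
qed

text \<open>The prism operator evaluates the cochain at a tuple whose first entries vary and whose remaining
entries are locally constant sample points.\<close>

lemma continuous_smooth_homotopy:
  assumes F: "continuous_cochain large (Suc q) (list_cochain large (Suc q) F)"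
  shows "continuous_cochain small q (list_cochain small q (smooth_homotopy F))"
proof (rule continuous_cochain_local)
  show "open Z" if "Z \<in> small" for Z using W(1) that by (rule open_translate_cover)
  fix Z assume Z: "Z \<in> small"
  let ?X = "subtopology (tuple_topology q) ({..q} \<rightarrow>\<^sub>E Z)"
  have "continuous_map ?X euclidean (\<lambda>u. smooth_homotopy F (tuple_list q u))"
    unfolding continuous_map_atin limitin_canonical_iff
  proof
    fix u assume u: "u \<in> topspace ?X"
    let ?a = "map (\<lambda>i u. u i) [0..<Suc q] :: ((nat \<Rightarrow> 'g) \<Rightarrow> 'g) list"
    have "((\<lambda>v. F (map (\<lambda>a. a v) (take (Suc k) ?a) @ ys)) \<longlongrightarrow> F (take (Suc k) (tuple_list q u) @ ys)) (atin ?X u)"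
      if k: "k < length (tuple_list q u)" and near: "list_all2 (\<lambda>x y. - x + y \<in> W) (drop k (tuple_list q u)) ys" for k ys
    proof -
      obtain g where g: "Z = (+) g ` W" using Z by (auto simp: translate_cover_def)
      define w where "w v = list_tuple (Suc q) (take (Suc k) (tuple_list q v) @ ys)" for v :: "nat \<Rightarrow> 'g"
      have k: "k \<le> q" and len_take: "length (take (Suc k) (tuple_list q v)) = Suc k" for v
        using k by auto
      have len: "length (take (Suc k) (tuple_list q v) @ ys) = Suc (Suc q)" for v
        using list_all2_lengthD [OF near] k by simp
      have in_Z: "set (tuple_list q v) \<subseteq> Z" if "v \<in> topspace ?X" for v
        using that by (auto simp: set_tuple_list dest: PiE_mem)
      have "set (drop k (tuple_list q u)) \<subseteq> (+) g ` W"
        using in_Z [OF u] set_drop_subset unfolding g by (rule subset_trans [rotated])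
      then have "set (take (Suc k) (tuple_list q v) @ ys) \<subseteq> (+) g ` U" if "v \<in> topspace ?X" for v
        using near in_Z [OF that] set_take_subset unfolding g
        by (rule small_append [OF _ _ subset_trans [rotated]])
      then have "small_list large (take (Suc k) (tuple_list q v) @ ys)" if "v \<in> topspace ?X" for v
        using that unfolding small_list_def translate_cover_def by blast
      then have w_mem: "w v \<in> cover_tuples large (Suc q)" if "v \<in> topspace ?X" for v
        unfolding w_def using len that by (intro list_tuple_mem_cover_tuples)
      have "continuous_map ?X (tuple_topology (Suc q)) w"
        unfolding continuous_map_componentwise
      proof (intro conjI ballI)
        show "w ` topspace ?X \<subseteq> extensional {..Suc q}"
          by (auto simp: w_def list_tuple_def)
        fix i assume i: "i \<in> {..Suc q}"
        show "continuous_map ?X euclidean (\<lambda>v. w v i)"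
        proof (cases "i < Suc k")
          case True
          then have "w v i = v i" for v
            using i k by (simp only: w_def list_tuple_def nth_append len_take restrict_apply if_True)
              (simp add: tuple_list_def del: upt_Suc)
          then have eq: "(\<lambda>v. w v i) = (\<lambda>v. v i)" by blast
          have "i \<in> {..q}" using True k by simp
          then show ?thesis
            unfolding eq by (intro continuous_map_from_subtopology continuous_map_product_projection)
        next
          case False
          then have "w v i = ys ! (i - Suc k)" for v
            using i by (simp only: w_def list_tuple_def nth_append len_take restrict_apply if_True if_False)
          then show ?thesis by simp
        qed
      qed
      then have w: "continuous_map ?X (subtopology (tuple_topology (Suc q)) (cover_tuples large (Suc q))) w"
        using w_mem by (simp add: continuous_map_in_subtopology image_subset_iff Pi_iff)
      have "continuous_map ?X euclidean (\<lambda>v. list_cochain large (Suc q) F (w v))"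
        using continuous_map_compose [OF w F] unfolding o_def .
      then have "continuous_map ?X euclidean (\<lambda>v. F (take (Suc k) (tuple_list q v) @ ys))"
      proof (rule continuous_map_eq)
        show "list_cochain large (Suc q) F (w v) = F (take (Suc k) (tuple_list q v) @ ys)"
          if "v \<in> topspace ?X" for v
          using w_mem [OF that] len [of v]
          by (simp add: list_cochain_def w_def tuple_list_list_tuple)
      qed
      then have "((\<lambda>v. F (take (Suc k) (tuple_list q v) @ ys)) \<longlongrightarrow> F (take (Suc k) (tuple_list q u) @ ys)) (atin ?X u)"
        using u by (simp only: continuous_map_atin limitin_canonical_iff)
      then show ?thesis
        by (simp add: tuple_list_def take_map o_def del: upt_Suc)
    qed
    then show "((\<lambda>u. smooth_homotopy F (tuple_list q u)) \<longlongrightarrow> smooth_homotopy F (tuple_list q u)) (atin ?X u)"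
      using tendsto_smooth_homotopy [OF tendsto_coordinates [OF u], of "\<lambda>_. F" F]
      unfolding map_coordinates by simp
  qed
  then show "continuous_map ?X euclidean (list_cochain small q (smooth_homotopy F))"
    by (rule continuous_map_eq)
      (use Z in \<open>auto simp: list_cochain_def cover_tuples_def\<close>)
qed

end


section \<open>Continuous and arbitrary cochains\<close>

lemma loop_contractibleE:
  assumes "loop_contractible TYPE('v::topological_group_add)"
  obtains \<Phi> :: "real \<Rightarrow> 'v::topological_group_add \<Rightarrow> 'v" where "continuous_on ({0..1} \<times> UNIV) (\<lambda>(t, v). \<Phi> t v)"
    "\<And>v. \<Phi> 0 v = v" "\<And>v. \<Phi> 1 v = 0" "\<And>t v w. t \<in> {0..1} \<Longrightarrow> \<Phi> t (v + w) = \<Phi> t v + \<Phi> t w"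
proof -
  obtain h where h: "continuous_map (prod_topology (top_of_set {0..1::real}) (euclidean :: 'v topology)) euclidean h"
    "\<And>v. h (0, v) = v" "\<And>v. h (1, v) = 0" "\<And>t v w. t \<in> {0..1} \<Longrightarrow> h (t, v + w) = h (t, v) + h (t, w)"
    using assms unfolding loop_contractible_def homotopic_with_def by auto
  have "prod_topology (top_of_set {0..1::real}) (euclidean :: 'v topology) = top_of_set ({0..1} \<times> UNIV)"
    by (metis prod_topology_subtopology_eu subtopology_UNIV)
  then have "continuous_on ({0..1} \<times> UNIV) h"
    using h(1) by simp
  then show thesis
    using that [of "\<lambda>t v. h (t, v)"] h by simp
qed

text \<open>The weights \<open>T k x = \<Phi> (s k x) - \<Phi> (s (Suc k) x)\<close> are endomorphisms because each stage of the contraction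
is one, and their sum telescopes to \<open>\<Phi> 0 - \<Phi> 1\<close>, the identity.\<close>

lemma exists_group_smoothing:
  fixes U :: "'g::topological_group_add set"
  assumes V: "loop_contractible TYPE('v::topological_ab_group_add)" and U: "open U" "0 \<in> U"
  obtains W and T :: "nat \<Rightarrow> 'g::topological_group_add \<Rightarrow> 'v::topological_ab_group_add \<Rightarrow> 'v" and c where "group_smoothing T c W U"
proof -
  obtain \<Phi> :: "real \<Rightarrow> 'v \<Rightarrow> 'v" where cont: "continuous_on ({0..1} \<times> UNIV) (\<lambda>(t, v). \<Phi> t v)"
    and \<Phi>: "\<And>v. \<Phi> 0 v = v" "\<And>v. \<Phi> 1 v = 0" "\<And>t v w. t \<in> {0..1} \<Longrightarrow> \<Phi> t (v + w) = \<Phi> t v + \<Phi> t w"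
    using loop_contractibleE [OF V] by blast
  obtain W where W: "open W" "0 \<in> W" "\<And>x y z. x \<in> W \<Longrightarrow> y \<in> W \<Longrightarrow> z \<in> W \<Longrightarrow> x + y + z \<in> U"
    using identity_nhd_third [OF U] by metis
  obtain d :: "'g \<Rightarrow> 'g \<Rightarrow> real" where "continuous_pseudometric d"
    and d: "\<And>x y. d x y < 1/2 \<Longrightarrow> - x + y \<in> W"
    using uniform_pseudometric [OF W(1,2)] by blast
  then obtain s c where "ladder d s c"
    using continuous_pseudometric.exists_ladder by blast
  then interpret L: ladder d s c .
  define T where "T k x v = \<Phi> (s k x) v - \<Phi> (s (Suc k) x) v" for k x v
  have T0: "T k x v = 0" if "s k x = s (Suc k) x" for k x v
    using that by (simp add: T_def)
  have "group_smoothing T c W U"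
  proof
    show "T k x (v + w) = T k x v + T k x w" for k x v w
      unfolding T_def \<Phi>(3) [OF L.s_range] by simp
    show "((\<lambda>(y, w). T k y w) \<longlongrightarrow> T k x v) (nhds (x, v))" for k x v
    proof -
      have "continuous_on UNIV (\<lambda>p. \<Phi> (s n (fst p)) (snd p))" for n
      proof -
        have "continuous_on UNIV (\<lambda>p::'g \<times> 'v. (s n (fst p), snd p))"
          by (intro continuous_intros continuous_on_compose2 [OF L.s_continuous]) auto
        moreover have "(\<lambda>p::'g \<times> 'v. (s n (fst p), snd p)) ` UNIV \<subseteq> {0..1} \<times> UNIV"
          using L.s_range [of n] by (simp add: image_subset_iff)
        ultimately have "continuous_on UNIV (\<lambda>p. case (s n (fst p), snd p) of (t, v) \<Rightarrow> \<Phi> t v)"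
          by (rule continuous_on_compose2 [OF cont])
        then show ?thesis by simp
      qed
      then have "continuous_on UNIV (\<lambda>p. T k (fst p) (snd p))"
        unfolding T_def by (intro continuous_intros)
      then have "((\<lambda>p. T k (fst p) (snd p)) \<longlongrightarrow> T k x v) (at (x, v))"
        by (auto simp: continuous_on_def)
      then have "((\<lambda>p. T k (fst p) (snd p)) \<longlongrightarrow> T k x v) (nhds (x, v))"
        using tendsto_at_iff_tendsto_nhds [of "\<lambda>p. T k (fst p) (snd p)" "(x, v)"] by simp
      then show ?thesis by (simp add: case_prod_unfold)
    qed
    show "\<exists>M. \<forall>\<^sub>F y in nhds x. \<forall>k\<ge>M. \<forall>v. T k y v = 0" for x
    proof -
      obtain M where "\<forall>\<^sub>F y in nhds x. \<forall>k\<ge>M. s k y = 1" using L.s_locally_one by blast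
      then have "\<forall>\<^sub>F y in nhds x. \<forall>k\<ge>M. \<forall>v. T k y v = 0"
        by (rule eventually_mono) (simp add: T0)
      then show ?thesis by blast
    qed
    show "(\<Sum>k<M. T k x v) = v" if M: "\<forall>k\<ge>M. \<forall>v. T k x v = 0" for M x v
    proof -
      have sum: "(\<Sum>k<N. T k x v) = v - \<Phi> (s N x) v" for N
        by (induction N) (simp_all add: T_def L.s_zero \<Phi>(1))
      obtain L where "\<forall>\<^sub>F y in nhds x. \<forall>k\<ge>L. s k y = 1" using L.s_locally_one by blast
      from eventually_nhds_x_imp_x [OF this] have L: "s (max L M) x = 1" by simp
      have "(\<Sum>k<M. T k x v) = (\<Sum>k<max L M. T k x v)"
        using M by (intro sum.mono_neutral_left) auto
      also have "\<dots> = v"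
        unfolding sum L by (simp add: \<Phi>(2))
      finally show ?thesis .
    qed
    show "(\<forall>\<^sub>F y in nhds x. \<forall>v. T k y v = 0) \<or>
      (\<exists>z. - x + z \<in> W \<and> (\<forall>\<^sub>F y in nhds x. (\<forall>v. T k y v = 0) \<or> c k y = z))" for k x
      using L.c_local [where x = x and n = k]
    proof (elim disjE exE conjE)
      assume "\<forall>\<^sub>F y in nhds x. s k y = s (Suc k) y"
      then have "\<forall>\<^sub>F y in nhds x. \<forall>v. T k y v = 0"
        by (rule eventually_mono) (simp add: T0)
      then show ?thesis ..
    next
      fix z assume z: "d x z < 1/2" and "\<forall>\<^sub>F y in nhds x. s k y = s (Suc k) y \<or> c k y = z"
      from this(2) have "\<forall>\<^sub>F y in nhds x. (\<forall>v. T k y v = 0) \<or> c k y = z"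
        by (rule eventually_mono) (auto simp: T0)
      with d [OF z] show ?thesis by blast
    qed
    show "x + y \<in> U" if "x \<in> W" "y \<in> W" for x y
      using W(3) [OF that W(2)] by simp
  qed (use W in auto)
  then show thesis by (rule that)
qed

lemma inv_list_cochain:
  "inv\<^bsub>cochains (tuple_complex \<UU>) q\<^esub> (list_cochain \<UU> q F) = list_cochain \<UU> q (\<lambda>xs. - F xs)"
  by (simp add: tuple_complex_def inv_functions list_cochain_extensional)
    (auto simp: list_cochain_def intro!: restrict_ext)

lemma cocycle_list_cochainE:
  assumes "z \<in> cocycles (tuple_complex \<UU>) n"
  obtains F where "z = list_cochain \<UU> n F"
    "\<And>xs. length xs = Suc (Suc n) \<Longrightarrow> small_list \<UU> xs \<Longrightarrow> list_coboundary F xs = 0"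
proof -
  have "z \<in> extensional (cover_tuples \<UU> n)"
    using assms by (simp add: cocycles_def kernel_def carrier_tuple_complex)
  then obtain F where F: "z = list_cochain \<UU> n F"
    using cochain_eq_list_cochain by blast
  have "list_cochain \<UU> (Suc n) (list_coboundary F) = list_cochain \<UU> (Suc n) (\<lambda>_. 0)"
    using assms unfolding F by (simp add: cocycles_def kernel_def coboundary_list_cochain one_list_cochain)
  from list_cochain_eqD [OF this] F show thesis using that by blast
qed

lemma list_cochain_cocycleI:
  assumes "\<And>xs. length xs = Suc (Suc n) \<Longrightarrow> small_list \<UU> xs \<Longrightarrow> list_coboundary F xs = 0"
  shows "list_cochain \<UU> n F \<in> cocycles (tuple_complex \<UU>) n"
  using list_cochain_cong [of "Suc n" \<UU> "list_coboundary F" "\<lambda>_. 0"] assms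
  by (simp add: cocycles_def kernel_def coboundary_list_cochain carrier_tuple_complex list_cochain_extensional one_list_cochain)

text \<open>In degree \<open>0\<close> the only coboundary is zero, whereas \<^const>\<open>list_coboundary\<close> is augmented. The condition
on \<open>G []\<close> reconciles the two.\<close>

lemma list_cochain_coboundaryI:
  assumes "\<And>xs. length xs = Suc n \<Longrightarrow> small_list \<UU> xs \<Longrightarrow> F xs = list_coboundary G xs"
    and "n = 0 \<Longrightarrow> G [] = 0"
  shows "list_cochain \<UU> n F \<in> coboundaries (tuple_complex \<UU>) n"
proof (cases n)
  case 0
  have "F xs = 0" if xs: "length xs = Suc n" "small_list \<UU> xs" for xs
  proof -
    obtain x where "xs = [x]" using xs(1) 0 by (cases xs) auto
    then show ?thesis using assms(1) [OF xs] assms(2) [OF 0] by simp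
  qed
  then have "list_cochain \<UU> n F = list_cochain \<UU> n (\<lambda>_. 0)" by (rule list_cochain_cong)
  then show ?thesis by (simp add: 0 coboundaries_def one_list_cochain)
next
  case (Suc m)
  have "list_cochain \<UU> n F = list_cochain \<UU> n (list_coboundary G)"
    using assms(1) by (rule list_cochain_cong)
  then have "list_cochain \<UU> n F = coboundary (tuple_complex \<UU>) m (list_cochain \<UU> m G)"
    unfolding coboundary_list_cochain using Suc by simp
  then show ?thesis
    by (simp add: Suc coboundaries_def carrier_tuple_complex list_cochain_extensional)
qed

lemma list_cochain_continuous_coboundaryI:
  fixes F :: "'a::topological_space list \<Rightarrow> 'v::topological_ab_group_add"
  assumes "\<And>xs. length xs = Suc n \<Longrightarrow> small_list \<UU> xs \<Longrightarrow> F xs = list_coboundary G xs"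
    and "n = 0 \<Longrightarrow> G [] = 0" and "\<And>m. n = Suc m \<Longrightarrow> continuous_cochain \<UU> m (list_cochain \<UU> m G)"
  shows "list_cochain \<UU> n F \<in> coboundaries (continuous_tuple_complex \<UU>) n"
proof -
  have coboundary: "list_cochain \<UU> n F \<in> coboundaries (tuple_complex \<UU>) n"
    using assms(1,2) by (rule list_cochain_coboundaryI)
  show ?thesis
  proof (cases n)
    case 0
    then show ?thesis
      using coboundary by (simp add: coboundaries_def continuous_tuple_complex_simps)
  next
    case (Suc m)
    have "list_cochain \<UU> n F = list_cochain \<UU> n (list_coboundary G)"
      using assms(1) by (rule list_cochain_cong)
    then have "list_cochain \<UU> n F = coboundary (tuple_complex \<UU>) m (list_cochain \<UU> m G)"
      unfolding coboundary_list_cochain using Suc by simp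
    then show ?thesis
      using assms(3) [OF Suc]
      by (auto simp: Suc coboundaries_def continuous_tuple_complex_simps carrier_continuous_tuple_complex list_cochain_extensional)
  qed
qed

lemma coboundary_list_cochainE:
  assumes "z \<in> coboundaries (tuple_complex \<UU>) n" "z = list_cochain \<UU> n F"
  obtains G where "\<And>xs. length xs = Suc n \<Longrightarrow> small_list \<UU> xs \<Longrightarrow> F xs = list_coboundary G xs" "n = 0 \<Longrightarrow> G [] = 0"
proof (cases n)
  case 0
  then have "list_cochain \<UU> n F = list_cochain \<UU> n (\<lambda>_. 0)"
    using assms by (simp add: coboundaries_def one_list_cochain)
  from list_cochain_eqD [OF this] show thesis
    by (intro that [of "\<lambda>_. 0"]) (simp_all add: list_coboundary_zero)
next
  case (Suc m)
  then obtain f where f: "f \<in> extensional (cover_tuples \<UU> m)" "z = coboundary (tuple_complex \<UU>) m f"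
    using assms(1) by (auto simp: coboundaries_def carrier_tuple_complex)
  then obtain G where "f = list_cochain \<UU> m G"
    using cochain_eq_list_cochain by blast
  then have "list_cochain \<UU> n F = list_cochain \<UU> n (list_coboundary G)"
    using f assms(2) Suc by (simp add: coboundary_list_cochain)
  from list_cochain_eqD [OF this] show thesis
    using that Suc by blast
qed

context group_smoothing
begin

lemma smooth_cocycle:
  assumes "\<And>xs. length xs = Suc (Suc n) \<Longrightarrow> small_list large xs \<Longrightarrow> list_coboundary F xs = 0"
  shows "list_cochain small n (smooth F) \<in> cocycles (continuous_tuple_complex small) n"
proof -
  have "list_cochain small n (smooth F) \<in> cocycles (tuple_complex small) n"
  proof (rule list_cochain_cocycleI)
    fix xs :: "'g list" assume xs: "length xs = Suc (Suc n)" "small_list small xs"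
    have "smooth (list_coboundary F) xs = smooth (\<lambda>_. 0) xs"
      using xs small_near by (intro smooth_cong assms) (auto dest: list_all2_lengthD)
    also have "\<dots> = 0"
      using smooth_diff [of "\<lambda>_. 0" "\<lambda>_. 0" xs] by simp
    finally show "list_coboundary (smooth F) xs = 0"
      by (simp add: smooth_coboundary)
  qed
  then show ?thesis
    using continuous_smooth
    by (simp add: cocycles_def kernel_def continuous_tuple_complex_simps carrier_continuous_tuple_complex carrier_tuple_complex)
qed

text \<open>The other half of the homotopy vanishes because the lists at which it evaluates \<open>list_coboundary F\<close>
are small of order \<open>U\<close>.\<close>

lemma smooth_homotopic:
  assumes "\<And>xs. length xs = Suc (Suc n) \<Longrightarrow> small_list large xs \<Longrightarrow> list_coboundary F xs = 0"
    and xs: "length xs = Suc n" "small_list small xs"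
  shows "smooth F xs - F xs = list_coboundary (smooth_homotopy F) xs"
proof -
  have "smooth_homotopy (list_coboundary F) xs = smooth_homotopy (\<lambda>_. 0) xs"
  proof (rule smooth_homotopy_cong)
    fix k ys assume "k < length xs" "list_all2 (\<lambda>x y. - x + y \<in> W) (drop k xs) ys"
    then show "list_coboundary F (take (Suc k) xs @ ys) = 0"
      using xs small_mixed by (intro assms(1)) (auto dest: list_all2_lengthD)
  qed
  also have "\<dots> = 0"
    using smooth_homotopy_diff [of "\<lambda>_. 0" "\<lambda>_. 0" xs] by simp
  finally show ?thesis
    using smooth_homotopy [of F xs] by simp
qed

lemma smooth_exact:
  assumes "\<And>xs. length xs = Suc n \<Longrightarrow> small_list large xs \<Longrightarrow> F xs = list_coboundary G xs"
    and xs: "length xs = Suc n" "small_list small xs"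
  shows "smooth F xs = list_coboundary (smooth G) xs"
proof -
  have "smooth F xs = smooth (list_coboundary G) xs"
    using xs small_near by (intro smooth_cong assms(1)) (auto dest: list_all2_lengthD)
  then show ?thesis by (simp add: smooth_coboundary)
qed

end

lemma inclusion_map_natural:
  fixes U :: "'g::topological_group_add set"
    and x :: "((nat \<Rightarrow> 'g) \<Rightarrow> 'v::topological_ab_group_add) set"
  assumes WU: "W \<subseteq> U" and x: "x \<in> carrier (cohomology (continuous_tuple_complex (translate_cover U)) n)"
  shows "inclusion_map n W (Trans (nhd_system continuous_tuple_complex n) U W x)
    = Trans (nhd_system tuple_complex n) U W (inclusion_map n U x)"
proof -
  let ?r = "\<lambda>q (f :: (nat \<Rightarrow> 'g) \<Rightarrow> 'v). restrict f (cover_tuples (translate_cover W) q)"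
  interpret I: abelian_cochain_map "continuous_tuple_complex \<UU>"
    "tuple_complex \<UU> :: ((nat \<Rightarrow> 'g) \<Rightarrow> 'v) cochain_complex" "\<lambda>_ f. f" for \<UU>
    by (rule continuous_inclusion)
  interpret C: abelian_cochain_map "continuous_tuple_complex (translate_cover U)"
    "continuous_tuple_complex (translate_cover W) :: ((nat \<Rightarrow> 'g) \<Rightarrow> 'v) cochain_complex" ?r
    using WU by (intro continuous_restriction refines_translate_cover)
  interpret A: abelian_cochain_map "tuple_complex (translate_cover U)"
    "tuple_complex (translate_cover W) :: ((nat \<Rightarrow> 'g) \<Rightarrow> 'v) cochain_complex" ?r
    using WU by (intro tuple_restriction refines_translate_cover)
  obtain z where z: "z \<in> cocycles (continuous_tuple_complex (translate_cover U)) n"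
    "x = I.K.cohomology_class (translate_cover U) n z"
    using x by (auto simp: I.K.carrier_cohomology)
  then show ?thesis
    using C.map_class [OF z(1)] C.map_cocycle [OF z(1)] A.map_class [OF I.map_cocycle [OF z(1)]]
    by (simp add: nhd_system_def inclusion_map_def I.map_class)
qed

text \<open>A cocycle is cohomologous to its smoothing, which is continuous; this is surjectivity. If a
continuous cocycle \<open>F\<close> is the coboundary of \<open>G\<close>, then its smoothing is the coboundary of the smoothing of \<open>G\<close>,
and the homotopy between \<open>F\<close> and its smoothing is continuous, so \<open>F\<close> is the coboundary of a continuous
cochain on a finer cover; this is injectivity.\<close>

theorem inclusion_colimit_iso:
  fixes n :: nat
  assumes V: "loop_contractible TYPE('v::topological_ab_group_add)"
  shows "colimit_map (nhd_system (tuple_complex :: 'g::topological_group_add set set \<Rightarrow>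
      ((nat \<Rightarrow> 'g) \<Rightarrow> 'v) cochain_complex) n) (inclusion_map n)
    \<in> iso (colimit (nhd_system continuous_tuple_complex n)) (colimit (nhd_system tuple_complex n))"
proof (rule colimit_map_iso [OF directed_continuous_system directed_tuple_system])
  let ?A = "tuple_complex :: 'g set set \<Rightarrow> ((nat \<Rightarrow> 'g) \<Rightarrow> 'v) cochain_complex"
  let ?C = "continuous_tuple_complex :: 'g set set \<Rightarrow> ((nat \<Rightarrow> 'g) \<Rightarrow> 'v) cochain_complex"
  interpret I: abelian_cochain_map "?C \<UU>" "?A \<UU>" "\<lambda>_ f. f" for \<UU> by (rule continuous_inclusion)
  let ?r = "\<lambda>W q (f :: (nat \<Rightarrow> 'g) \<Rightarrow> 'v). restrict f (cover_tuples (translate_cover W) q)"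
  have rC: "abelian_cochain_map (?C (translate_cover U)) (?C (translate_cover W)) (?r W)" if "W \<subseteq> U" for U W
    using that by (intro continuous_restriction refines_translate_cover)
  have rA: "abelian_cochain_map (?A (translate_cover U)) (?A (translate_cover W)) (?r W)" if "W \<subseteq> U" for U W
    using that by (intro tuple_restriction refines_translate_cover)
  show "Index (nhd_system ?A n) = Index (nhd_system ?C n)" "Le (nhd_system ?A n) = Le (nhd_system ?C n)"
    by (simp_all add: nhd_system_def)
  show "inclusion_map n U \<in> hom (Obj (nhd_system ?C n) U) (Obj (nhd_system ?A n) U)" for U
    using I.cohomology_map_hom by (simp add: nhd_system_def inclusion_map_def)
  show "inclusion_map n W (Trans (nhd_system ?C n) U W x) = Trans (nhd_system ?A n) U W (inclusion_map n U x)"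
    if "Le (nhd_system ?C n) U W" "x \<in> carrier (Obj (nhd_system ?C n) U)" for U W x
    using that by (intro inclusion_map_natural) (simp_all add: nhd_system_def)
  show "\<exists>W\<in>Index (nhd_system ?C n). Le (nhd_system ?C n) U W \<and> Trans (nhd_system ?C n) U W x = \<one>\<^bsub>Obj (nhd_system ?C n) W\<^esub>"
    if U: "U \<in> Index (nhd_system ?C n)" and x: "x \<in> carrier (Obj (nhd_system ?C n) U)"
      and one: "inclusion_map n U x = \<one>\<^bsub>Obj (nhd_system ?A n) U\<^esub>" for U x
  proof -
    obtain z where z: "z \<in> cocycles (?C (translate_cover U)) n" "x = I.K.cohomology_class (translate_cover U) n z"
      using x by (auto simp: nhd_system_def I.K.carrier_cohomology)
    have "open U" "0 \<in> U" using U by (auto simp: nhd_system_def identity_nhds_def)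
    then obtain W T c where "group_smoothing (T :: nat \<Rightarrow> 'g \<Rightarrow> 'v \<Rightarrow> 'v) c W U"
      using exists_group_smoothing [OF V] by metis
    then interpret group_smoothing T c W U .
    have zA: "z \<in> cocycles (?A large) n" using I.map_cocycle [OF z(1)] .
    then obtain F where F: "z = list_cochain large n F"
        "\<And>xs. length xs = Suc (Suc n) \<Longrightarrow> small_list large xs \<Longrightarrow> list_coboundary F xs = 0"
      by (rule cocycle_list_cochainE) blast
    have "z \<in> coboundaries (?A large) n"
      using one I.L.class_eq_one_iff [OF zA] z by (simp add: nhd_system_def inclusion_map_def I.map_class)
    then obtain G where G: "\<And>xs. length xs = Suc n \<Longrightarrow> small_list large xs \<Longrightarrow> F xs = list_coboundary G xs"
        "n = 0 \<Longrightarrow> G [] = 0"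
      using F(1) by (rule coboundary_list_cochainE) blast
    have "list_cochain small n F \<in> coboundaries (?C small) n"
    proof (rule list_cochain_continuous_coboundaryI [where G = "\<lambda>xs. smooth G xs - smooth_homotopy F xs"])
      show "F xs = list_coboundary (\<lambda>xs. smooth G xs - smooth_homotopy F xs) xs"
        if "length xs = Suc n" "small_list small xs" for xs
        using smooth_exact [OF G(1) that] smooth_homotopic [OF F(2) that]
        by (simp add: list_coboundary_diff algebra_simps)
      show "smooth G [] - smooth_homotopy F [] = 0" if "n = 0"
        using G(2) that by simp
      show "continuous_cochain small m (list_cochain small m (\<lambda>xs. smooth G xs - smooth_homotopy F xs))" if n: "n = Suc m" for m
      proof -
        have "z \<in> carrier (cochains (?C large) n)"
          using I.K.cocycles_subset z(1) by blast
        then have "continuous_cochain large n z"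
          by (simp add: carrier_continuous_tuple_complex)
        then have "continuous_cochain large (Suc m) (list_cochain large (Suc m) F)"
          using F(1) n by simp
        then have "continuous_cochain small m (list_cochain small m (smooth_homotopy F))"
          by (rule continuous_smooth_homotopy)
        then have "continuous_cochain small m (\<lambda>u. list_cochain small m (smooth G) u - list_cochain small m (smooth_homotopy F) u)"
          using continuous_smooth [of m G]
          by (simp add: continuous_map_atin tendsto_diff)
        then show ?thesis
          by (rule continuous_map_eq) (auto simp: list_cochain_def)
      qed
    qed
    then have "?r W n z \<in> coboundaries (?C small) n"
      unfolding F(1) restrict_list_cochain [OF refines] .
    then have "Trans (nhd_system ?C n) U W x = \<one>\<^bsub>Obj (nhd_system ?C n) W\<^esub>"
      using abelian_cochain_map.map_class [OF rC [OF W_subset_U] z(1)] z(2)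
        I.K.class_eq_one_iff [OF abelian_cochain_map.map_cocycle [OF rC [OF W_subset_U] z(1)]]
      by (simp add: nhd_system_def)
    then show ?thesis
      using W W_subset_U by (intro bexI [of _ W]) (auto simp: nhd_system_def identity_nhds_def)
  qed
  show "\<exists>W\<in>Index (nhd_system ?C n). Le (nhd_system ?C n) U W \<and>
      (\<exists>x\<in>carrier (Obj (nhd_system ?C n) W). inclusion_map n W x = Trans (nhd_system ?A n) U W y)"
    if U: "U \<in> Index (nhd_system ?C n)" and y: "y \<in> carrier (Obj (nhd_system ?A n) U)" for U y
  proof -
    obtain z where z: "z \<in> cocycles (?A (translate_cover U)) n" "y = I.L.cohomology_class (translate_cover U) n z"
      using y by (auto simp: nhd_system_def I.L.carrier_cohomology)
    have "open U" "0 \<in> U" using U by (auto simp: nhd_system_def identity_nhds_def)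
    then obtain W T c where "group_smoothing (T :: nat \<Rightarrow> 'g \<Rightarrow> 'v \<Rightarrow> 'v) c W U"
      using exists_group_smoothing [OF V] by metis
    then interpret group_smoothing T c W U .
    obtain F where F: "z = list_cochain large n F"
        "\<And>xs. length xs = Suc (Suc n) \<Longrightarrow> small_list large xs \<Longrightarrow> list_coboundary F xs = 0"
      using z(1) by (rule cocycle_list_cochainE) blast
    let ?p = "list_cochain small n (smooth F)"
    have p: "?p \<in> cocycles (?C small) n" using F(2) by (rule smooth_cocycle)
    have r: "?r W n z \<in> cocycles (?A small) n"
      using z(1) by (rule abelian_cochain_map.map_cocycle [OF rA [OF W_subset_U]])
    have rz: "?r W n z = list_cochain small n F"
      unfolding F(1) by (rule restrict_list_cochain [OF refines])
    have "list_cochain small n (\<lambda>xs. smooth F xs - F xs) \<in> coboundaries (?A small) n"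
      using smooth_homotopic [OF F(2)] by (rule list_cochain_coboundaryI) auto
    then have "?p \<otimes>\<^bsub>cochains (?A small) n\<^esub> inv\<^bsub>cochains (?A small) n\<^esub> (?r W n z) \<in> coboundaries (?A small) n"
      unfolding rz by (simp add: inv_list_cochain mult_list_cochain)
    then have "I.L.cohomology_class small n ?p = I.L.cohomology_class small n (?r W n z)"
      using I.L.class_eq_iff [OF I.map_cocycle [OF p] r] by simp
    then have "inclusion_map n W (I.K.cohomology_class small n ?p) = Trans (nhd_system ?A n) U W y"
      using I.map_class [OF p] abelian_cochain_map.map_class [OF rA [OF W_subset_U] z(1)] z(2)
      by (simp add: nhd_system_def inclusion_map_def)
    moreover have "I.K.cohomology_class small n ?p \<in> carrier (Obj (nhd_system ?C n) W)"
      using I.K.class_closed [OF p] by (simp add: nhd_system_def)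
    ultimately show ?thesis
      using W W_subset_U by (intro bexI [of _ W]) (auto simp: nhd_system_def identity_nhds_def)
  qed
qed


section \<open>Contractions of carried acyclic complexes\<close>

text \<open>The coefficients \<open>V\<close> are only an abelian group, so integer multiples are iterated sums.\<close>

definition int_scale :: "int \<Rightarrow> 'v::ab_group_add \<Rightarrow> 'v" where
  "int_scale k v = (\<Sum>i<nat k. v) - (\<Sum>i<nat (- k). v)"

lemma int_scale_zero [simp]: "int_scale 0 v = 0"
  and int_scale_one [simp]: "int_scale 1 v = v"
  by (simp_all add: int_scale_def)

lemma int_scale_add: "int_scale (k + l) v = int_scale k v + int_scale l v"
proof -
  have sum_add: "(\<Sum>i<m + n. v) = (\<Sum>i<m. v) + (\<Sum>i<n. v)" for m n :: nat
    by (induction n) (simp_all add: add.assoc)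
  have "nat (k + l) + (nat (- k) + nat (- l)) = nat (- (k + l)) + (nat k + nat l)"
    by simp
  then have "(\<Sum>i<nat (k + l). v) + ((\<Sum>i<nat (- k). v) + (\<Sum>i<nat (- l). v)) =
      (\<Sum>i<nat (- (k + l)). v) + ((\<Sum>i<nat k. v) + (\<Sum>i<nat l. v))"
    unfolding sum_add [symmetric] by (rule arg_cong)
  then show ?thesis
    unfolding int_scale_def by (simp add: algebra_simps)
qed

lemma int_scale_diff: "int_scale (k - l) v = int_scale k v - int_scale l v"
  using int_scale_add [of "k - l" l v] by simp

text \<open>The linear extension of a cochain from basis elements to chains.\<close>

definition eval_chain :: "('b \<Rightarrow> 'v::ab_group_add) \<Rightarrow> ('b \<Rightarrow>\<^sub>0 int) \<Rightarrow> 'v" where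
  "eval_chain f c = (\<Sum>x\<in>Poly_Mapping.keys c. int_scale (Poly_Mapping.lookup c x) (f x))"

lemma eval_chain_superset:
  assumes "finite A" "Poly_Mapping.keys c \<subseteq> A"
  shows "eval_chain f c = (\<Sum>x\<in>A. int_scale (Poly_Mapping.lookup c x) (f x))"
  unfolding eval_chain_def
  using assms by (intro sum.mono_neutral_left) (auto simp: in_keys_iff)

lemma eval_chain_0 [simp]: "eval_chain f 0 = 0"
  and eval_chain_of [simp]: "eval_chain f (frag_of x) = f x"
  by (simp_all add: eval_chain_def keys_frag_of)

lemma eval_chain_diff: "eval_chain f (a - b) = eval_chain f a - eval_chain f b"
proof -
  let ?A = "Poly_Mapping.keys a \<union> Poly_Mapping.keys b"
  have "Poly_Mapping.keys (a - b) \<subseteq> ?A"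
    by (rule keys_diff)
  then show ?thesis
    by (simp add: eval_chain_superset [of ?A] lookup_minus int_scale_diff sum_subtractf)
qed

lemma eval_chain_minus: "eval_chain f (- a) = - eval_chain f a"
  using eval_chain_diff [of f 0 a] by simp

lemma eval_chain_add: "eval_chain f (a + b) = eval_chain f a + eval_chain f b"
  using eval_chain_diff [of f a "- b"] by (simp add: eval_chain_minus)

lemma eval_chain_sum: "eval_chain f (\<Sum>i\<in>A. g i) = (\<Sum>i\<in>A. eval_chain f (g i))"
  by (induction A rule: infinite_finite_induct) (simp_all add: eval_chain_add)

lemma eval_chain_sign:
  "eval_chain f (frag_cmul ((-1) ^ k) c) = (if even k then eval_chain f c else - eval_chain f c)"
  by (simp add: eval_chain_minus)

lemma eval_chain_cong: "(\<And>x. x \<in> Poly_Mapping.keys c \<Longrightarrow> f x = g x) \<Longrightarrow> eval_chain f c = eval_chain g c"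
  unfolding eval_chain_def by (rule sum.cong) auto

lemma eval_chain_eq_0: "(\<And>x. x \<in> Poly_Mapping.keys c \<Longrightarrow> f x = 0) \<Longrightarrow> eval_chain f c = 0"
  using eval_chain_cong [of c f "\<lambda>_. 0"] by (simp add: eval_chain_def int_scale_def)

lemma eval_chain_add_fun: "eval_chain (\<lambda>x. f x + g x) c = eval_chain f c + eval_chain g c"
  using subset_UNIV [of "Poly_Mapping.keys c"]
  by (induction c rule: frag_induction) (auto simp: eval_chain_diff)

lemma eval_chain_diff_fun: "eval_chain (\<lambda>x. f x - g x) c = eval_chain f c - eval_chain g c"
  using subset_UNIV [of "Poly_Mapping.keys c"]
  by (induction c rule: frag_induction) (auto simp: eval_chain_diff)

lemma eval_chain_frag_extend: "eval_chain f (frag_extend g c) = eval_chain (\<lambda>x. eval_chain f (g x)) c"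
  using subset_UNIV [of "Poly_Mapping.keys c"]
  by (induction c rule: frag_induction) (auto simp: frag_extend_diff eval_chain_diff)

lemma frag_extend_frag_extend: "frag_extend f (frag_extend g c) = frag_extend (\<lambda>x. frag_extend f (g x)) c"
  using subset_UNIV [of "Poly_Mapping.keys c"]
  by (induction c rule: frag_induction) (auto simp: frag_extend_diff)

lemma frag_extend_frag_of: "frag_extend frag_of c = c"
  using frag_expansion by metis

lemma frag_extend_minus_fun: "frag_extend (\<lambda>x. f x - g x) c = frag_extend f c - frag_extend g c"
  using subset_UNIV [of "Poly_Mapping.keys c"]
  by (induction c rule: frag_induction) (auto simp: frag_extend_diff)

lemma frag_extend_add_fun: "frag_extend (\<lambda>x. f x + g x) c = frag_extend f c + frag_extend g c"
  using subset_UNIV [of "Poly_Mapping.keys c"]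
  by (induction c rule: frag_induction) (auto simp: frag_extend_diff)

lemma keys_frag_extend_subset:
  assumes "\<And>x. x \<in> Poly_Mapping.keys c \<Longrightarrow> Poly_Mapping.keys (f x) \<subseteq> S"
  shows "Poly_Mapping.keys (frag_extend f c) \<subseteq> S"
  using keys_frag_extend [of f c] assms by blast

text \<open>A free chain complex in which cycles bound at a controlled price. The set \<open>carried i p b\<close> holds the basis elements of
degree \<open>p\<close> that are near \<open>b\<close> of order \<open>i\<close>; filling a cycle, and passing from a face of \<open>b\<close> to \<open>b\<close>, raise the
order by one. Only orders up to \<open>N\<close> are available, since neighbourhoods of a group can be shrunk but not
enlarged at will.\<close>

locale carried_acyclic =
  fixes bd :: "nat \<Rightarrow> 'b \<Rightarrow> 'b \<Rightarrow>\<^sub>0 int" and basis :: "nat \<Rightarrow> 'b set"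
    and carried :: "nat \<Rightarrow> nat \<Rightarrow> 'b \<Rightarrow> 'b set" and N :: nat
  assumes bd_0: "b \<in> basis 0 \<Longrightarrow> bd 0 b = 0"
    and face: "b \<in> basis (Suc q) \<Longrightarrow> Poly_Mapping.keys (bd (Suc q) b) \<subseteq> basis q"
    and bd_bd: "b \<in> basis (Suc q) \<Longrightarrow> frag_extend (bd q) (bd (Suc q) b) = 0"
    and self_carried: "b \<in> basis q \<Longrightarrow> b \<in> carried i q b"
    and face_carried: "b \<in> basis (Suc q) \<Longrightarrow> b' \<in> Poly_Mapping.keys (bd (Suc q) b) \<Longrightarrow> i < N \<Longrightarrow>
       carried i p b' \<subseteq> carried (Suc i) p b"
    and acyclic: "b \<in> basis r \<Longrightarrow> i < N \<Longrightarrow> Poly_Mapping.keys c \<subseteq> carried i q b \<Longrightarrow> frag_extend (bd q) c = 0 \<Longrightarrow>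
       \<exists>e. Poly_Mapping.keys e \<subseteq> carried (Suc i) (Suc q) b \<and> frag_extend (bd (Suc q)) e = c"
begin

fun contraction :: "nat \<Rightarrow> 'b \<Rightarrow> 'b \<Rightarrow>\<^sub>0 int" where
  "contraction 0 b = (SOME e. Poly_Mapping.keys e \<subseteq> carried 1 1 b \<and> frag_extend (bd 1) e = frag_of b)"
| "contraction (Suc q) b = (SOME e. Poly_Mapping.keys e \<subseteq> carried (2 * q + 3) (Suc (Suc q)) b \<and>
      frag_extend (bd (Suc (Suc q))) e = frag_of b - frag_extend (contraction q) (bd (Suc q) b))"

text \<open>In degree \<open>Suc q\<close> the chain \<open>b - contraction (\<partial> b)\<close> is a cycle, by the equation in degree \<open>q\<close>. It is carried to
order \<open>2q + 2\<close>, and filling it raises the order to \<open>2q + 3\<close>.\<close>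

lemma contraction:
  assumes "b \<in> basis q" "2 * q < N"
  shows "Poly_Mapping.keys (contraction q b) \<subseteq> carried (2 * q + 1) (Suc q) b"
    and "frag_extend (bd (Suc q)) (contraction q b) =
      frag_of b - (case q of 0 \<Rightarrow> 0 | Suc p \<Rightarrow> frag_extend (contraction p) (bd q b))"
proof -
  have "Poly_Mapping.keys (contraction q b) \<subseteq> carried (2 * q + 1) (Suc q) b \<and>
    frag_extend (bd (Suc q)) (contraction q b) =
      frag_of b - (case q of 0 \<Rightarrow> 0 | Suc p \<Rightarrow> frag_extend (contraction p) (bd q b))"
    using assms
  proof (induction q arbitrary: b)
    case 0
    have "\<exists>e. Poly_Mapping.keys e \<subseteq> carried (Suc 0) (Suc 0) b \<and> frag_extend (bd (Suc 0)) e = frag_of b"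
      using 0 self_carried bd_0 by (intro acyclic [of b 0]) (auto simp: keys_frag_of)
    from someI_ex [OF this] show ?case by simp
  next
    case (Suc q)
    let ?c = "frag_of b - frag_extend (contraction q) (bd (Suc q) b)"
    have IH: "Poly_Mapping.keys (contraction q b') \<subseteq> carried (2 * q + 1) (Suc q) b'"
        "frag_extend (bd (Suc q)) (contraction q b') =
          frag_of b' - (case q of 0 \<Rightarrow> 0 | Suc p \<Rightarrow> frag_extend (contraction p) (bd q b'))"
      if "b' \<in> Poly_Mapping.keys (bd (Suc q) b)" for b'
      using Suc.IH [of b'] that face [OF Suc.prems(1)] Suc.prems(2) by auto
    have "Poly_Mapping.keys (frag_extend (contraction q) (bd (Suc q) b)) \<subseteq> carried (2 * q + 2) (Suc q) b"
    proof (rule keys_frag_extend_subset)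
      fix b' assume b': "b' \<in> Poly_Mapping.keys (bd (Suc q) b)"
      have "carried (2 * q + 1) (Suc q) b' \<subseteq> carried (Suc (2 * q + 1)) (Suc q) b"
        using Suc.prems b' by (intro face_carried) auto
      then show "Poly_Mapping.keys (contraction q b') \<subseteq> carried (2 * q + 2) (Suc q) b"
        using IH(1) [OF b'] by simp
    qed
    then have "Poly_Mapping.keys ?c \<subseteq> carried (2 * q + 2) (Suc q) b"
      using keys_diff [of "frag_of b"] self_carried [OF Suc.prems(1), of "2 * q + 2"]
      by (fastforce simp: keys_frag_of)
    moreover have "frag_extend (bd (Suc q)) ?c = 0"
    proof -
      have "frag_extend (bd (Suc q)) (frag_extend (contraction q) (bd (Suc q) b)) =
          frag_extend (\<lambda>b'. frag_of b' - (case q of 0 \<Rightarrow> 0 | Suc p \<Rightarrow> frag_extend (contraction p) (bd q b'))) (bd (Suc q) b)"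
        unfolding frag_extend_frag_extend using IH(2) by (rule frag_extend_eq)
      also have "\<dots> = bd (Suc q) b"
      proof (cases q)
        case 0
        then show ?thesis by (simp add: frag_extend_frag_of)
      next
        case p: (Suc p)
        have "frag_extend (\<lambda>b'. frag_extend (contraction p) (bd q b')) (bd (Suc q) b) =
            frag_extend (contraction p) (frag_extend (bd q) (bd (Suc q) b))"
          by (simp add: frag_extend_frag_extend)
        also have "\<dots> = 0"
          by (simp add: bd_bd [OF Suc.prems(1)])
        finally show ?thesis
          using p by (simp add: frag_extend_minus_fun frag_extend_frag_of)
      qed
      finally show ?thesis by (simp add: frag_extend_diff)
    qed
    ultimately have "\<exists>e. Poly_Mapping.keys e \<subseteq> carried (Suc (2 * q + 2)) (Suc (Suc q)) b \<and>
        frag_extend (bd (Suc (Suc q))) e = ?c"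
      using Suc.prems by (intro acyclic) auto
    then have "\<exists>e. Poly_Mapping.keys e \<subseteq> carried (2 * q + 3) (Suc (Suc q)) b \<and>
        frag_extend (bd (Suc (Suc q))) e = ?c"
      by (simp add: numeral_3_eq_3)
    moreover have "2 * Suc q + 1 = 2 * q + 3" by simp
    ultimately show ?case
      unfolding contraction.simps nat.case by (simp only:) (rule someI_ex)
  qed
  then show "Poly_Mapping.keys (contraction q b) \<subseteq> carried (2 * q + 1) (Suc q) b"
    "frag_extend (bd (Suc q)) (contraction q b) =
      frag_of b - (case q of 0 \<Rightarrow> 0 | Suc p \<Rightarrow> frag_extend (contraction p) (bd q b))"
    by auto
qed

text \<open>Evaluate \<open>F\<close> on \<open>b = \<partial> (contraction b) + contraction (\<partial> b)\<close>. The first summand contributes nothing because \<open>F\<close> is a cocycle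
on everything carried by \<open>b\<close>, and the second is the coboundary of \<open>F \<circ> contraction\<close>.\<close>

lemma cocycle_is_coboundary:
  assumes n: "2 * n < N"
    and cocycle: "\<And>b e. b \<in> basis n \<Longrightarrow> e \<in> carried (2 * n + 1) (Suc n) b \<Longrightarrow> eval_chain F (bd (Suc n) e) = 0"
  obtains G where "\<forall>b\<in>basis n. F b = (case n of 0 \<Rightarrow> 0 | Suc m \<Rightarrow> eval_chain G (bd n b))"
proof -
  let ?G = "\<lambda>b. eval_chain F (contraction (n - 1) b)"
  have "F b = (case n of 0 \<Rightarrow> 0 | Suc m \<Rightarrow> eval_chain ?G (bd n b))" if b: "b \<in> basis n" for b
  proof -
    have "eval_chain F (frag_extend (bd (Suc n)) (contraction n b)) = 0"
      unfolding eval_chain_frag_extend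
      by (rule eval_chain_eq_0) (use contraction(1) [OF b n] cocycle [OF b] in blast)
    then have "F b = eval_chain F (case n of 0 \<Rightarrow> 0 | Suc p \<Rightarrow> frag_extend (contraction p) (bd n b))"
      unfolding contraction(2) [OF b n] by (simp add: eval_chain_diff)
    then show ?thesis
      by (simp add: eval_chain_frag_extend split: nat.split)
  qed
  then show thesis using that [of ?G] by blast
qed

end

lemma eval_chain_boundary:
  "eval_chain f (chain_boundary (Suc q) (frag_of \<tau>)) = alternating_sum (Suc q) (\<lambda>k. f (singular_face (Suc q) k \<tau>))"
  by (simp add: chain_boundary_of eval_chain_sum eval_chain_sign alternating_sum_def del: sum.atMost_Suc cong: if_cong)

lemma chain_boundary_eq_frag_extend: "chain_boundary q c = frag_extend (\<lambda>\<tau>. chain_boundary q (frag_of \<tau>)) c"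
  using subset_UNIV [of "Poly_Mapping.keys c"]
  by (induction c rule: frag_induction) (auto simp: frag_extend_diff chain_boundary_diff)


section \<open>Cochains on small simplices\<close>

text \<open>Both the singular complex and the complex of small simplices are of this kind.\<close>

locale simplex_family =
  fixes S :: "nat \<Rightarrow> ((nat \<Rightarrow> real) \<Rightarrow> 'a::topological_space) set"
  assumes simplices: "S q \<subseteq> singular_simplex_set q euclidean"
    and faces: "\<tau> \<in> S (Suc q) \<Longrightarrow> k \<le> Suc q \<Longrightarrow> singular_face (Suc q) k \<tau> \<in> S q"
begin

lemma keys_boundary: "\<tau> \<in> S (Suc q) \<Longrightarrow> Poly_Mapping.keys (chain_boundary (Suc q) (frag_of \<tau>)) \<subseteq> S q"
proof -
  assume \<tau>: "\<tau> \<in> S (Suc q)"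
  have "Poly_Mapping.keys (\<Sum>k\<le>Suc q. frag_cmul ((-1) ^ k) (frag_of (singular_face (Suc q) k \<tau>)))
      \<subseteq> (\<Union>k\<in>{..Suc q}. Poly_Mapping.keys (frag_cmul ((-1) ^ k) (frag_of (singular_face (Suc q) k \<tau>))))"
    by (rule keys_sum)
  also have "\<dots> \<subseteq> (\<Union>k\<in>{..Suc q}. {singular_face (Suc q) k \<tau>})"
    by (intro UN_mono order_trans [OF keys_cmul]) (simp_all add: keys_frag_of)
  finally show ?thesis
    using faces [OF \<tau>] by (auto simp: chain_boundary_of simp del: sum.atMost_Suc)
qed

lemma boundary_boundary:
  assumes "\<tau> \<in> S (Suc (Suc q))"
  shows "chain_boundary (Suc q) (chain_boundary (Suc (Suc q)) (frag_of \<tau>)) = 0"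
proof -
  have "singular_chain (Suc (Suc q)) euclidean (frag_of \<tau>)"
    using assms simplices by (auto simp: singular_chain_of)
  from chain_boundary_boundary [OF this] show ?thesis by simp
qed

lemma carrier_simplex_complex: "carrier (cochains (simplex_complex S) q) = extensional (S q)"
  by (auto simp: simplex_complex_def additive_group_def PiE_def)

lemma one_simplex_complex: "\<one>\<^bsub>cochains (simplex_complex S) q\<^esub> = restrict (\<lambda>_. 0) (S q)"
  by (simp add: simplex_complex_def additive_group_def)

lemma mult_simplex_complex:
  "restrict F (S q) \<otimes>\<^bsub>cochains (simplex_complex S) q\<^esub> restrict G (S q) = restrict (\<lambda>\<tau>. F \<tau> + G \<tau>) (S q)"
  by (auto simp: simplex_complex_def additive_group_def intro!: restrict_ext)

lemma inv_simplex_complex: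
  "inv\<^bsub>cochains (simplex_complex S) q\<^esub> (restrict F (S q)) = restrict (\<lambda>\<tau>. - F \<tau>) (S q)"
  by (simp add: simplex_complex_def inv_functions cong: restrict_cong)

lemma coboundary_simplex_complex:
  "coboundary (simplex_complex S) q (restrict F (S q))
    = restrict (\<lambda>\<tau>. eval_chain F (chain_boundary (Suc q) (frag_of \<tau>))) (S (Suc q))"
proof -
  have "alternating_sum (Suc q) (\<lambda>k. restrict F (S q) (singular_face (Suc q) k \<tau>))
      = eval_chain F (chain_boundary (Suc q) (frag_of \<tau>))" if "\<tau> \<in> S (Suc q)" for \<tau>
    unfolding eval_chain_boundary alternating_sum_def
    using faces [OF that] by (intro sum.cong) auto
  then show ?thesis
    by (simp add: simplex_complex_def cong: restrict_cong)
qed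

lemma cochain_restrict: "f \<in> extensional (S q) \<Longrightarrow> f = restrict f (S q)"
  by (simp add: extensional_restrict)

lemma simplex_complex: "abelian_cochain_complex (simplex_complex S :: (_ \<Rightarrow> 'v::ab_group_add) cochain_complex)"
proof (rule abelian_cochain_complex.intro)
  let ?K = "simplex_complex S :: (_ \<Rightarrow> 'v) cochain_complex"
  fix n
  show "comm_group (cochains ?K n)"
    by (simp add: simplex_complex_def comm_group_functions)
  show "coboundary ?K n \<in> hom (cochains ?K n) (cochains ?K (Suc n))"
  proof (rule homI)
    fix x assume "x \<in> carrier (cochains ?K n)"
    then show "coboundary ?K n x \<in> carrier (cochains ?K (Suc n))"
      unfolding carrier_simplex_complex by (simp add: simplex_complex_def)
  next
    fix x y assume "x \<in> carrier (cochains ?K n)" "y \<in> carrier (cochains ?K n)"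
    then obtain F G where FG: "x = restrict F (S n)" "y = restrict G (S n)"
      unfolding carrier_simplex_complex using cochain_restrict by blast
    show "coboundary ?K n (x \<otimes>\<^bsub>cochains ?K n\<^esub> y)
        = coboundary ?K n x \<otimes>\<^bsub>cochains ?K (Suc n)\<^esub> coboundary ?K n y"
      unfolding FG mult_simplex_complex coboundary_simplex_complex eval_chain_add_fun ..
  qed
  fix x assume "x \<in> carrier (cochains ?K n)"
  then obtain F where F: "x = restrict F (S n)"
    unfolding carrier_simplex_complex using cochain_restrict by blast
  have "eval_chain (\<lambda>\<sigma>. eval_chain F (chain_boundary (Suc n) (frag_of \<sigma>))) (chain_boundary (Suc (Suc n)) (frag_of \<tau>)) = 0"
    if "\<tau> \<in> S (Suc (Suc n))" for \<tau>
    unfolding eval_chain_frag_extend [symmetric] chain_boundary_eq_frag_extend [symmetric]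
    using boundary_boundary [OF that] by simp
  then show "coboundary ?K (Suc n) (coboundary ?K n x) = \<one>\<^bsub>cochains ?K (Suc (Suc n))\<^esub>"
    unfolding F coboundary_simplex_complex one_simplex_complex by (rule restrict_ext)
qed

lemma cocycleI:
  assumes "\<And>\<tau>. \<tau> \<in> S (Suc n) \<Longrightarrow> eval_chain F (chain_boundary (Suc n) (frag_of \<tau>)) = 0"
  shows "restrict F (S n) \<in> cocycles (simplex_complex S) n"
  using assms
  by (simp add: cocycles_def kernel_def carrier_simplex_complex coboundary_simplex_complex one_simplex_complex
      cong: restrict_cong)

lemma cocycleE:
  assumes "z \<in> cocycles (simplex_complex S) n"
  shows "z = restrict z (S n)" and "\<tau> \<in> S (Suc n) \<Longrightarrow> eval_chain z (chain_boundary (Suc n) (frag_of \<tau>)) = 0"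
proof -
  show z: "z = restrict z (S n)"
    using assms cochain_restrict by (auto simp: cocycles_def kernel_def carrier_simplex_complex)
  assume \<tau>: "\<tau> \<in> S (Suc n)"
  have "coboundary (simplex_complex S) n (restrict z (S n)) = restrict (\<lambda>_. 0) (S (Suc n))"
    using assms z by (simp add: cocycles_def kernel_def one_simplex_complex)
  from fun_cong [OF this, of \<tau>] show "eval_chain z (chain_boundary (Suc n) (frag_of \<tau>)) = 0"
    using \<tau> by (simp add: coboundary_simplex_complex)
qed

lemma boundary_zero: "chain_boundary 0 c = 0"
  by (simp add: chain_boundary_def)

lemma coboundaryI:
  assumes "\<And>\<tau>. \<tau> \<in> S n \<Longrightarrow> F \<tau> = eval_chain G (chain_boundary n (frag_of \<tau>))"
  shows "restrict F (S n) \<in> coboundaries (simplex_complex S) n"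
proof (cases n)
  case 0
  then show ?thesis
    using assms by (auto simp: coboundaries_def one_simplex_complex boundary_zero intro!: restrict_ext)
next
  case (Suc m)
  have "restrict F (S n) = coboundary (simplex_complex S) m (restrict G (S m))"
    using assms unfolding coboundary_simplex_complex Suc by (intro restrict_ext)
  then show ?thesis
    by (simp add: Suc coboundaries_def carrier_simplex_complex)
qed

lemma coboundaryE:
  assumes "z \<in> coboundaries (simplex_complex S) n"
  obtains G where "\<And>\<tau>. \<tau> \<in> S n \<Longrightarrow> z \<tau> = eval_chain G (chain_boundary n (frag_of \<tau>))"
proof (cases n)
  case 0
  then show thesis
    using assms that by (simp add: coboundaries_def one_simplex_complex boundary_zero)
next
  case (Suc m)
  then obtain G where "G \<in> extensional (S m)" "z = coboundary (simplex_complex S) m G"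
    using assms by (auto simp: coboundaries_def carrier_simplex_complex)
  then have "z = coboundary (simplex_complex S) m (restrict G (S m))"
    using cochain_restrict by metis
  then show thesis
    using that [of G] Suc by (simp add: coboundary_simplex_complex)
qed

end

interpretation all: simplex_family "\<lambda>q. singular_simplex_set q (euclidean :: 'a::topological_space topology)"
proof
  show "singular_face (Suc q) k \<tau> \<in> singular_simplex_set q euclidean"
    if "\<tau> \<in> singular_simplex_set (Suc q) euclidean" "k \<le> Suc q" for q k and \<tau> :: "(nat \<Rightarrow> real) \<Rightarrow> 'a"
    using singular_simplex_singular_face [of "Suc q" euclidean \<tau> k] that by simp
qed simp

lemma small_simplices_eq:
  "small_simplices \<UU> q = {\<tau>. \<exists>U\<in>\<UU>. singular_simplex q (top_of_set U) \<tau>}"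
  by (auto simp: small_simplices_def singular_simplex_subtopology image_subset_iff Pi_iff)

lemma small_simplices_subset: "small_simplices \<UU> q \<subseteq> singular_simplex_set q euclidean"
  by (auto simp: small_simplices_def)

interpretation small: simplex_family "small_simplices \<UU>" for \<UU> :: "'a::topological_space set set"
proof
  show "small_simplices \<UU> q \<subseteq> singular_simplex_set q euclidean" for q
    by (rule small_simplices_subset)
  fix q k and \<tau> :: "(nat \<Rightarrow> real) \<Rightarrow> 'a"
  assume "\<tau> \<in> small_simplices \<UU> (Suc q)" "k \<le> Suc q"
  then obtain U where "U \<in> \<UU>" "singular_simplex (Suc q) (top_of_set U) \<tau>"
    by (auto simp: small_simplices_eq)
  then show "singular_face (Suc q) k \<tau> \<in> small_simplices \<UU> q"
    using singular_simplex_singular_face [of "Suc q" "top_of_set U" \<tau> k] \<open>k \<le> Suc q\<close>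
    by (auto simp: small_simplices_eq)
qed

lemma simplex_restriction:
  assumes S: "simplex_family S" and R: "simplex_family R" and sub: "\<And>q. R q \<subseteq> S q"
  shows "abelian_cochain_map (simplex_complex S :: (_ \<Rightarrow> 'v::ab_group_add) cochain_complex) (simplex_complex R)
    (\<lambda>q f. restrict f (R q))"
proof -
  interpret S: simplex_family S by fact
  interpret R: simplex_family R by fact
  let ?K = "simplex_complex S :: (_ \<Rightarrow> 'v::ab_group_add) cochain_complex"
  let ?L = "simplex_complex R :: (_ \<Rightarrow> 'v::ab_group_add) cochain_complex"
  have restr: "restrict (restrict F (S q)) (R q) = restrict F (R q)" for F :: "_ \<Rightarrow> 'v" and q
    using sub [of q] by (simp add: restrict_restrict inf.absorb2)
  show ?thesis
  proof (intro abelian_cochain_map.intro abelian_cochain_map_axioms.intro S.simplex_complex R.simplex_complex)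
    fix n
    show "(\<lambda>f. restrict f (R n)) \<in> hom (cochains ?K n) (cochains ?L n)"
    proof (rule homI)
      show "restrict x (R n) \<in> carrier (cochains ?L n)" for x :: "_ \<Rightarrow> 'v"
        by (simp add: R.carrier_simplex_complex)
      fix x y assume "x \<in> carrier (cochains ?K n)" "y \<in> carrier (cochains ?K n)"
      then obtain F G where FG: "x = restrict F (S n)" "y = restrict G (S n)"
        unfolding S.carrier_simplex_complex using S.cochain_restrict by blast
      show "restrict (x \<otimes>\<^bsub>cochains ?K n\<^esub> y) (R n) = restrict x (R n) \<otimes>\<^bsub>cochains ?L n\<^esub> restrict y (R n)"
        unfolding FG S.mult_simplex_complex restr R.mult_simplex_complex ..
    qed
    fix x assume "x \<in> carrier (cochains ?K n)"
    then obtain F where F: "x = restrict F (S n)"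
      unfolding S.carrier_simplex_complex using S.cochain_restrict by blast
    show "restrict (coboundary ?K n x) (R (Suc n)) = coboundary ?L n (restrict x (R n))"
      unfolding F S.coboundary_simplex_complex restr R.coboundary_simplex_complex ..
  qed
qed

text \<open>Chains modulo those supported in \<open>R\<close> are free on the complement of \<open>R\<close>. Dropping the
summands in \<open>R\<close> picks the representative of a class that is supported in the complement.\<close>

definition drop_small :: "'b set \<Rightarrow> ('b \<Rightarrow>\<^sub>0 int) \<Rightarrow> 'b \<Rightarrow>\<^sub>0 int" where
  "drop_small R c = frag_extend (\<lambda>\<tau>. if \<tau> \<in> R then 0 else frag_of \<tau>) c"

lemma drop_small_diff: "drop_small R (a - b) = drop_small R a - drop_small R b"
  by (simp add: drop_small_def frag_extend_diff)

lemma keys_drop_small: "Poly_Mapping.keys (drop_small R c) \<subseteq> Poly_Mapping.keys c - R"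
  unfolding drop_small_def by (rule keys_frag_extend_subset) (auto simp: keys_frag_of)

lemma drop_small_eq_0: "Poly_Mapping.keys c \<subseteq> R \<Longrightarrow> drop_small R c = 0"
  unfolding drop_small_def by (rule frag_extend_eq_0) auto

lemma drop_small_id: "Poly_Mapping.keys c \<inter> R = {} \<Longrightarrow> drop_small R c = c"
proof -
  assume "Poly_Mapping.keys c \<inter> R = {}"
  then have "drop_small R c = frag_extend frag_of c"
    unfolding drop_small_def by (intro frag_extend_eq) auto
  then show ?thesis by (simp add: frag_extend_frag_of)
qed

lemma keys_diff_drop_small: "Poly_Mapping.keys (c - drop_small R c) \<subseteq> R"
proof -
  have "c - drop_small R c = frag_extend (\<lambda>\<tau>. frag_of \<tau> - (if \<tau> \<in> R then 0 else frag_of \<tau>)) c"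
    by (simp add: drop_small_def frag_extend_minus_fun frag_extend_frag_of)
  also have "Poly_Mapping.keys \<dots> \<subseteq> R"
    by (rule keys_frag_extend_subset) (auto simp: keys_frag_of)
  finally show ?thesis .
qed

lemma eval_chain_drop_small:
  assumes "\<And>\<tau>. \<tau> \<in> R \<Longrightarrow> f \<tau> = 0" shows "eval_chain f (drop_small R c) = eval_chain f c"
proof -
  have "eval_chain f (c - drop_small R c) = 0"
    by (rule eval_chain_eq_0) (rule assms, erule subsetD [OF keys_diff_drop_small])
  then show ?thesis by (simp add: eval_chain_diff)
qed

locale open_cover =
  fixes \<UU> :: "'a::topological_space set set"
  assumes open_members: "U \<in> \<UU> \<Longrightarrow> open U" and covers: "\<Union>\<UU> = UNIV"
begin

abbreviation simplices where "simplices q \<equiv> singular_simplex_set q (euclidean :: 'a topology)"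
abbreviation small where "small q \<equiv> small_simplices \<UU> q"
abbreviation dropped where "dropped q \<equiv> drop_small (small q)"

definition relative_boundary :: "nat \<Rightarrow> ((nat \<Rightarrow> real) \<Rightarrow> 'a) \<Rightarrow> 'a chain" where
  "relative_boundary q \<tau> = dropped (q - 1) (chain_boundary q (frag_of \<tau>))"

lemma keys_boundary_small: "Poly_Mapping.keys c \<subseteq> small (Suc q) \<Longrightarrow> Poly_Mapping.keys (chain_boundary (Suc q) c) \<subseteq> small q"
  unfolding chain_boundary_eq_frag_extend [of _ c]
  using small.keys_boundary by (intro keys_frag_extend_subset) blast

lemma dropped_boundary_dropped: "dropped q (chain_boundary (Suc q) (dropped (Suc q) c)) = dropped q (chain_boundary (Suc q) c)"
proof -
  have "dropped q (chain_boundary (Suc q) (c - dropped (Suc q) c)) = 0"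
    by (intro drop_small_eq_0 keys_boundary_small keys_diff_drop_small)
  then show ?thesis by (simp add: chain_boundary_diff drop_small_diff)
qed

lemma frag_extend_relative_boundary: "frag_extend (relative_boundary q) c = dropped (q - 1) (chain_boundary q c)"
  unfolding chain_boundary_eq_frag_extend [of _ c] relative_boundary_def [abs_def] drop_small_def
  by (simp add: frag_extend_frag_extend)

text \<open>An iterated subdivision of \<open>c\<close> is small, and differs from \<open>c\<close> by a boundary and by the homotopy applied to
the boundary of \<open>c\<close>. The latter is small because the homotopy is natural and \<open>c\<close> is a relative cycle. So,
modulo small chains, \<open>c\<close> bounds.\<close>

lemma relative_boundary_exact:
  assumes c: "Poly_Mapping.keys c \<subseteq> simplices q - small q" and cycle: "frag_extend (relative_boundary q) c = 0"
  shows "\<exists>e. Poly_Mapping.keys e \<subseteq> simplices (Suc q) - small (Suc q) \<and> frag_extend (relative_boundary (Suc q)) e = c"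
proof -
  have chain: "singular_chain q euclidean c"
    using c by (auto simp: singular_chain_def)
  obtain n where n: "\<And>m f. \<lbrakk>n \<le> m; f \<in> Poly_Mapping.keys ((singular_subdivision q ^^ m) c)\<rbrakk>
                      \<Longrightarrow> \<exists>V \<in> \<UU>. f \<in> standard_simplex q \<rightarrow> V"
    using sufficient_iterated_singular_subdivision_exists [of \<UU> euclidean q c] open_members covers chain
    by auto
  obtain h where h: "\<And>p. h p 0 = (0 :: 'a chain)" "\<And>p c1 c2. h p (c1-c2) = h p c1 - h p c2"
    "\<And>p X c. singular_chain p X c \<Longrightarrow> singular_chain (Suc p) X (h p c)"
    "\<And>p X c. singular_chain p X c \<Longrightarrow> chain_boundary (Suc p) (h p c) + h (p - Suc 0) (chain_boundary p c)
                   = (singular_subdivision p ^^ n) c - c"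
    by (rule chain_homotopic_iterated_singular_subdivision [of n]) blast
  have h_small: "Poly_Mapping.keys (h p a) \<subseteq> small (Suc p)" if "Poly_Mapping.keys a \<subseteq> small p" for p a
    using that
  proof (induction a rule: frag_induction)
    case (one \<tau>)
    then obtain U where "U \<in> \<UU>" "singular_simplex p (top_of_set U) \<tau>"
      by (auto simp: small_simplices_eq)
    then have "singular_chain (Suc p) (top_of_set U) (h p (frag_of \<tau>))"
      by (intro h(3)) (simp add: singular_chain_of)
    then show ?case
      using \<open>U \<in> \<UU>\<close> by (auto simp: singular_chain_def small_simplices_eq)
  next
    case (diff a b)
    then show ?case using keys_diff [of "h p a" "h p b"] by (auto simp: h(2))
  qed (simp add: h(1))
  have sub: "singular_chain q euclidean ((singular_subdivision q ^^ n) c)"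
    by (induction n) (auto simp: singular_chain_singular_subdivision chain)
  have sd_small: "Poly_Mapping.keys ((singular_subdivision q ^^ n) c) \<subseteq> small q"
    using n [of n] sub by (auto simp: small_simplices_def singular_chain_def image_subset_iff Pi_iff)
  have h_boundary_small: "Poly_Mapping.keys (h (q - 1) (chain_boundary q c)) \<subseteq> small q"
  proof (cases q)
    case 0
    then show ?thesis by (simp add: chain_boundary_def h(1))
  next
    case (Suc p)
    have "Poly_Mapping.keys (chain_boundary q c) \<subseteq> small p"
      using cycle keys_diff_drop_small [of "chain_boundary q c" "small p"]
      by (simp add: frag_extend_relative_boundary Suc)
    then show ?thesis using h_small [of _ p] Suc by simp
  qed
  let ?e = "dropped (Suc q) (- h q c)"
  have "frag_extend (relative_boundary (Suc q)) ?e = dropped q (chain_boundary (Suc q) (- h q c))"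
    by (simp add: frag_extend_relative_boundary dropped_boundary_dropped)
  also have "chain_boundary (Suc q) (- h q c) = c - ((singular_subdivision q ^^ n) c - h (q - 1) (chain_boundary q c))"
    using h(4) [OF chain] by (simp add: chain_boundary_minus algebra_simps)
  also have "dropped q \<dots> = c"
    using c drop_small_eq_0 [OF sd_small] drop_small_eq_0 [OF h_boundary_small]
    by (simp add: drop_small_diff) (rule drop_small_id, blast)
  finally have "frag_extend (relative_boundary (Suc q)) ?e = c" .
  moreover have "Poly_Mapping.keys ?e \<subseteq> simplices (Suc q) - small (Suc q)"
    using keys_drop_small [of "small (Suc q)" "- h q c"] h(3) [OF chain] by (auto simp: singular_chain_def)
  ultimately show ?thesis by blast
qed

lemma relative_carried_acyclic:
  "carried_acyclic relative_boundary (\<lambda>q. simplices q - small q) (\<lambda>i q b. simplices q - small q) N"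
proof
  show "relative_boundary 0 b = 0" for b
    by (simp add: relative_boundary_def chain_boundary_def drop_small_def)
  show "Poly_Mapping.keys (relative_boundary (Suc q) b) \<subseteq> simplices q - small q"
    if "b \<in> simplices (Suc q) - small (Suc q)" for b q
    using keys_drop_small [of "small q" "chain_boundary (Suc q) (frag_of b)"] all.keys_boundary [of b q] that
    by (auto simp: relative_boundary_def)
  show "frag_extend (relative_boundary q) (relative_boundary (Suc q) b) = 0"
    if b: "b \<in> simplices (Suc q) - small (Suc q)" for b q
  proof (cases q)
    case 0
    then show ?thesis by (simp add: frag_extend_relative_boundary chain_boundary_def drop_small_def)
  next
    case (Suc p)
    have "chain_boundary (Suc p) (chain_boundary (Suc (Suc p)) (frag_of b)) = 0"
      using b Suc by (intro all.boundary_boundary) auto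
    then show ?thesis
      using Suc by (simp add: frag_extend_relative_boundary relative_boundary_def dropped_boundary_dropped)
        (simp add: drop_small_def)
  qed
  show "\<exists>e. Poly_Mapping.keys e \<subseteq> simplices (Suc q) - small (Suc q) \<and> frag_extend (relative_boundary (Suc q)) e = c"
    if "Poly_Mapping.keys c \<subseteq> simplices q - small q" "frag_extend (relative_boundary q) c = 0" for c q
    using that by (rule relative_boundary_exact)
qed auto

text \<open>Relative cochains are the cochains that vanish on small simplices; their complex is acyclic
since it is dual to a contractible one.\<close>

lemma relative_cocycle:
  assumes zero: "\<And>\<tau>. \<tau> \<in> small n \<Longrightarrow> F \<tau> = 0"
    and cocycle: "\<And>\<tau>. \<tau> \<in> simplices (Suc n) \<Longrightarrow> eval_chain F (chain_boundary (Suc n) (frag_of \<tau>)) = 0"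
  obtains G where "\<forall>\<tau>\<in>simplices n. F \<tau> = eval_chain G (chain_boundary n (frag_of \<tau>))"
    "\<forall>m. n = Suc m \<longrightarrow> (\<forall>\<tau>\<in>small m. G \<tau> = 0)"
proof -
  interpret carried_acyclic relative_boundary "\<lambda>q. simplices q - small q" "\<lambda>i q b. simplices q - small q" "Suc (2 * n)"
    by (rule relative_carried_acyclic)
  have rel: "eval_chain F (relative_boundary (Suc n) e) = 0" if "e \<in> simplices (Suc n) - small (Suc n)" for b e
    using eval_chain_drop_small [of "small n" F] zero cocycle that by (simp add: relative_boundary_def)
  have "2 * n < Suc (2 * n)" by simp
  from cocycle_is_coboundary [OF this rel]
  obtain G where G: "\<forall>b\<in>simplices n - small n.
      F b = (case n of 0 \<Rightarrow> 0 | Suc m \<Rightarrow> eval_chain G (relative_boundary n b))" .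
  let ?G = "\<lambda>\<tau>. if \<tau> \<in> small (n - 1) then 0 else G \<tau>"
  show thesis
  proof (rule that [of ?G])
    show "\<forall>m. n = Suc m \<longrightarrow> (\<forall>\<tau>\<in>small m. ?G \<tau> = 0)" by simp
    show "\<forall>\<tau>\<in>simplices n. F \<tau> = eval_chain ?G (chain_boundary n (frag_of \<tau>))"
    proof
      fix \<tau> assume \<tau>: "\<tau> \<in> simplices n"
      show "F \<tau> = eval_chain ?G (chain_boundary n (frag_of \<tau>))"
      proof (cases n)
        case 0
        then show ?thesis
          using G [THEN bspec, of \<tau>] zero [of \<tau>] \<tau> by (cases "\<tau> \<in> small n") (auto simp: chain_boundary_def)
      next
        case (Suc m)
        show ?thesis
        proof (cases "\<tau> \<in> small n")
          case True
          then have "Poly_Mapping.keys (chain_boundary n (frag_of \<tau>)) \<subseteq> small m"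
            using small.keys_boundary Suc by blast
          then have "eval_chain ?G (chain_boundary n (frag_of \<tau>)) = 0"
            by (intro eval_chain_eq_0 [of _ ?G]) (use Suc in auto)
          then show ?thesis using zero True by simp
        next
          case False
          have "F \<tau> = eval_chain G (relative_boundary n \<tau>)"
            using G [THEN bspec, of \<tau>] \<tau> False Suc by simp
          also have "\<dots> = eval_chain ?G (relative_boundary n \<tau>)"
            unfolding relative_boundary_def
            by (rule eval_chain_cong) (use keys_drop_small Suc in fastforce)
          also have "\<dots> = eval_chain ?G (chain_boundary n (frag_of \<tau>))"
            unfolding relative_boundary_def by (rule eval_chain_drop_small) simp
          finally show ?thesis .
        qed
      qed
    qed
  qed
qed

text \<open>This is the exact sequence of the pair, with \<open>relative_cocycle\<close> for the relative term. If the
restriction of \<open>z\<close> is the coboundary of \<open>Y\<close>, then \<open>z\<close> minus the coboundary of the extension of \<open>Y\<close> is a relative cocycle.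
Conversely, the coboundary of an extension by zero of a cocycle \<open>w\<close> is a relative cocycle, and subtracting a
relative cochain with this coboundary makes the extension a cocycle.\<close>

theorem small_restriction_iso:
  "small_restriction n \<UU> \<in> iso (cohomology (singular_complex :: (_ \<Rightarrow> 'v::ab_group_add) cochain_complex) n)
     (cohomology (small_complex \<UU>) n)"
proof -
  let ?S = "singular_complex :: (((nat \<Rightarrow> real) \<Rightarrow> 'a) \<Rightarrow> 'v) cochain_complex"
  let ?T = "small_complex \<UU> :: (((nat \<Rightarrow> real) \<Rightarrow> 'a) \<Rightarrow> 'v) cochain_complex"
  interpret R: abelian_cochain_map ?S ?T "\<lambda>q f. restrict f (small q)"
    by (rule simplex_restriction [OF all.simplex_family_axioms small.simplex_family_axioms small_simplices_subset])
  have dd: "eval_chain (\<lambda>\<sigma>. eval_chain G (chain_boundary q (frag_of \<sigma>))) (chain_boundary (Suc q) (frag_of \<tau>)) = 0"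
    if \<tau>: "\<tau> \<in> simplices (Suc q)" for G :: "_ \<Rightarrow> 'v" and q \<tau>
  proof (cases q)
    case 0
    then show ?thesis by (simp add: chain_boundary_def eval_chain_eq_0)
  next
    case (Suc p)
    then show ?thesis
      unfolding eval_chain_frag_extend [symmetric] chain_boundary_eq_frag_extend [symmetric]
      using all.boundary_boundary [of \<tau> p] \<tau> by simp
  qed
  have "cohomology_map n ?S ?T (\<lambda>f. restrict f (small n)) \<in> iso (cohomology ?S n) (cohomology ?T n)"
  proof (rule R.cohomology_map_iso)
    fix z assume z: "z \<in> cocycles ?S n" and exact: "restrict z (small n) \<in> coboundaries ?T n"
    from small.coboundaryE [OF exact] obtain Y where Y: "\<And>\<tau>. \<tau> \<in> small n \<Longrightarrow> restrict z (small n) \<tau> = eval_chain Y (chain_boundary n (frag_of \<tau>))"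
      by blast
    let ?F = "\<lambda>\<tau>. z \<tau> - eval_chain Y (chain_boundary n (frag_of \<tau>))"
    have zero: "?F \<tau> = 0" if "\<tau> \<in> small n" for \<tau>
      using Y [OF that] that by simp
    have cocycle: "eval_chain ?F (chain_boundary (Suc n) (frag_of \<tau>)) = 0" if "\<tau> \<in> simplices (Suc n)" for \<tau>
      using all.cocycleE(2) [OF z that] dd [OF that] by (simp add: eval_chain_diff_fun)
    from relative_cocycle [of n ?F, OF zero cocycle]
    obtain G where G: "\<forall>\<tau>\<in>simplices n. ?F \<tau> = eval_chain G (chain_boundary n (frag_of \<tau>))" .
    have "restrict z (simplices n) \<in> coboundaries ?S n"
    proof (rule all.coboundaryI)
      fix \<tau> assume "\<tau> \<in> simplices n"
      then have "?F \<tau> = eval_chain G (chain_boundary n (frag_of \<tau>))"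
        using G by blast
      then show "z \<tau> = eval_chain (\<lambda>\<sigma>. G \<sigma> + Y \<sigma>) (chain_boundary n (frag_of \<tau>))"
        by (simp add: eval_chain_add_fun diff_eq_eq)
    qed
    then show "z \<in> coboundaries ?S n"
      using all.cocycleE(1) [OF z] by simp
  next
    fix w assume w: "w \<in> cocycles ?T n"
    \<comment> \<open>Extension by zero.\<close>
    let ?W = "\<lambda>\<tau>. if \<tau> \<in> small n then w \<tau> else 0"
    let ?F = "\<lambda>\<tau>. eval_chain ?W (chain_boundary (Suc n) (frag_of \<tau>))"
    have zero: "?F \<tau> = 0" if "\<tau> \<in> small (Suc n)" for \<tau>
    proof -
      have "?F \<tau> = eval_chain w (chain_boundary (Suc n) (frag_of \<tau>))"
        by (rule eval_chain_cong) (use small.keys_boundary [OF that] in auto)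
      then show ?thesis using small.cocycleE(2) [OF w that] by simp
    qed
    from relative_cocycle [of "Suc n" ?F, OF zero dd]
    obtain G where G: "\<forall>\<tau>\<in>simplices (Suc n). ?F \<tau> = eval_chain G (chain_boundary (Suc n) (frag_of \<tau>))"
      "\<forall>m. Suc n = Suc m \<longrightarrow> (\<forall>\<tau>\<in>small m. G \<tau> = 0)" .
    let ?z = "restrict (\<lambda>\<tau>. ?W \<tau> - G \<tau>) (simplices n)"
    have "?z \<in> cocycles ?S n"
      by (rule all.cocycleI) (simp add: eval_chain_diff_fun G(1))
    moreover have "restrict ?z (small n) = w"
    proof -
      have "restrict ?z (small n) = restrict w (small n)"
      proof
        show "restrict ?z (small n) \<tau> = restrict w (small n) \<tau>" for \<tau>
          using G(2) small_simplices_subset [of \<UU> n] by (cases "\<tau> \<in> small n") auto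
      qed
      then show ?thesis using small.cocycleE(1) [OF w] by simp
    qed
    moreover have "w \<otimes>\<^bsub>cochains ?T n\<^esub> inv\<^bsub>cochains ?T n\<^esub> w \<in> coboundaries ?T n"
    proof -
      have "w \<in> carrier (cochains ?T n)" using R.L.cocycles_subset w by blast
      then have "w \<otimes>\<^bsub>cochains ?T n\<^esub> inv\<^bsub>cochains ?T n\<^esub> w = \<one>\<^bsub>cochains ?T n\<^esub>"
        using R.L.comm_group by (simp add: comm_group_def group.r_inv)
      then show ?thesis by (simp only: R.L.one_coboundary)
    qed
    ultimately show "\<exists>z\<in>cocycles ?S n. restrict z (small n) \<otimes>\<^bsub>cochains ?T n\<^esub> inv\<^bsub>cochains ?T n\<^esub> w \<in> coboundaries ?T n"
      by (intro bexI [of _ ?z]) auto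
  qed
  then show ?thesis by (simp add: small_restriction_def)
qed

end


section \<open>Vertices of simplices and acyclic neighbourhoods\<close>

definition vertex_list :: "nat \<Rightarrow> ((nat \<Rightarrow> real) \<Rightarrow> 'a) \<Rightarrow> 'a list" where
  "vertex_list q \<tau> = map (\<lambda>i. simplicial_vertex i \<tau>) [0..<Suc q]"

lemma length_vertex_list [simp]: "length (vertex_list q \<tau>) = Suc q"
  by (simp add: vertex_list_def)

lemma hd_vertex_list: "hd (vertex_list q \<tau>) = simplicial_vertex 0 \<tau>"
  by (simp add: vertex_list_def upt_rec [of 0] del: upt_Suc)

lemma set_vertex_list: "set (vertex_list q \<tau>) \<subseteq> \<tau> ` standard_simplex q"
  by (auto simp: vertex_list_def simplicial_vertex_def basis_in_standard_simplex simp del: upt_Suc)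

lemma simplicial_vertex_face:
  assumes "k \<le> Suc q" "i \<le> q"
  shows "simplicial_vertex i (singular_face (Suc q) k \<tau>) = simplicial_vertex (if i < k then i else Suc i) \<tau>"
proof -
  have "simplical_face k (\<lambda>j. if j = i then 1 else 0 :: real) = (\<lambda>j. if j = (if i < k then i else Suc i) then 1 else 0)"
    by (rule ext) (auto simp: simplical_face_def)
  then show ?thesis
    using assms by (simp add: simplicial_vertex_def singular_face_def basis_in_standard_simplex)
qed

lemma vertex_list_face:
  assumes "k \<le> Suc q"
  shows "vertex_list q (singular_face (Suc q) k \<tau>) = delete_nth k (vertex_list (Suc q) \<tau>)"
  using assms
  by (intro nth_equalityI)
    (auto simp: vertex_list_def simplicial_vertex_face delete_nth_def nth_append min_def simp del: upt_Suc)

lemma list_coboundary_vertex_list: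
  "eval_chain (\<lambda>\<sigma>. F (vertex_list q \<sigma>)) (chain_boundary (Suc q) (frag_of \<tau>)) = list_coboundary F (vertex_list (Suc q) \<tau>)"
  unfolding eval_chain_boundary alternating_sum_def list_coboundary_eq_sum length_vertex_list lessThan_Suc_atMost
  by (rule sum.cong) (simp_all add: vertex_list_face)

lemma frag_extend_eq_eval_chain: "frag_extend f c = eval_chain f c"
  using subset_UNIV [of "Poly_Mapping.keys c"]
  by (induction c rule: frag_induction) (auto simp: eval_chain_diff frag_extend_diff)

lemma eval_chain_list_coboundary: "eval_chain h (list_coboundary f xs) = list_coboundary (\<lambda>ys. eval_chain h (f ys)) xs"
proof (induction xs arbitrary: f)
  case (Cons x xs)
  show ?case by (simp add: eval_chain_diff Cons.IH)
qed simp

abbreviation list_boundary :: "'a list \<Rightarrow> 'a list \<Rightarrow>\<^sub>0 int" where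
  "list_boundary \<equiv> list_coboundary frag_of"

lemma eval_chain_list_boundary: "eval_chain F (list_boundary xs) = list_coboundary F xs"
  by (simp add: eval_chain_list_coboundary)

lemma list_boundary_list_boundary: "frag_extend list_boundary (list_boundary xs) = 0"
  by (simp add: frag_extend_eq_eval_chain eval_chain_list_boundary list_coboundary_list_coboundary)

lemma keys_list_boundary:
  "Poly_Mapping.keys (list_boundary xs) \<subseteq> {ys. length xs = Suc (length ys) \<and> set ys \<subseteq> set xs}"
proof (induction xs)
  case (Cons x xs)
  have "list_coboundary (\<lambda>ys. frag_of (x # ys)) xs = frag_extend (\<lambda>ys. frag_of (x # ys)) (list_boundary xs)"
    by (simp add: frag_extend_eq_eval_chain eval_chain_list_boundary)
  also have "Poly_Mapping.keys \<dots> \<subseteq> {ys. length (x # xs) = Suc (length ys) \<and> set ys \<subseteq> set (x # xs)}"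
    using Cons by (intro keys_frag_extend_subset) (auto simp: keys_frag_of)
  finally show ?case
    using keys_diff [of "frag_of xs" "list_coboundary (\<lambda>ys. frag_of (x # ys)) xs"]
    by (auto simp: keys_frag_of)
qed simp

definition cone_chain :: "'a \<Rightarrow> ('a list \<Rightarrow>\<^sub>0 int) \<Rightarrow> 'a list \<Rightarrow>\<^sub>0 int" where
  "cone_chain x c = frag_extend (\<lambda>ys. frag_of (x # ys)) c"

lemma list_boundary_cone:
  "frag_extend list_boundary (cone_chain x c) = c - cone_chain x (frag_extend list_boundary c)"
proof -
  have "frag_extend list_boundary (cone_chain x c) =
      frag_extend (\<lambda>ys. frag_of ys - frag_extend (\<lambda>zs. frag_of (x # zs)) (list_boundary ys)) c"
    unfolding cone_chain_def frag_extend_frag_extend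
    by (simp add: frag_extend_eq_eval_chain eval_chain_list_boundary)
  then show ?thesis
    by (simp add: cone_chain_def frag_extend_minus_fun frag_extend_frag_of frag_extend_frag_extend)
qed

text \<open>Sum of the coefficients, as a chain of the one-point set.\<close>

definition augment :: "('b \<Rightarrow>\<^sub>0 int) \<Rightarrow> unit \<Rightarrow>\<^sub>0 int" where
  "augment c = frag_extend (\<lambda>_. frag_of ()) c"

lemma augment_frag_extend_frag_of: "augment (frag_extend (\<lambda>x. frag_of (g x)) c) = augment c"
  by (simp add: augment_def frag_extend_frag_extend)

text \<open>By homotopy invariance \<open>c\<close> is homologous in \<open>Y\<close> to its image under the constant map, which is a cycle
of a one-point space. That cycle bounds in positive degrees, and in degree \<open>0\<close> it is zero because its
coefficients sum to zero.\<close>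

lemma null_homotopic_acyclic:
  assumes X: "X \<noteq> {}" and hom: "homotopic_with (\<lambda>_. True) (top_of_set X) (top_of_set Y) id (\<lambda>_. a)"
    and c: "singular_chain p (top_of_set X) c" "chain_boundary p c = 0" and aug: "p = 0 \<Longrightarrow> augment c = 0"
  shows "\<exists>e. singular_chain (Suc p) (top_of_set Y) e \<and> chain_boundary (Suc p) e = c"
proof -
  let ?k = "\<lambda>_. a"
  have cont: "continuous_map (top_of_set X) (top_of_set Y) id" "continuous_map (top_of_set X) (top_of_set Y) ?k"
    using homotopic_with_imp_continuous_maps [OF hom] by auto
  then have a: "a \<in> Y"
    using X continuous_map_image_subset_topspace [OF cont(2)] by auto
  have cyc: "singular_relcycle p (top_of_set X) {} c"
    using c by (simp add: singular_cycle)
  have "homotopic_with (\<lambda>h. h \<in> {} \<rightarrow> {}) (top_of_set X) (top_of_set Y) id ?k"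
    using hom by (rule homotopic_with_mono) auto
  then have "homologous_rel p (top_of_set Y) {} (chain_map p id c) (chain_map p ?k c)"
    using cyc by (rule homotopic_imp_homologous_rel_chain_maps)
  then have 1: "singular_relboundary p (top_of_set Y) {} (c - chain_map p ?k c)"
    using chain_map_ident [OF c(1)] by (simp add: homologous_rel_def)
  have 2: "singular_relboundary p (top_of_set Y) {} (chain_map p ?k c)"
  proof (cases "p = 0")
    case True
    have simplex: "simplex_map 0 ?k \<sigma> = restrict ?k (standard_simplex 0)" for \<sigma>
      by (simp add: simplex_map_def o_def)
    have "chain_map 0 ?k c = frag_extend (\<lambda>_. frag_of (restrict ?k (standard_simplex 0))) (augment c)"
      unfolding chain_map_def augment_def frag_extend_frag_extend by (simp add: simplex o_def)
    then show ?thesis using aug True by simp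
  next
    case False
    have "singular_relcycle p (top_of_set {a}) {} (chain_map p ?k c)"
      using cyc by (rule singular_relcycle_chain_map) auto
    then have "singular_relboundary p (top_of_set {a}) {} (chain_map p ?k c)"
      using False singular_boundary_eq_cycle_singleton [of "top_of_set {a}" a p] by simp
    then show ?thesis
      using a unfolding singular_boundary by (meson empty_subsetI insert_subset singular_chain_mono)
  qed
  have "singular_relboundary p (top_of_set Y) {} c"
    using singular_relboundary_add [OF 1 2] by simp
  then show ?thesis by (simp add: singular_boundary)
qed

definition acyclic_in :: "'g::topological_group_add set \<Rightarrow> 'g set \<Rightarrow> bool" where
  "acyclic_in X Y \<longleftrightarrow> (\<forall>g p c. singular_chain p (top_of_set ((+) g ` X)) c \<and> chain_boundary p c = 0 \<and>
      (p = 0 \<longrightarrow> augment c = 0) \<longrightarrow>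
      (\<exists>e. singular_chain (Suc p) (top_of_set ((+) g ` Y)) e \<and> chain_boundary (Suc p) e = c))"

lemma acyclic_in_mono: "acyclic_in X Y \<Longrightarrow> X' \<subseteq> X \<Longrightarrow> acyclic_in X' Y"
  unfolding acyclic_in_def by (meson image_mono singular_chain_mono)

lemma continuous_translation:
  "continuous_map (top_of_set ((+) g ` X)) (top_of_set ((+) (h + g) ` X)) ((+) (h :: 'g::topological_group_add))"
  unfolding continuous_map_in_subtopology continuous_map_iff_continuous
  by (auto simp: image_image add.assoc intro!: continuous_intros)

lemma null_homotopic_acyclic_in:
  fixes X Y :: "'g::topological_group_add set"
  assumes X: "X \<noteq> {}" and hom: "homotopic_with (\<lambda>_. True) (top_of_set X) (top_of_set Y) id (\<lambda>_. a)"
  shows "acyclic_in X Y"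
  unfolding acyclic_in_def
proof (intro allI impI, elim conjE)
  fix g p c assume c: "singular_chain p (top_of_set ((+) g ` X)) c" "chain_boundary p c = 0" "p = 0 \<longrightarrow> augment c = 0"
  let ?c = "chain_map p ((+) (- g)) c"
  have chain: "singular_chain p (top_of_set X) ?c"
    using singular_chain_chain_map [OF c(1) continuous_translation [of g X "- g"]] by simp
  have boundary: "chain_boundary p ?c = 0"
    using chain_boundary_chain_map [OF c(1), of "(+) (- g)"] c(2) by simp
  have augment: "augment ?c = 0" if "p = 0"
    using c(3) that unfolding chain_map_def o_def augment_frag_extend_frag_of by blast
  obtain e where e: "singular_chain (Suc p) (top_of_set Y) e" "chain_boundary (Suc p) e = ?c"
    using null_homotopic_acyclic [OF X hom chain boundary augment] by blast
  let ?e = "chain_map (Suc p) ((+) g) e"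
  have "singular_chain (Suc p) (top_of_set ((+) g ` Y)) ?e"
    using singular_chain_chain_map [OF e(1), of "top_of_set ((+) g ` Y)" "(+) g"] continuous_translation [of 0 Y g] by simp
  moreover have "chain_boundary (Suc p) ?e = chain_map p ((+) g) ?c"
    using chain_boundary_chain_map [OF e(1), of "(+) g"] e(2) by simp
  moreover have "chain_map p ((+) g) ?c = c"
  proof -
    have "chain_map p ((+) g) ?c = chain_map p ((+) g \<circ> (+) (- g)) c"
      by (simp add: chain_map_compose)
    also have "(+) g \<circ> (+) (- g) = id"
      by (auto simp: add.assoc [symmetric])
    finally show ?thesis unfolding chain_map_ident [OF c(1)] .
  qed
  ultimately show "\<exists>e. singular_chain (Suc p) (top_of_set ((+) g ` Y)) e \<and> chain_boundary (Suc p) e = c"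
    by metis
qed

lemma acyclic_nhd_step:
  fixes Y :: "'g::topological_group_add set"
  assumes G: "locally_contractible_space (euclidean :: 'g topology)" and Y: "open Y" "0 \<in> Y"
  obtains X where "open X" "0 \<in> X" "acyclic_in X Y" "\<forall>x\<in>X. \<forall>y\<in>X. x + y \<in> Y"
proof -
  obtain Z a where Z: "open Z" "0 \<in> Z" "Z \<subseteq> Y"
    "homotopic_with (\<lambda>_. True) (top_of_set Z) (top_of_set Y) id (\<lambda>_. a)"
    using G Y unfolding locally_contractible_space_def by (metis open_openin)
  obtain X where X: "open X" "0 \<in> X" "\<And>x y z. x \<in> X \<Longrightarrow> y \<in> X \<Longrightarrow> z \<in> X \<Longrightarrow> x + y + z \<in> Z"
    using identity_nhd_third [OF Z(1,2)] by metis
  have "x + y \<in> Z" if "x \<in> X" "y \<in> X" for x y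
    using X(3) [OF that X(2)] by simp
  moreover from this have "X \<subseteq> Z"
    using X(2) by (metis add.right_neutral subsetI)
  moreover have "acyclic_in Z Y"
    using null_homotopic_acyclic_in [OF _ Z(4)] Z(2) by blast
  ultimately show thesis
    using that [of X] X(1,2) Z(3) acyclic_in_mono [of Z Y X] by blast
qed

text \<open>The neighbourhoods grow towards the given \<open>U\<close>, to match the orders of the locale \<open>carried_acyclic\<close>.\<close>

locale acyclic_filtration =
  fixes X :: "nat \<Rightarrow> 'g::topological_group_add set" and N :: nat and U :: "'g set"
  assumes open_X: "open (X i)" and zero_mem: "0 \<in> X i" and X_le: "X i \<subseteq> U" and X_zero_le: "X 0 \<subseteq> X i"
    and acyclic: "i < N \<Longrightarrow> acyclic_in (X i) (X (Suc i))"
    and add_mem: "i < N \<Longrightarrow> x \<in> X i \<Longrightarrow> y \<in> X i \<Longrightarrow> x + y \<in> X (Suc i)"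

text \<open>A sequence shrinking from \<open>U\<close> is chosen first; counting it backwards from position \<open>N\<close> gives an
increasing one.\<close>

lemma exists_acyclic_filtration:
  fixes U :: "'g::topological_group_add set"
  assumes G: "locally_contractible_space (euclidean :: 'g topology)" and U: "open U" "0 \<in> U"
  obtains X where "acyclic_filtration X N U"
proof -
  define P where "P n Y \<longleftrightarrow> open Y \<and> 0 \<in> Y \<and> (n = 0 \<longrightarrow> Y = U)" for n :: nat and Y
  define Q where "Q n Y X \<longleftrightarrow> acyclic_in X Y \<and> (\<forall>x\<in>X. \<forall>y\<in>X. x + y \<in> Y)" for n :: nat and Y X :: "'g set"
  have "\<exists>Y. \<forall>n. P n (Y n) \<and> Q n (Y n) (Y (Suc n))"
  proof (rule dependent_nat_choice)
    show "\<exists>Y. P 0 Y" using U by (auto simp: P_def)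
    fix Y n assume "P n Y"
    then have "open Y" "0 \<in> Y" by (simp_all add: P_def)
    from acyclic_nhd_step [OF G this]
    obtain X where "open X" "0 \<in> X" "acyclic_in X Y" "\<forall>x\<in>X. \<forall>y\<in>X. x + y \<in> Y" .
    then show "\<exists>X. P (Suc n) X \<and> Q n Y X"
      unfolding P_def Q_def by auto
  qed
  then obtain Y where "\<forall>n. P n (Y n) \<and> Q n (Y n) (Y (Suc n))" ..
  then have Y: "P n (Y n)" "Q n (Y n) (Y (Suc n))" for n by simp_all
  have step: "Y (Suc n) \<subseteq> Y n" for n
  proof
    fix x assume x: "x \<in> Y (Suc n)"
    have "0 \<in> Y (Suc n)" using Y(1) [of "Suc n"] by (simp add: P_def)
    moreover have "\<forall>x\<in>Y (Suc n). \<forall>y\<in>Y (Suc n). x + y \<in> Y n" using Y(2) [of n] by (simp add: Q_def)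
    ultimately have "x + 0 \<in> Y n" using x by blast
    then show "x \<in> Y n" by simp
  qed
  have dec: "Y n \<subseteq> Y m" if "m \<le> n" for m n
    using that by (induction n rule: dec_induct) (use step in auto)
  have Suc: "N - i = Suc (N - Suc i)" if "i < N" for i using that by simp
  have "acyclic_filtration (\<lambda>i. Y (N - i)) N U"
  proof
    show "open (Y (N - i))" "0 \<in> Y (N - i)" for i
      using Y(1) [of "N - i"] by (simp_all add: P_def)
    show "Y (N - i) \<subseteq> U" for i using dec [of 0 "N - i"] Y(1) [of 0] by (simp add: P_def)
    show "acyclic_in (Y (N - i)) (Y (N - Suc i))" if "i < N" for i
      using Y(2) [of "N - Suc i"] unfolding Q_def Suc [OF that] by blast
    show "x + y \<in> Y (N - Suc i)" if "i < N" "x \<in> Y (N - i)" "y \<in> Y (N - i)" for i x y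
      using Y(2) [of "N - Suc i"] that(2,3) unfolding Q_def Suc [OF that(1)] by blast
    show "Y (N - 0) \<subseteq> Y (N - i)" for i by (rule dec) simp
  qed
  then show thesis by (rule that)
qed


section \<open>The mapping cone of the vertex map\<close>

text \<open>Basis of the mapping cone. In degree \<open>q\<close> it consists of the lists of length \<open>q + 1\<close> and of the singular
simplices of dimension \<open>q - 1\<close>.\<close>

type_synonym 'a cell = "'a list + ((nat \<Rightarrow> real) \<Rightarrow> 'a)"

definition cells :: "nat \<Rightarrow> 'a::topological_space set \<Rightarrow> 'a cell set" where
  "cells q S = Inl ` {xs. length xs = Suc q \<and> set xs \<subseteq> S} \<union>
     Inr ` {\<tau>. \<exists>p. q = Suc p \<and> singular_simplex p (top_of_set S) \<tau>}"

abbreviation Inl_chain :: "('a list \<Rightarrow>\<^sub>0 int) \<Rightarrow> 'a cell \<Rightarrow>\<^sub>0 int" where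
  "Inl_chain c \<equiv> frag_extend (\<lambda>xs. frag_of (Inl xs)) c"

abbreviation Inr_chain :: "'a chain \<Rightarrow> 'a cell \<Rightarrow>\<^sub>0 int" where
  "Inr_chain c \<equiv> frag_extend (\<lambda>\<tau>. frag_of (Inr \<tau>)) c"

text \<open>The cone is built from the complex without augmentation, so a list of length one has boundary
zero.\<close>

fun cone_boundary :: "nat \<Rightarrow> 'a cell \<Rightarrow> 'a cell \<Rightarrow>\<^sub>0 int" where
  "cone_boundary q (Inl xs) = (if q = 0 then 0 else Inl_chain (list_boundary xs))"
| "cone_boundary q (Inr \<tau>) =
    frag_of (Inl (vertex_list (q - 1) \<tau>)) - Inr_chain (chain_boundary (q - 1) (frag_of \<tau>))"

fun cell_base :: "'a cell \<Rightarrow> 'a" where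
  "cell_base (Inl xs) = hd xs"
| "cell_base (Inr \<tau>) = simplicial_vertex 0 \<tau>"

lemma cells_mono: "S \<subseteq> T \<Longrightarrow> cells q S \<subseteq> cells q T"
  by (auto simp: cells_def dest: singular_simplex_mono)

lemma Inl_cell_iff: "Inl xs \<in> cells q S \<longleftrightarrow> length xs = Suc q \<and> set xs \<subseteq> S"
  by (auto simp: cells_def)

lemma Inr_cell_iff: "Inr \<tau> \<in> cells q S \<longleftrightarrow> (\<exists>p. q = Suc p \<and> singular_simplex p (top_of_set S) \<tau>)"
  by (auto simp: cells_def)

lemma simplex_image: "singular_simplex p (top_of_set S) \<tau> \<Longrightarrow> \<tau> ` standard_simplex p \<subseteq> S"
  by (auto simp: singular_simplex_subtopology)

lemma cell_base_mem: "b \<in> cells q S \<Longrightarrow> cell_base b \<in> S"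
proof (cases b)
  case (Inl xs)
  assume "b \<in> cells q S"
  then have "xs \<noteq> []" "set xs \<subseteq> S" using Inl by (auto simp: Inl_cell_iff)
  then show ?thesis using Inl by (simp add: hd_in_set subset_iff)
next
  case (Inr \<tau>)
  assume "b \<in> cells q S"
  then obtain p where p: "singular_simplex p (top_of_set S) \<tau>" using Inr by (auto simp: Inr_cell_iff)
  have "hd (vertex_list p \<tau>) \<in> set (vertex_list p \<tau>)"
    by (rule hd_in_set) (metis length_vertex_list list.size(3) nat.distinct(1))
  then show ?thesis
    using set_vertex_list [of p \<tau>] simplex_image [OF p] Inr by (auto simp: hd_vertex_list)
qed

lemma keys_Inl_chain: "Poly_Mapping.keys c \<subseteq> {xs. length xs = Suc q \<and> set xs \<subseteq> S} \<Longrightarrow> Poly_Mapping.keys (Inl_chain c) \<subseteq> cells q S"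
  by (intro keys_frag_extend_subset) (auto simp: keys_frag_of Inl_cell_iff)

lemma keys_Inr_chain: "singular_chain p (top_of_set S) c \<Longrightarrow> Poly_Mapping.keys (Inr_chain c) \<subseteq> cells (Suc p) S"
  unfolding singular_chain_def by (intro keys_frag_extend_subset) (auto simp: keys_frag_of Inr_cell_iff)

lemma cell_faces:
  assumes "b \<in> cells (Suc q) S"
  shows "Poly_Mapping.keys (cone_boundary (Suc q) b) \<subseteq> cells q S"
proof (cases b)
  case (Inl xs)
  then have "length xs = Suc (Suc q)" "set xs \<subseteq> S" using assms by (auto simp: Inl_cell_iff)
  then have "Poly_Mapping.keys (Inl_chain (list_boundary xs)) \<subseteq> cells q S"
    using keys_list_boundary [of xs] by (intro keys_Inl_chain) auto
  then show ?thesis using Inl by simp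
next
  case (Inr \<tau>)
  then have \<tau>: "singular_simplex q (top_of_set S) \<tau>" using assms by (auto simp: Inr_cell_iff)
  have "set (vertex_list q \<tau>) \<subseteq> S"
    using set_vertex_list simplex_image [OF \<tau>] by fast
  then have "Poly_Mapping.keys (frag_of (Inl (vertex_list q \<tau>) :: 'a cell)) \<subseteq> cells q S"
    by (simp add: keys_frag_of Inl_cell_iff)
  moreover have "Poly_Mapping.keys (Inr_chain (chain_boundary q (frag_of \<tau>))) \<subseteq> cells q S"
  proof (cases q)
    case 0
    then show ?thesis by (simp add: chain_boundary_def)
  next
    case (Suc p)
    have "singular_chain q (top_of_set S) (frag_of \<tau>)" using \<tau> by (simp add: singular_chain_of)
    then have "singular_chain p (top_of_set S) (chain_boundary q (frag_of \<tau>))"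
      using singular_chain_boundary [of q] Suc by fastforce
    then show ?thesis unfolding Suc by (rule keys_Inr_chain)
  qed
  ultimately show ?thesis
    using Inr keys_diff [of "frag_of (Inl (vertex_list q \<tau>))" "Inr_chain (chain_boundary q (frag_of \<tau>))"] by auto
qed

lemma cone_boundary_Inl_chain:
  "frag_extend (cone_boundary (Suc q)) (Inl_chain c) = Inl_chain (frag_extend list_boundary c)"
  by (simp add: frag_extend_frag_extend)

lemma cone_boundary_Inr_chain:
  "frag_extend (cone_boundary (Suc q)) (Inr_chain c) =
    Inl_chain (frag_extend (\<lambda>\<tau>. frag_of (vertex_list q \<tau>)) c) - Inr_chain (chain_boundary q c)"
proof -
  have "frag_extend (cone_boundary (Suc q)) (Inr_chain c) =
      frag_extend (\<lambda>\<tau>. frag_of (Inl (vertex_list q \<tau>)) - Inr_chain (chain_boundary q (frag_of \<tau>))) c"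
    by (simp add: frag_extend_frag_extend)
  also have "\<dots> = frag_extend (\<lambda>\<tau>. frag_of (Inl (vertex_list q \<tau>))) c -
      Inr_chain (frag_extend (\<lambda>\<tau>. chain_boundary q (frag_of \<tau>)) c)"
    by (simp add: frag_extend_minus_fun frag_extend_frag_extend)
  finally show ?thesis
    unfolding chain_boundary_eq_frag_extend [symmetric] by (simp add: frag_extend_frag_extend)
qed

lemma vertex_chain_boundary:
  "frag_extend (\<lambda>\<tau>. frag_of (vertex_list q \<tau>)) (chain_boundary (Suc q) c) =
    frag_extend list_boundary (frag_extend (\<lambda>\<tau>. frag_of (vertex_list (Suc q) \<tau>)) c)"
proof -
  have "frag_extend (\<lambda>\<tau>. frag_of (vertex_list q \<tau>)) (chain_boundary (Suc q) (frag_of \<tau>)) = list_boundary (vertex_list (Suc q) \<tau>)" for \<tau> :: "(nat \<Rightarrow> real) \<Rightarrow> 'a"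
    unfolding frag_extend_eq_eval_chain by (rule list_coboundary_vertex_list)
  then show ?thesis
    unfolding chain_boundary_eq_frag_extend [of _ c] by (simp add: frag_extend_frag_extend)
qed

lemma cone_boundary_boundary:
  assumes b: "b \<in> cells (Suc q) S"
  shows "frag_extend (cone_boundary q) (cone_boundary (Suc q) b) = 0"
proof (cases q)
  case 0
  have "cone_boundary 0 b' = 0" if "b' \<in> cells 0 S" for b'
    using that by (cases b') (auto simp: Inr_cell_iff)
  then show ?thesis
    using cell_faces [OF b] 0 by (intro frag_extend_eq_0 [of _ "cone_boundary q"]) auto
next
  case (Suc p)
  show ?thesis
  proof (cases b)
    case (Inl xs)
    then show ?thesis using Suc by (simp add: cone_boundary_Inl_chain list_boundary_list_boundary del: cone_boundary.simps) (simp add: cone_boundary_Inl_chain list_boundary_list_boundary)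
  next
    case (Inr \<tau>)
    then have "singular_chain q (top_of_set S) (frag_of \<tau>)" using b by (auto simp: Inr_cell_iff singular_chain_of)
    from chain_boundary_boundary [OF this] have dd: "chain_boundary p (chain_boundary (Suc p) (frag_of \<tau>)) = 0"
      using Suc by simp
    have "frag_extend (cone_boundary q) (cone_boundary (Suc q) b) =
        Inl_chain (list_boundary (vertex_list q \<tau>)) -
        frag_extend (cone_boundary (Suc p)) (Inr_chain (chain_boundary (Suc p) (frag_of \<tau>)))"
      using Inr Suc by (simp add: frag_extend_diff)
    also have "\<dots> = 0"
      unfolding cone_boundary_Inr_chain dd vertex_chain_boundary using Suc by simp
    finally show ?thesis .
  qed
qed

lemma cone_chain_split:
  obtains t s where "c = Inl_chain t + Inr_chain s"
    "Poly_Mapping.keys t \<subseteq> Inl -` Poly_Mapping.keys c"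
    "Poly_Mapping.keys s \<subseteq> Inr -` Poly_Mapping.keys (c :: 'a cell \<Rightarrow>\<^sub>0 int)"
proof
  let ?t = "frag_extend (case_sum frag_of (\<lambda>_. 0)) c" and ?s = "frag_extend (case_sum (\<lambda>_. 0) frag_of) c"
  show "c = Inl_chain ?t + Inr_chain ?s"
  proof -
    have "Inl_chain ?t + Inr_chain ?s = frag_extend (\<lambda>b. Inl_chain (case_sum frag_of (\<lambda>_. 0) b) + Inr_chain (case_sum (\<lambda>_. 0) frag_of b)) c"
      by (simp add: frag_extend_frag_extend frag_extend_add_fun)
    also have "\<dots> = frag_extend frag_of c"
      by (rule frag_extend_eq) (simp split: sum.split)
    finally show ?thesis by (simp add: frag_extend_frag_of)
  qed
  show "Poly_Mapping.keys ?t \<subseteq> Inl -` Poly_Mapping.keys c"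
    by (rule keys_frag_extend_subset) (auto simp: keys_frag_of split: sum.splits)
  show "Poly_Mapping.keys ?s \<subseteq> Inr -` Poly_Mapping.keys c"
    by (rule keys_frag_extend_subset) (auto simp: keys_frag_of split: sum.splits)
qed

lemma Inl_Inr_chain_eq_0:
  assumes "Inl_chain t - Inr_chain s = 0" shows "t = 0" "s = 0"
proof -
  have "frag_extend (case_sum frag_of (\<lambda>_. 0)) (Inl_chain t - Inr_chain s) = t"
    by (simp add: frag_extend_diff frag_extend_frag_extend frag_extend_frag_of frag_extend_eq_0)
  then show "t = 0" using assms by simp
  have "frag_extend (case_sum (\<lambda>_. 0) frag_of) (Inl_chain t - Inr_chain s) = - s"
    by (simp add: frag_extend_diff frag_extend_frag_extend frag_extend_frag_of frag_extend_eq_0)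
  then show "s = 0" using assms by simp
qed

lemma augment_list_boundary:
  assumes "length xs = 2" shows "augment (list_boundary xs) = 0"
proof -
  obtain x y where "xs = [x, y]"
    using assms by (auto simp: numeral_2_eq_2 length_Suc_conv)
  then show ?thesis by (simp add: augment_def frag_extend_diff)
qed

text \<open>In degree \<open>0\<close> a point is the boundary of the constant singular simplex at it. In positive
degrees, split the cycle as a chain \<open>t\<close> of tuples plus a chain \<open>s\<close> of simplices. Then \<open>s\<close> is a cycle, and the
vertices of \<open>s\<close> are minus the boundary of \<open>t\<close>; if \<open>s\<close> has dimension \<open>0\<close>, it follows that its coefficients sum to zero. Hence
\<open>s\<close> bounds some \<open>u\<close>. Adding the vertices of \<open>u\<close> to \<open>t\<close> gives a cycle of tuples, which is filled by the cone
with apex \<open>h\<close>.\<close>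

lemma cone_acyclic:
  fixes h :: "'g::topological_group_add"
  assumes XY: "acyclic_in X Y" "X \<subseteq> Y" and zero: "0 \<in> Y"
    and c: "Poly_Mapping.keys c \<subseteq> cells q ((+) h ` X)" and cycle: "frag_extend (cone_boundary q) c = 0"
  shows "\<exists>e. Poly_Mapping.keys e \<subseteq> cells (Suc q) ((+) h ` Y) \<and> frag_extend (cone_boundary (Suc q)) e = c"
proof -
  let ?X = "(+) h ` X" and ?Y = "(+) h ` Y"
  have h: "h \<in> ?Y" using zero by (intro image_eqI [of _ _ 0]) auto
  have sub: "?X \<subseteq> ?Y" using XY(2) by blast
  obtain t s where ts: "c = Inl_chain t + Inr_chain s"
    "Poly_Mapping.keys t \<subseteq> Inl -` Poly_Mapping.keys c" "Poly_Mapping.keys s \<subseteq> Inr -` Poly_Mapping.keys c"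
    by (rule cone_chain_split)
  have t: "length xs = Suc q" "set xs \<subseteq> ?X" if "xs \<in> Poly_Mapping.keys t" for xs
  proof -
    have "Inl xs \<in> cells q ?X" using subsetD [OF ts(2) that] c by auto
    then show "length xs = Suc q" "set xs \<subseteq> ?X" by (simp_all add: Inl_cell_iff)
  qed
  have s: "\<exists>p. q = Suc p \<and> singular_simplex p (top_of_set ?X) \<tau>" if "\<tau> \<in> Poly_Mapping.keys s" for \<tau>
  proof -
    have "Inr \<tau> \<in> cells q ?X" using subsetD [OF ts(3) that] c by auto
    then show ?thesis by (simp only: Inr_cell_iff)
  qed
  show ?thesis
  proof (cases q)
    case 0
    have "Poly_Mapping.keys s = {}" using s 0 by blast
    then have "c = Inl_chain t" using ts(1) by simp
    define k where "k xs = restrict (\<lambda>_. hd xs) (standard_simplex 0)" for xs :: "'g list"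
    have vertex: "vertex_list 0 (k xs) = xs" if xs: "xs \<in> Poly_Mapping.keys t" for xs
    proof -
      obtain x where "xs = [x]" using t(1) [OF xs] 0 by (auto simp: length_Suc_conv)
      then show ?thesis by (simp add: vertex_list_def simplicial_vertex_def k_def basis_in_standard_simplex)
    qed
    let ?u = "frag_extend (\<lambda>xs. frag_of (k xs)) t"
    have "singular_chain 0 (top_of_set ?Y) ?u"
    proof (rule singular_chain_extend)
      fix xs assume xs: "xs \<in> Poly_Mapping.keys t"
      then have "xs \<noteq> []" using t(1) by fastforce
      then have "hd xs \<in> ?Y" using t(2) [OF xs] sub hd_in_set by fast
      then have "continuous_map (subtopology (powertop_real UNIV) (standard_simplex 0)) (top_of_set ?Y) (\<lambda>_. hd xs)"
        by simp
      then have "continuous_map (subtopology (powertop_real UNIV) (standard_simplex 0)) (top_of_set ?Y) (k xs)"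
        by (rule continuous_map_eq) (simp add: k_def)
      then have "singular_simplex 0 (top_of_set ?Y) (k xs)"
        by (simp add: singular_simplex_def k_def)
      then show "singular_chain 0 (top_of_set ?Y) (frag_of (k xs))" by (simp add: singular_chain_of)
    qed
    then have "Poly_Mapping.keys (Inr_chain ?u) \<subseteq> cells (Suc q) ?Y"
      using keys_Inr_chain [of 0] 0 by simp
    moreover have "frag_extend (\<lambda>\<tau>. frag_of (vertex_list 0 \<tau>)) ?u = t"
    proof -
      have "frag_extend (\<lambda>\<tau>. frag_of (vertex_list 0 \<tau>)) ?u = frag_extend frag_of t"
        unfolding frag_extend_frag_extend by (rule frag_extend_eq) (simp add: vertex)
      then show ?thesis by (simp add: frag_extend_frag_of)
    qed
    then have "frag_extend (cone_boundary (Suc q)) (Inr_chain ?u) = c"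
      unfolding 0 cone_boundary_Inr_chain \<open>c = Inl_chain t\<close> by (simp add: chain_boundary_def)
    ultimately show ?thesis by blast
  next
    case (Suc p)
    let ?v = "\<lambda>c. frag_extend (\<lambda>\<tau>. frag_of (vertex_list p \<tau>)) c"
    have s_chain: "singular_chain p (top_of_set ?X) s"
      using s Suc by (auto simp: singular_chain_def)
    have "Inl_chain (frag_extend list_boundary t + ?v s) - Inr_chain (chain_boundary p s) = 0"
      using cycle unfolding ts(1) Suc frag_extend_add cone_boundary_Inl_chain cone_boundary_Inr_chain
      by (simp add: add_diff_eq)
    from Inl_Inr_chain_eq_0 [OF this]
    have bt: "frag_extend list_boundary t + ?v s = 0" and bs: "chain_boundary p s = 0" by auto
    have "augment s = 0" if "p = 0"
    proof -
      have "augment s = augment (?v s)" by (simp add: augment_frag_extend_frag_of)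
      also have "?v s = - frag_extend list_boundary t"
        using bt by (simp add: eq_neg_iff_add_eq_0 add.commute)
      also have "augment \<dots> = - frag_extend (\<lambda>xs. augment (list_boundary xs)) t"
        by (simp add: augment_def frag_extend_minus frag_extend_frag_extend)
      also have "\<dots> = 0"
      proof -
        have "frag_extend (\<lambda>xs. augment (list_boundary xs)) t = 0"
        proof (rule frag_extend_eq_0)
          fix xs assume "xs \<in> Poly_Mapping.keys t"
          then have "length xs = 2" using t(1) Suc that by simp
          then show "augment (list_boundary xs) = 0" by (rule augment_list_boundary)
        qed
        then show ?thesis by simp
      qed
      finally show ?thesis .
    qed
    then obtain u where u: "singular_chain (Suc p) (top_of_set ?Y) u" "chain_boundary (Suc p) u = s"
      using XY(1) s_chain bs unfolding acyclic_in_def by blast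
    let ?vu = "frag_extend (\<lambda>\<tau>. frag_of (vertex_list (Suc p) \<tau>)) u"
    let ?t = "t + ?vu"
    have bt': "frag_extend list_boundary ?t = 0"
      using bt u(2) vertex_chain_boundary [of p u] by (simp add: frag_extend_add)
    let ?e = "Inl_chain (cone_chain h ?t) - Inr_chain u"
    have keys_vu: "Poly_Mapping.keys ?vu \<subseteq> {xs. length xs = Suc q \<and> set xs \<subseteq> ?Y}"
    proof (rule keys_frag_extend_subset)
      fix \<tau> assume "\<tau> \<in> Poly_Mapping.keys u"
      then have "singular_simplex (Suc p) (top_of_set ?Y) \<tau>" using u(1) by (auto simp: singular_chain_def)
      from simplex_image [OF this] show "Poly_Mapping.keys (frag_of (vertex_list (Suc p) \<tau>)) \<subseteq> {xs. length xs = Suc q \<and> set xs \<subseteq> ?Y}"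
        using set_vertex_list [of "Suc p" \<tau>] Suc by (auto simp: keys_frag_of)
    qed
    have "Poly_Mapping.keys t \<subseteq> {xs. length xs = Suc q \<and> set xs \<subseteq> ?Y}"
      using t(1) order_trans [OF t(2) sub] by (simp add: subset_iff [of "Poly_Mapping.keys t"])
    then have "Poly_Mapping.keys ?t \<subseteq> {xs. length xs = Suc q \<and> set xs \<subseteq> ?Y}"
      using keys_vu by (intro order_trans [OF keys_add Un_least])
    then have "Poly_Mapping.keys (cone_chain h ?t) \<subseteq> {xs. length xs = Suc (Suc q) \<and> set xs \<subseteq> ?Y}"
      unfolding cone_chain_def using h by (intro keys_frag_extend_subset) (auto simp: keys_frag_of)
    then have "Poly_Mapping.keys (Inl_chain (cone_chain h ?t)) \<subseteq> cells (Suc q) ?Y"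
      by (rule keys_Inl_chain)
    moreover have "Poly_Mapping.keys (Inr_chain u) \<subseteq> cells (Suc q) ?Y"
      using keys_Inr_chain [OF u(1)] Suc by simp
    ultimately have "Poly_Mapping.keys ?e \<subseteq> cells (Suc q) ?Y"
      by (rule order_trans [OF keys_diff Un_least])
    moreover have "frag_extend (cone_boundary (Suc q)) ?e = c"
      unfolding frag_extend_diff cone_boundary_Inl_chain list_boundary_cone bt' cone_boundary_Inr_chain
      using Suc u(2) ts(1) by (simp add: cone_chain_def frag_extend_add)
    ultimately show ?thesis by blast
  qed
qed

text \<open>A cell is attached to the translate of the filtration to its base point. For a cell that is small
of order \<open>W\<close>, the base points of its faces lie in the translate of \<open>X 0\<close>, so passing from a face to the cell costs
one step of the filtration.\<close>

locale cone_filtration = acyclic_filtration +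
  fixes W :: "'a::topological_group_add set"
  assumes W: "x \<in> W \<Longrightarrow> y \<in> W \<Longrightarrow> - x + y \<in> X 0"
begin

abbreviation small_cells where "small_cells q \<equiv> \<Union>g. cells q ((+) g ` W)"
abbreviation carrier_cells where "carrier_cells i q b \<equiv> cells q ((+) (cell_base b) ` X i)"

lemma translate_subset: "x \<in> (+) g ` W \<Longrightarrow> (+) g ` W \<subseteq> (+) x ` X 0"
proof
  fix y assume "x \<in> (+) g ` W" "y \<in> (+) g ` W"
  then obtain a b where ab: "a \<in> W" "b \<in> W" "x = g + a" "y = g + b" by blast
  then have "y = x + (- a + b)" by (simp add: add.assoc [symmetric])
  then show "y \<in> (+) x ` X 0" using W [OF ab(1,2)] by blast
qed

lemma translate_subset_step:
  assumes "x \<in> (+) y ` X 0" "i < N" shows "(+) x ` X i \<subseteq> (+) y ` X (Suc i)"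
proof
  fix z assume "z \<in> (+) x ` X i"
  then obtain a b where ab: "a \<in> X 0" "b \<in> X i" "x = y + a" "z = x + b" using assms(1) by blast
  then have "a + b \<in> X (Suc i)" using add_mem [OF assms(2)] X_zero_le by blast
  then show "z \<in> (+) y ` X (Suc i)" using ab by (auto simp: add.assoc)
qed

lemma X_step: "i < N \<Longrightarrow> X i \<subseteq> X (Suc i)"
  using add_mem [OF _ _ zero_mem] by force

sublocale carried_acyclic cone_boundary small_cells carrier_cells N
proof
  show "cone_boundary 0 b = 0" if "b \<in> small_cells 0" for b
    using that by (cases b) (auto simp: Inr_cell_iff)
  show "Poly_Mapping.keys (cone_boundary (Suc q) b) \<subseteq> small_cells q" if "b \<in> small_cells (Suc q)" for b q
    using that cell_faces by blast
  show "frag_extend (cone_boundary q) (cone_boundary (Suc q) b) = 0" if "b \<in> small_cells (Suc q)" for b q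
    using that cone_boundary_boundary by blast
  show "b \<in> carrier_cells i q b" if "b \<in> small_cells q" for b i q
  proof -
    obtain g where g: "b \<in> cells q ((+) g ` W)" using \<open>b \<in> small_cells q\<close> by blast
    have "(+) g ` W \<subseteq> (+) (cell_base b) ` X i"
      using translate_subset [OF cell_base_mem [OF g]] X_zero_le by blast
    then show ?thesis using g cells_mono by blast
  qed
  show "carrier_cells i p b' \<subseteq> carrier_cells (Suc i) p b"
    if b: "b \<in> small_cells (Suc q)" and b': "b' \<in> Poly_Mapping.keys (cone_boundary (Suc q) b)" and i: "i < N" for b b' i p q
  proof (rule cells_mono)
    obtain g where g: "b \<in> cells (Suc q) ((+) g ` W)" using b by blast
    then have "b' \<in> cells q ((+) g ` W)" using cell_faces b' by blast
    then have "cell_base b' \<in> (+) (cell_base b) ` X 0"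
      using translate_subset [OF cell_base_mem [OF g]] cell_base_mem by blast
    then show "(+) (cell_base b') ` X i \<subseteq> (+) (cell_base b) ` X (Suc i)"
      using i by (rule translate_subset_step)
  qed
  show "\<exists>e. Poly_Mapping.keys e \<subseteq> carrier_cells (Suc i) (Suc q) b \<and> frag_extend (cone_boundary (Suc q)) e = c"
    if "i < N" "Poly_Mapping.keys c \<subseteq> carrier_cells i q b" "frag_extend (cone_boundary q) c = 0" for b c i q
    using acyclic [OF that(1)] X_step [OF that(1)] zero_mem that(2,3) by (rule cone_acyclic)
qed

end

lemma cone_pro_acyclic:
  fixes U :: "'g::topological_group_add set" and F :: "'g cell \<Rightarrow> 'v::ab_group_add"
  assumes G: "locally_contractible_space (euclidean :: 'g topology)" and U: "open U" "0 \<in> U"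
    and cocycle: "\<And>g b. b \<in> cells (Suc n) ((+) g ` U) \<Longrightarrow> eval_chain F (cone_boundary (Suc n) b) = 0"
  obtains W G where "open W" "0 \<in> W" "W \<subseteq> U"
    "\<forall>g. \<forall>b\<in>cells n ((+) g ` W). F b = (case n of 0 \<Rightarrow> 0 | Suc m \<Rightarrow> eval_chain G (cone_boundary n b))"
proof -
  obtain X where "acyclic_filtration X (Suc (2 * n)) U"
    using exists_acyclic_filtration [OF G U] by blast
  then interpret acyclic_filtration X "Suc (2 * n)" U .
  obtain W where W_nhd: "open W" "0 \<in> W" "\<And>x. x \<in> W \<Longrightarrow> - x \<in> W"
      "\<And>x y z. x \<in> W \<Longrightarrow> y \<in> W \<Longrightarrow> z \<in> W \<Longrightarrow> x + y + z \<in> X 0"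
    using identity_nhd_third [OF open_X [of 0] zero_mem [of 0]] by metis
  interpret cone_filtration X "Suc (2 * n)" U W
  proof
    show "- x + y \<in> X 0" if "x \<in> W" "y \<in> W" for x y
      using W_nhd(4) [OF W_nhd(3) [OF that(1)] that(2) W_nhd(2)] by simp
  qed
  have n: "2 * n < Suc (2 * n)" by simp
  have "eval_chain F (cone_boundary (Suc n) e) = 0" if "e \<in> carrier_cells (2 * n + 1) (Suc n) b" for b e
    using cocycle [of e "cell_base b"] that subsetD [OF cells_mono [OF image_mono [OF X_le]]] by metis
  from cocycle_is_coboundary [OF n this] obtain G
    where G: "\<forall>b\<in>small_cells n. F b = (case n of 0 \<Rightarrow> 0 | Suc m \<Rightarrow> eval_chain G (cone_boundary n b))" .
  have "W \<subseteq> X 0" using W_nhd(4) [OF _ W_nhd(2) W_nhd(2)] by auto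
  then have "W \<subseteq> U" using X_le by blast
  then show thesis
    using that [of W G] W_nhd(1,2) G by blast
qed


section \<open>Comparison with singular cohomology\<close>

lemma vertex_cochain_list_cochain:
  "vertex_cochain \<UU> n (list_cochain \<UU> n F) = restrict (\<lambda>\<tau>. F (vertex_list n \<tau>)) (small_simplices \<UU> n)"
proof -
  have "list_cochain \<UU> n F (\<lambda>i\<in>{..n}. simplicial_vertex i \<tau>) = F (vertex_list n \<tau>)"
    if \<tau>: "\<tau> \<in> small_simplices \<UU> n" for \<tau>
  proof -
    have eq: "(\<lambda>i\<in>{..n}. simplicial_vertex i \<tau>) = list_tuple n (vertex_list n \<tau>)"
      by (rule ext) (simp add: list_tuple_def vertex_list_def del: upt_Suc)
    have "small_list \<UU> (vertex_list n \<tau>)"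
      using \<tau> set_vertex_list [of n \<tau>] unfolding small_simplices_def small_list_def by blast
    then have "list_tuple n (vertex_list n \<tau>) \<in> cover_tuples \<UU> n"
      by (intro list_tuple_mem_cover_tuples) simp
    then show ?thesis
      unfolding eq by (simp add: list_cochain_def tuple_list_list_tuple)
  qed
  then show ?thesis
    unfolding vertex_cochain_def by (rule restrict_ext)
qed

lemma vertex_cochain_map:
  "abelian_cochain_map (tuple_complex \<UU> :: ((nat \<Rightarrow> 'a::topological_space) \<Rightarrow> 'v::ab_group_add) cochain_complex)
    (small_complex \<UU>) (vertex_cochain \<UU>)"
proof (intro abelian_cochain_map.intro abelian_cochain_map_axioms.intro tuple_complex small.simplex_complex)
  let ?K = "tuple_complex \<UU> :: ((nat \<Rightarrow> 'a) \<Rightarrow> 'v) cochain_complex"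
  let ?L = "small_complex \<UU> :: (((nat \<Rightarrow> real) \<Rightarrow> 'a) \<Rightarrow> 'v) cochain_complex"
  fix n
  show "vertex_cochain \<UU> n \<in> hom (cochains ?K n) (cochains ?L n)"
  proof (rule homI)
    show "vertex_cochain \<UU> n x \<in> carrier (cochains ?L n)" for x
      by (simp add: small.carrier_simplex_complex vertex_cochain_def)
    fix x y assume "x \<in> carrier (cochains ?K n)" "y \<in> carrier (cochains ?K n)"
    then obtain F G where "x = list_cochain \<UU> n F" "y = list_cochain \<UU> n G"
      unfolding carrier_tuple_complex by (metis cochain_eq_list_cochain)
    then show "vertex_cochain \<UU> n (x \<otimes>\<^bsub>cochains ?K n\<^esub> y) = vertex_cochain \<UU> n x \<otimes>\<^bsub>cochains ?L n\<^esub> vertex_cochain \<UU> n y"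
      by (simp only: mult_list_cochain vertex_cochain_list_cochain small.mult_simplex_complex)
  qed
  fix x assume "x \<in> carrier (cochains ?K n)"
  then obtain F where "x = list_cochain \<UU> n F"
    unfolding carrier_tuple_complex by (metis cochain_eq_list_cochain)
  then show "vertex_cochain \<UU> (Suc n) (coboundary ?K n x) = coboundary ?L n (vertex_cochain \<UU> n x)"
    by (simp only: coboundary_list_cochain vertex_cochain_list_cochain small.coboundary_simplex_complex list_coboundary_vertex_list)
qed

lemma open_cover_translates:
  assumes "U \<in> identity_nhds" shows "open_cover (translate_cover U)"
proof
  have U: "open U" "0 \<in> U" using assms by (auto simp: identity_nhds_def)
  show "open Z" if "Z \<in> translate_cover U" for Z using U(1) that by (rule open_translate_cover)
  have "x \<in> (+) x ` U" for x using U(2) by (intro image_eqI [of _ _ 0]) auto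
  then show "\<Union>(translate_cover U) = UNIV" by (auto simp: translate_cover_def)
qed

text \<open>If the vertex cochain of \<open>F\<close> is the coboundary of \<open>Y\<close>, then \<open>F\<close> and \<open>Y\<close> together are a cocycle of the
dual cone. On a smaller neighbourhood it is a coboundary, and its component on tuples exhibits \<open>F\<close> as one.\<close>

lemma vertex_map_injective:
  fixes U :: "'g::topological_group_add set" and F :: "'g list \<Rightarrow> 'v::ab_group_add"
  assumes G: "locally_contractible_space (euclidean :: 'g topology)" and U: "U \<in> identity_nhds"
    and cocycle: "\<And>xs. length xs = Suc (Suc n) \<Longrightarrow> small_list (translate_cover U) xs \<Longrightarrow> list_coboundary F xs = 0"
    and exact: "restrict (\<lambda>\<tau>. F (vertex_list n \<tau>)) (small_simplices (translate_cover U) n)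
      \<in> coboundaries (small_complex (translate_cover U)) n"
  obtains W where "W \<in> identity_nhds" "W \<subseteq> U"
    "list_cochain (translate_cover W) n F \<in> coboundaries (tuple_complex (translate_cover W)) n"
proof -
  let ?\<UU> = "translate_cover U"
  obtain Y where Y: "\<And>\<tau>. \<tau> \<in> small_simplices ?\<UU> n \<Longrightarrow>
      restrict (\<lambda>\<tau>. F (vertex_list n \<tau>)) (small_simplices ?\<UU> n) \<tau> = eval_chain Y (chain_boundary n (frag_of \<tau>))"
    using small.coboundaryE [OF exact] by blast
  let ?F = "case_sum F Y"
  have "eval_chain ?F (cone_boundary (Suc n) b) = 0" if b: "b \<in> cells (Suc n) ((+) g ` U)" for g b
  proof (cases b)
    case (Inl xs)
    then have "length xs = Suc (Suc n)" "small_list ?\<UU> xs"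
      using b by (auto simp: Inl_cell_iff small_list_def translate_cover_def)
    then have "list_coboundary F xs = 0" by (rule cocycle)
    then show ?thesis using Inl by (simp add: eval_chain_frag_extend eval_chain_list_boundary)
  next
    case (Inr \<tau>)
    then have \<tau>: "\<tau> \<in> small_simplices ?\<UU> n"
      using b by (auto simp: Inr_cell_iff small_simplices_eq translate_cover_def)
    show ?thesis
      using Inr Y [OF \<tau>] \<tau> by (simp add: eval_chain_diff eval_chain_frag_extend)
  qed
  moreover have "open U" "0 \<in> U" using U by (auto simp: identity_nhds_def)
  ultimately obtain W K where W: "open W" "0 \<in> W" "W \<subseteq> U"
    and K: "\<forall>g. \<forall>b\<in>cells n ((+) g ` W). ?F b = (case n of 0 \<Rightarrow> 0 | Suc m \<Rightarrow> eval_chain K (cone_boundary n b))"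
    using cone_pro_acyclic [OF G, of U n ?F] by metis
  let ?\<W> = "translate_cover W"
  have "list_cochain ?\<W> n F \<in> coboundaries (tuple_complex ?\<W>) n"
  \<comment> \<open>The value at the empty list has to be \<open>0\<close> in degree \<open>0\<close>.\<close>
  proof (rule list_cochain_coboundaryI [where G = "\<lambda>xs. if n = 0 then 0 else K (Inl xs)"])
    fix xs :: "'g list" assume xs: "length xs = Suc n" "small_list ?\<W> xs"
    then obtain g where "Inl xs \<in> cells n ((+) g ` W)"
      by (auto simp: small_list_def translate_cover_def Inl_cell_iff)
    then have "F xs = (case n of 0 \<Rightarrow> 0 | Suc m \<Rightarrow> eval_chain K (cone_boundary n (Inl xs)))"
      using K by force
    then show "F xs = list_coboundary (\<lambda>xs. if n = 0 then 0 else K (Inl xs)) xs"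
      by (cases n) (simp_all add: list_coboundary_zero eval_chain_frag_extend eval_chain_list_boundary)
  qed simp
  then show thesis
    using W by (intro that [of W]) (auto simp: identity_nhds_def)
qed

text \<open>A singular cocycle \<open>f\<close>, extended by zero to tuples, is a cocycle of the dual cone. When it becomes a
coboundary, the tuple component of the bounding cochain is a cocycle whose vertex cochain is cohomologous
to \<open>f\<close>.\<close>

lemma vertex_map_surjective:
  fixes U :: "'g::topological_group_add set" and f :: "((nat \<Rightarrow> real) \<Rightarrow> 'g) \<Rightarrow> 'v::ab_group_add"
  assumes G: "locally_contractible_space (euclidean :: 'g topology)"
    and cocycle: "\<And>\<tau>. \<tau> \<in> singular_simplex_set (Suc n) euclidean \<Longrightarrow> eval_chain f (chain_boundary (Suc n) (frag_of \<tau>)) = 0"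
  obtains W F where "W \<in> identity_nhds"
    "list_cochain (translate_cover W) n F \<in> cocycles (tuple_complex (translate_cover W)) n"
    "restrict (\<lambda>\<tau>. F (vertex_list n \<tau>) - f \<tau>) (small_simplices (translate_cover W) n)
      \<in> coboundaries (small_complex (translate_cover W)) n"
proof -
  let ?F = "case_sum (\<lambda>_. 0) f :: 'g cell \<Rightarrow> 'v"
  have zero: "eval_chain (\<lambda>_. 0 :: 'v) c = 0" for c :: "'b \<Rightarrow>\<^sub>0 int"
    by (rule eval_chain_eq_0) simp
  have "eval_chain ?F (cone_boundary (Suc (Suc n)) b) = 0" if b: "b \<in> cells (Suc (Suc n)) ((+) g ` UNIV)" for g b
  proof (cases b)
    case (Inl xs)
    then show ?thesis by (simp add: eval_chain_frag_extend zero)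
  next
    case (Inr \<tau>)
    then have "\<tau> \<in> singular_simplex_set (Suc n) euclidean"
      using b by (auto simp: Inr_cell_iff singular_simplex_subtopology)
    then show ?thesis
      using Inr cocycle by (simp add: eval_chain_diff eval_chain_frag_extend)
  qed
  then obtain W K where W: "open W" "0 \<in> W"
    and K: "\<forall>g. \<forall>b\<in>cells (Suc n) ((+) g ` W). ?F b = eval_chain K (cone_boundary (Suc n) b)"
    using cone_pro_acyclic [OF G, of UNIV "Suc n" ?F] by auto
  let ?\<W> = "translate_cover W"
  let ?H = "\<lambda>xs. K (Inl xs)"
  have "list_cochain ?\<W> n ?H \<in> cocycles (tuple_complex ?\<W>) n"
  proof (rule list_cochain_cocycleI)
    fix xs :: "'g list" assume "length xs = Suc (Suc n)" "small_list ?\<W> xs"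
    then obtain g where "Inl xs \<in> cells (Suc n) ((+) g ` W)"
      by (auto simp: small_list_def translate_cover_def Inl_cell_iff)
    then have "0 = eval_chain K (cone_boundary (Suc n) (Inl xs))"
      using K by force
    then show "list_coboundary ?H xs = 0"
      by (simp add: eval_chain_frag_extend eval_chain_list_boundary)
  qed
  moreover have "restrict (\<lambda>\<tau>. ?H (vertex_list n \<tau>) - f \<tau>) (small_simplices ?\<W> n) \<in> coboundaries (small_complex ?\<W>) n"
  proof (rule small.coboundaryI [where G = "\<lambda>\<sigma>. K (Inr \<sigma>)"])
    fix \<tau> assume "\<tau> \<in> small_simplices ?\<W> n"
    then obtain g where "Inr \<tau> \<in> cells (Suc n) ((+) g ` W)"
      by (auto simp: small_simplices_eq translate_cover_def Inr_cell_iff)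
    then have "f \<tau> = eval_chain K (cone_boundary (Suc n) (Inr \<tau>))"
      using K by force
    then show "?H (vertex_list n \<tau>) - f \<tau> = eval_chain (\<lambda>\<sigma>. K (Inr \<sigma>)) (chain_boundary n (frag_of \<tau>))"
      by (simp add: eval_chain_diff eval_chain_frag_extend)
  qed
  ultimately show thesis
    using W by (intro that [of W ?H]) (auto simp: identity_nhds_def)
qed

lemma small_restriction_map:
  "abelian_cochain_map (singular_complex :: (((nat \<Rightarrow> real) \<Rightarrow> 'a::topological_space) \<Rightarrow> 'v::ab_group_add) cochain_complex)
    (small_complex \<UU>) (\<lambda>q f. restrict f (small_simplices \<UU> q))"
  by (rule simplex_restriction [OF all.simplex_family_axioms small.simplex_family_axioms small_simplices_subset])

lemma small_simplices_refines: "refines \<VV> \<UU> \<Longrightarrow> small_simplices \<VV> q \<subseteq> small_simplices \<UU> q"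
  unfolding refines_def small_simplices_def by (auto, meson subset_trans)

text \<open>The map \<^const>\<open>vertex_map\<close> is characterized without reference to the inverse of
\<^const>\<open>small_restriction\<close>.\<close>

lemma vertex_map_eqI:
  fixes U :: "'g::topological_group_add set" and z :: "(nat \<Rightarrow> 'g) \<Rightarrow> 'v::ab_group_add"
  assumes U: "U \<in> identity_nhds"
    and z: "z \<in> cocycles (tuple_complex (translate_cover U)) n" and w: "w \<in> cocycles singular_complex n"
    and eq: "vertex_cochain (translate_cover U) n z \<otimes>\<^bsub>cochains (small_complex (translate_cover U)) n\<^esub>
        inv\<^bsub>cochains (small_complex (translate_cover U)) n\<^esub> (restrict w (small_simplices (translate_cover U) n))
        \<in> coboundaries (small_complex (translate_cover U)) n"
  shows "vertex_map tuple_complex n U (abelian_cochain_complex.cohomology_class (tuple_complex (translate_cover U)) n z)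
    = abelian_cochain_complex.cohomology_class singular_complex n w"
proof -
  let ?\<UU> = "translate_cover U"
  interpret open_cover ?\<UU> using U by (rule open_cover_translates)
  interpret V: abelian_cochain_map "tuple_complex ?\<UU> :: ((nat \<Rightarrow> 'g) \<Rightarrow> 'v) cochain_complex" "small_complex ?\<UU>" "vertex_cochain ?\<UU>"
    by (rule vertex_cochain_map)
  interpret R: abelian_cochain_map "singular_complex :: (_ \<Rightarrow> 'v) cochain_complex" "small_complex ?\<UU>"
    "\<lambda>q f. restrict f (small_simplices ?\<UU> q)"
    by (rule small_restriction_map)
  have r: "small_restriction n ?\<UU> (R.K.cohomology_class n w) = V.L.cohomology_class n (vertex_cochain ?\<UU> n z)"
    using eq V.L.class_eq_iff [OF V.map_cocycle [OF z] R.map_cocycle [OF w]]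
    unfolding small_restriction_def R.map_class [OF w] by simp
  have inj: "inj_on (small_restriction n ?\<UU>) (carrier (cohomology (singular_complex :: (_ \<Rightarrow> 'v) cochain_complex) n))"
    using small_restriction_iso by (auto simp: iso_def bij_betw_def)
  show ?thesis
    unfolding vertex_map_def V.map_class [OF z] r [symmetric]
    by (rule inv_into_f_f [OF inj R.K.class_closed [OF w]])
qed

lemma vertex_map_cases:
  fixes U :: "'g::topological_group_add set" and z :: "(nat \<Rightarrow> 'g) \<Rightarrow> 'v::ab_group_add"
  assumes U: "U \<in> identity_nhds" and z: "z \<in> cocycles (tuple_complex (translate_cover U)) n"
  obtains w where "w \<in> cocycles singular_complex n"
    "vertex_cochain (translate_cover U) n z \<otimes>\<^bsub>cochains (small_complex (translate_cover U)) n\<^esub>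
        inv\<^bsub>cochains (small_complex (translate_cover U)) n\<^esub> (restrict w (small_simplices (translate_cover U) n))
        \<in> coboundaries (small_complex (translate_cover U)) n"
proof -
  let ?\<UU> = "translate_cover U"
  interpret open_cover ?\<UU> using U by (rule open_cover_translates)
  interpret V: abelian_cochain_map "tuple_complex ?\<UU> :: ((nat \<Rightarrow> 'g) \<Rightarrow> 'v) cochain_complex" "small_complex ?\<UU>" "vertex_cochain ?\<UU>"
    by (rule vertex_cochain_map)
  interpret R: abelian_cochain_map "singular_complex :: (_ \<Rightarrow> 'v) cochain_complex" "small_complex ?\<UU>"
    "\<lambda>q f. restrict f (small_simplices ?\<UU> q)"
    by (rule small_restriction_map)
  have "V.L.cohomology_class n (vertex_cochain ?\<UU> n z) \<in>
      small_restriction n ?\<UU> ` carrier (cohomology (singular_complex :: (_ \<Rightarrow> 'v) cochain_complex) n)"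
    using small_restriction_iso [of n, where 'v = 'v] V.L.class_closed [OF V.map_cocycle [OF z]]
    by (simp add: iso_def bij_betw_def)
  then obtain w where w: "w \<in> cocycles singular_complex n"
    "V.L.cohomology_class n (vertex_cochain ?\<UU> n z) = small_restriction n ?\<UU> (R.K.cohomology_class n w)"
    unfolding R.K.carrier_cohomology by blast
  then show thesis
    using that [OF w(1)] V.L.class_eq_iff [OF V.map_cocycle [OF z] R.map_cocycle [OF w(1)]]
    unfolding small_restriction_def R.map_class [OF w(1)] by simp
qed

theorem vertex_colimit_iso:
  fixes n :: nat
  assumes G: "locally_contractible_space (euclidean :: 'g::topological_group_add topology)"
  shows "colimit_desc (vertex_map tuple_complex n) \<in>
    iso (colimit (nhd_system (tuple_complex :: 'g set set \<Rightarrow> ((nat \<Rightarrow> 'g) \<Rightarrow> 'v::ab_group_add) cochain_complex) n))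
      (cohomology singular_complex n)"
    and "\<And>U. U \<in> identity_nhds \<Longrightarrow> vertex_map tuple_complex n U \<in>
      hom (cohomology (tuple_complex (translate_cover U) :: ((nat \<Rightarrow> 'g) \<Rightarrow> 'v) cochain_complex) n) (cohomology singular_complex n)"
    and "\<And>U W x. U \<in> identity_nhds \<Longrightarrow> W \<in> identity_nhds \<Longrightarrow> W \<subseteq> U \<Longrightarrow>
      x \<in> carrier (cohomology (tuple_complex (translate_cover U) :: ((nat \<Rightarrow> 'g) \<Rightarrow> 'v) cochain_complex) n) \<Longrightarrow>
      vertex_map tuple_complex n W (Trans (nhd_system tuple_complex n) U W x) = vertex_map tuple_complex n U x"
proof -
  let ?A = "tuple_complex :: 'g set set \<Rightarrow> ((nat \<Rightarrow> 'g) \<Rightarrow> 'v) cochain_complex"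
  let ?S = "singular_complex :: (((nat \<Rightarrow> real) \<Rightarrow> 'g) \<Rightarrow> 'v) cochain_complex"
  interpret A: abelian_cochain_complex "?A \<UU>" for \<UU> by (rule tuple_complex)
  interpret S: abelian_cochain_complex ?S by (rule all.simplex_complex)
  interpret D: directed_system "nhd_system ?A n" by (rule directed_tuple_system)
  have index: "U \<in> Index (nhd_system ?A n) \<longleftrightarrow> U \<in> identity_nhds" "Le (nhd_system ?A n) U W \<longleftrightarrow> W \<subseteq> U"
    "Obj (nhd_system ?A n) U = cohomology (?A (translate_cover U)) n" for U W
    by (simp_all add: nhd_system_def)
  have trans_class: "Trans (nhd_system ?A n) U W (A.cohomology_class (translate_cover U) n z)
      = A.cohomology_class (translate_cover W) n (restrict z (cover_tuples (translate_cover W) n))"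
    and trans_cocycle: "restrict z (cover_tuples (translate_cover W) n) \<in> cocycles (?A (translate_cover W)) n"
    if WU: "W \<subseteq> U" and z: "z \<in> cocycles (?A (translate_cover U)) n" for U W z
  proof -
    interpret R: abelian_cochain_map "?A (translate_cover U)" "?A (translate_cover W)"
      "\<lambda>q f. restrict f (cover_tuples (translate_cover W) q)"
      using WU by (intro tuple_restriction refines_translate_cover)
    show "Trans (nhd_system ?A n) U W (A.cohomology_class (translate_cover U) n z)
      = A.cohomology_class (translate_cover W) n (restrict z (cover_tuples (translate_cover W) n))"
      using R.map_class [OF z] by (simp add: nhd_system_def)
    show "restrict z (cover_tuples (translate_cover W) n) \<in> cocycles (?A (translate_cover W)) n"
      using z by (rule R.map_cocycle)
  qed
  show hom: "vertex_map ?A n U \<in> hom (cohomology (?A (translate_cover U)) n) (cohomology ?S n)"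
    if U: "U \<in> identity_nhds" for U
  proof -
    interpret open_cover "translate_cover U" using U by (rule open_cover_translates)
    have gS: "group (cohomology ?S n)"
      using S.comm_group_cohomology [of n] by (simp add: comm_group_def)
    have inv_hom: "inv_into (carrier (cohomology ?S n)) (small_restriction n (translate_cover U))
        \<in> hom (cohomology (small_complex (translate_cover U)) n) (cohomology ?S n)"
      using group.iso_set_sym [OF gS small_restriction_iso] by (simp add: iso_def)
    show ?thesis
      using hom_compose [OF abelian_cochain_map.cohomology_map_hom [OF vertex_cochain_map] inv_hom]
      by (simp add: vertex_map_def [abs_def] o_def)
  qed
  show natural: "vertex_map ?A n W (Trans (nhd_system ?A n) U W x) = vertex_map ?A n U x"
    if U: "U \<in> identity_nhds" and W: "W \<in> identity_nhds" and WU: "W \<subseteq> U"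
      and x: "x \<in> carrier (cohomology (?A (translate_cover U)) n)" for U W x
  proof -
    let ?\<UU> = "translate_cover U" and ?\<W> = "translate_cover W"
    interpret r: abelian_cochain_map "small_complex ?\<UU> :: (((nat \<Rightarrow> real) \<Rightarrow> 'g) \<Rightarrow> 'v) cochain_complex" "small_complex ?\<W>"
      "\<lambda>q f. restrict f (small_simplices ?\<W> q)"
      by (rule simplex_restriction [OF small.simplex_family_axioms small.simplex_family_axioms
            small_simplices_refines [OF refines_translate_cover [OF WU]]])
    obtain z where z: "z \<in> cocycles (?A ?\<UU>) n" "x = A.cohomology_class ?\<UU> n z"
      using x by (auto simp: A.carrier_cohomology)
    obtain w where w: "w \<in> cocycles ?S n"
      "vertex_cochain ?\<UU> n z \<otimes>\<^bsub>cochains (small_complex ?\<UU>) n\<^esub>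
        inv\<^bsub>cochains (small_complex ?\<UU>) n\<^esub> (restrict w (small_simplices ?\<UU> n)) \<in> coboundaries (small_complex ?\<UU>) n"
      using vertex_map_cases [OF U z(1)] by blast
    obtain F where F: "z = list_cochain ?\<UU> n F"
      using z(1) by (rule cocycle_list_cochainE)
    have sub: "small_simplices ?\<UU> n \<inter> small_simplices ?\<W> n = small_simplices ?\<W> n"
      using small_simplices_refines [OF refines_translate_cover [OF WU]] by blast
    have w': "restrict (\<lambda>\<tau>. F (vertex_list n \<tau>) + - w \<tau>) (small_simplices ?\<UU> n) \<in> coboundaries (small_complex ?\<UU>) n"
      using w(2) unfolding F vertex_cochain_list_cochain small.inv_simplex_complex small.mult_simplex_complex .
    have rz: "restrict z (cover_tuples ?\<W> n) = list_cochain ?\<W> n F"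
      unfolding F by (rule restrict_list_cochain [OF refines_translate_cover [OF WU]])
    have "vertex_cochain ?\<W> n (restrict z (cover_tuples ?\<W> n)) \<otimes>\<^bsub>cochains (small_complex ?\<W>) n\<^esub>
        inv\<^bsub>cochains (small_complex ?\<W>) n\<^esub> (restrict w (small_simplices ?\<W> n)) \<in> coboundaries (small_complex ?\<W>) n"
      using r.map_coboundaries [OF w']
      unfolding rz vertex_cochain_list_cochain small.inv_simplex_complex small.mult_simplex_complex restrict_restrict sub .
    then have "vertex_map ?A n W (A.cohomology_class ?\<W> n (restrict z (cover_tuples ?\<W> n))) = S.cohomology_class n w"
      by (rule vertex_map_eqI [OF W trans_cocycle [OF WU z(1)] w(1)])
    moreover have "vertex_map ?A n U x = S.cohomology_class n w"
      unfolding z(2) by (rule vertex_map_eqI [OF U z(1) w])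
    ultimately show ?thesis
      unfolding z(2) trans_class [OF WU z(1)] by simp
  qed
  show "colimit_desc (vertex_map ?A n) \<in> iso (colimit (nhd_system ?A n)) (cohomology ?S n)"
  proof (rule D.colimit_desc_iso)
    show "vertex_map ?A n U \<in> hom (Obj (nhd_system ?A n) U) (cohomology ?S n)" if "U \<in> Index (nhd_system ?A n)" for U
      using hom that by (simp add: index)
    show "group (cohomology ?S n)" using S.comm_group_cohomology by (simp add: comm_group_def)
    show "vertex_map ?A n W (Trans (nhd_system ?A n) U W x) = vertex_map ?A n U x"
      if "U \<in> Index (nhd_system ?A n)" "W \<in> Index (nhd_system ?A n)" "Le (nhd_system ?A n) U W"
        "x \<in> carrier (Obj (nhd_system ?A n) U)" for U W x
      using natural that by (simp add: index)
    show "\<exists>W\<in>Index (nhd_system ?A n). Le (nhd_system ?A n) U W \<and> Trans (nhd_system ?A n) U W x = \<one>\<^bsub>Obj (nhd_system ?A n) W\<^esub>"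
      if U': "U \<in> Index (nhd_system ?A n)" and x: "x \<in> carrier (Obj (nhd_system ?A n) U)"
        and one: "vertex_map ?A n U x = \<one>\<^bsub>cohomology ?S n\<^esub>" for U x
    proof -
      let ?\<UU> = "translate_cover U"
      have U: "U \<in> identity_nhds" using U' by (simp add: index)
      interpret V: abelian_cochain_map "?A ?\<UU>" "small_complex ?\<UU>" "vertex_cochain ?\<UU>" by (rule vertex_cochain_map)
      interpret R: abelian_cochain_map ?S "small_complex ?\<UU>" "\<lambda>q f. restrict f (small_simplices ?\<UU> q)"
        by (rule small_restriction_map)
      obtain z where z: "z \<in> cocycles (?A ?\<UU>) n" "x = A.cohomology_class ?\<UU> n z"
        using x by (auto simp: index A.carrier_cohomology)
      obtain w where w: "w \<in> cocycles ?S n"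
        "vertex_cochain ?\<UU> n z \<otimes>\<^bsub>cochains (small_complex ?\<UU>) n\<^esub>
          inv\<^bsub>cochains (small_complex ?\<UU>) n\<^esub> (restrict w (small_simplices ?\<UU> n)) \<in> coboundaries (small_complex ?\<UU>) n"
        using vertex_map_cases [OF U z(1)] by blast
      have "S.cohomology_class n w = \<one>\<^bsub>cohomology ?S n\<^esub>"
        using one vertex_map_eqI [OF U z(1) w] z(2) by simp
      then have "w \<in> coboundaries ?S n" using S.class_eq_one_iff [OF w(1)] by simp
      then have "restrict w (small_simplices ?\<UU> n) \<in> coboundaries (small_complex ?\<UU>) n"
        by (rule R.map_coboundaries)
      then have "V.L.cohomology_class n (restrict w (small_simplices ?\<UU> n)) = \<one>\<^bsub>cohomology (small_complex ?\<UU>) n\<^esub>"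
        using V.L.class_eq_one_iff [OF R.map_cocycle [OF w(1)]] by simp
      then have "V.L.cohomology_class n (vertex_cochain ?\<UU> n z) = \<one>\<^bsub>cohomology (small_complex ?\<UU>) n\<^esub>"
        using V.L.class_eq_iff [OF V.map_cocycle [OF z(1)] R.map_cocycle [OF w(1)]] w(2) by simp
      then have exact: "vertex_cochain ?\<UU> n z \<in> coboundaries (small_complex ?\<UU>) n"
        using V.L.class_eq_one_iff [OF V.map_cocycle [OF z(1)]] by simp
      obtain F where F: "z = list_cochain ?\<UU> n F"
        "\<And>xs. length xs = Suc (Suc n) \<Longrightarrow> small_list ?\<UU> xs \<Longrightarrow> list_coboundary F xs = 0"
        using cocycle_list_cochainE [OF z(1)] by metis
      obtain W where W: "W \<in> identity_nhds" "W \<subseteq> U"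
        "list_cochain (translate_cover W) n F \<in> coboundaries (?A (translate_cover W)) n"
        using vertex_map_injective [OF G U F(2) exact [unfolded F(1) vertex_cochain_list_cochain]] by metis
      have "restrict z (cover_tuples (translate_cover W) n) \<in> coboundaries (?A (translate_cover W)) n"
        using W(3) unfolding F(1) restrict_list_cochain [OF refines_translate_cover [OF W(2)]] .
      then have "Trans (nhd_system ?A n) U W x = \<one>\<^bsub>cohomology (?A (translate_cover W)) n\<^esub>"
        unfolding z(2) trans_class [OF W(2) z(1)]
        using A.class_eq_one_iff [OF trans_cocycle [OF W(2) z(1)]] by simp
      then show ?thesis using W(1,2) index by metis
    qed
    show "\<exists>U\<in>Index (nhd_system ?A n). \<exists>x\<in>carrier (Obj (nhd_system ?A n) U). vertex_map ?A n U x = h"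
      if "h \<in> carrier (cohomology ?S n)" for h
    proof -
      obtain w where w: "w \<in> cocycles ?S n" "h = S.cohomology_class n w"
        using \<open>h \<in> carrier (cohomology ?S n)\<close> by (auto simp: S.carrier_cohomology)
      obtain W F where W: "W \<in> identity_nhds"
        and F: "list_cochain (translate_cover W) n F \<in> cocycles (?A (translate_cover W)) n"
          "restrict (\<lambda>\<tau>. F (vertex_list n \<tau>) - w \<tau>) (small_simplices (translate_cover W) n)
            \<in> coboundaries (small_complex (translate_cover W)) n"
        by (rule vertex_map_surjective [OF G all.cocycleE(2) [OF w(1)]])
      have "vertex_map ?A n W (A.cohomology_class (translate_cover W) n (list_cochain (translate_cover W) n F)) = h"
        unfolding w(2)
      proof (rule vertex_map_eqI [OF W F(1) w(1)])
        show "vertex_cochain (translate_cover W) n (list_cochain (translate_cover W) n F)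
            \<otimes>\<^bsub>cochains (small_complex (translate_cover W)) n\<^esub>
            inv\<^bsub>cochains (small_complex (translate_cover W)) n\<^esub> (restrict w (small_simplices (translate_cover W) n))
            \<in> coboundaries (small_complex (translate_cover W)) n"
          using F(2) unfolding vertex_cochain_list_cochain small.inv_simplex_complex small.mult_simplex_complex by simp
      qed
      then show ?thesis
        using W A.class_closed [OF F(1)] index by metis
    qed
  qed
qed

lemma vertex_map_factor:
  fixes U :: "'g::topological_group_add set"
    and x :: "((nat \<Rightarrow> 'g) \<Rightarrow> 'v::topological_ab_group_add) set"
  assumes x: "x \<in> carrier (cohomology (continuous_tuple_complex (translate_cover U)) n)"
  shows "vertex_map continuous_tuple_complex n U x = vertex_map tuple_complex n U (inclusion_map n U x)"
proof -
  let ?\<UU> = "translate_cover U"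
  interpret I: abelian_cochain_map "continuous_tuple_complex ?\<UU>"
    "tuple_complex ?\<UU> :: ((nat \<Rightarrow> 'g) \<Rightarrow> 'v) cochain_complex" "\<lambda>_ f. f"
    by (rule continuous_inclusion)
  interpret V: abelian_cochain_map "tuple_complex ?\<UU> :: ((nat \<Rightarrow> 'g) \<Rightarrow> 'v) cochain_complex"
    "small_complex ?\<UU>" "vertex_cochain ?\<UU>"
    by (rule vertex_cochain_map)
  interpret VC: abelian_cochain_map "continuous_tuple_complex ?\<UU> :: ((nat \<Rightarrow> 'g) \<Rightarrow> 'v) cochain_complex"
    "small_complex ?\<UU>" "vertex_cochain ?\<UU>"
  proof (intro abelian_cochain_map.intro abelian_cochain_map_axioms.intro I.K.abelian_cochain_complex_axioms
      V.L.abelian_cochain_complex_axioms)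
    show "vertex_cochain ?\<UU> q \<in> hom (cochains (continuous_tuple_complex ?\<UU>) q) (cochains (small_complex ?\<UU> :: (_ \<Rightarrow> 'v) cochain_complex) q)" for q
      using hom_compose [OF I.map_hom V.map_hom] by (simp add: o_def)
    show "vertex_cochain ?\<UU> (Suc q) (coboundary (continuous_tuple_complex ?\<UU>) q f) =
        coboundary (small_complex ?\<UU>) q (vertex_cochain ?\<UU> q f)"
      if "f \<in> carrier (cochains (continuous_tuple_complex ?\<UU> :: ((nat \<Rightarrow> 'g) \<Rightarrow> 'v) cochain_complex) q)" for f q
      unfolding continuous_tuple_complex_simps
      using that carrier_continuous_subset by (intro V.map_coboundary) blast
  qed
  obtain z where z: "z \<in> cocycles (continuous_tuple_complex ?\<UU>) n" "x = I.K.cohomology_class n z"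
    using x by (auto simp: I.K.carrier_cohomology)
  show ?thesis
    unfolding vertex_map_def inclusion_map_def z(2) I.map_class [OF z(1)] VC.map_class [OF z(1)]
      V.map_class [OF I.map_cocycle [OF z(1)]] ..
qed

text \<open>On continuous cochains the vertex map is the composite of the inclusion and the vertex map
on all cochains.\<close>

theorem continuous_vertex_colimit_iso:
  fixes n :: nat
  assumes G: "locally_contractible_space (euclidean :: 'g::topological_group_add topology)"
    and V: "loop_contractible TYPE('v::topological_ab_group_add)"
  shows "colimit_desc (vertex_map continuous_tuple_complex n) \<in>
    iso (colimit (nhd_system (continuous_tuple_complex :: 'g set set \<Rightarrow> ((nat \<Rightarrow> 'g) \<Rightarrow> 'v) cochain_complex) n))
      (cohomology singular_complex n)"
proof -
  let ?Ac = "continuous_tuple_complex :: 'g set set \<Rightarrow> ((nat \<Rightarrow> 'g) \<Rightarrow> 'v) cochain_complex"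
  let ?A = "tuple_complex :: 'g set set \<Rightarrow> ((nat \<Rightarrow> 'g) \<Rightarrow> 'v) cochain_complex"
  let ?Hsing = "cohomology (singular_complex :: (((nat \<Rightarrow> real) \<Rightarrow> 'g) \<Rightarrow> 'v) cochain_complex) n"
  interpret C: directed_system "nhd_system ?Ac n" by (rule directed_continuous_system)
  interpret D: directed_system "nhd_system ?A n" by (rule directed_tuple_system)
  interpret I: abelian_cochain_map "?Ac \<UU>" "?A \<UU>" "\<lambda>_ f. f" for \<UU>
    by (rule continuous_inclusion)
  let ?i = "inclusion_map n :: 'g set \<Rightarrow> ((nat \<Rightarrow> 'g) \<Rightarrow> 'v) set \<Rightarrow> _"
  have index: "U \<in> Index (nhd_system K n) \<longleftrightarrow> U \<in> identity_nhds" "Le (nhd_system K n) U W \<longleftrightarrow> W \<subseteq> U"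
    "Obj (nhd_system K n) U = cohomology (K (translate_cover U)) n" for U W
    and K :: "'g set set \<Rightarrow> ((nat \<Rightarrow> 'g) \<Rightarrow> 'v) cochain_complex"
    by (simp_all add: nhd_system_def)
  have i_closed: "?i U x \<in> carrier (cohomology (?A (translate_cover U)) n)"
    if "x \<in> carrier (cohomology (?Ac (translate_cover U)) n)" for U x
    using hom_carrier [OF I.cohomology_map_hom] that by (auto simp: inclusion_map_def)
  have i_natural: "?i W (Trans (nhd_system ?Ac n) U W x) = Trans (nhd_system ?A n) U W (?i U x)"
    if "W \<subseteq> U" "x \<in> carrier (cohomology (?Ac (translate_cover U)) n)" for U W x
    using that by (rule inclusion_map_natural)
  have factor: "vertex_map ?Ac n U x = vertex_map ?A n U (?i U x)"
    if "x \<in> carrier (cohomology (?Ac (translate_cover U)) n)" for U x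
    using that by (rule vertex_map_factor)
  have vertex_natural: "vertex_map ?A n W (Trans (nhd_system ?A n) U W x) = vertex_map ?A n U x"
    if "U \<in> identity_nhds" "W \<in> identity_nhds" "W \<subseteq> U" "x \<in> carrier (cohomology (?A (translate_cover U)) n)" for U W x
    using that by (rule vertex_colimit_iso(3) [OF G])
  have "colimit_desc (vertex_map ?A n) \<circ> colimit_map (nhd_system ?A n) ?i \<in> iso (colimit (nhd_system ?Ac n)) ?Hsing"
    by (rule iso_set_trans [OF inclusion_colimit_iso [OF V] vertex_colimit_iso(1) [OF G]])
  then show "colimit_desc (vertex_map ?Ac n) \<in> iso (colimit (nhd_system ?Ac n)) ?Hsing"
  proof (rule C.colimit_iso_cong)
    fix X assume "X \<in> carrier (colimit (nhd_system ?Ac n))"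
    then obtain U x where U: "U \<in> identity_nhds" and x: "x \<in> carrier (cohomology (?Ac (translate_cover U)) n)"
      and X: "X = C.germ U x"
      by (auto simp: C.carrier_colimit index)
    have "colimit_desc (vertex_map ?Ac n) X = vertex_map ?Ac n U x"
      unfolding X
    proof (rule C.colimit_desc_germ)
      fix U W x assume "U \<in> Index (nhd_system ?Ac n)" "W \<in> Index (nhd_system ?Ac n)" "Le (nhd_system ?Ac n) U W"
        and x: "x \<in> carrier (Obj (nhd_system ?Ac n) U)"
      then have UW: "U \<in> identity_nhds" "W \<in> identity_nhds" "W \<subseteq> U"
        and x': "x \<in> carrier (cohomology (?Ac (translate_cover U)) n)" by (simp_all only: index)
      have "Trans (nhd_system ?Ac n) U W x \<in> carrier (cohomology (?Ac (translate_cover W)) n)"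
        using C.trans_closed [of U W x] UW x by (simp only: index)
      then show "vertex_map ?Ac n W (Trans (nhd_system ?Ac n) U W x) = vertex_map ?Ac n U x"
        using factor i_natural [OF UW(3) x'] vertex_natural [OF UW i_closed [OF x']] x' by metis
    qed (use U x in \<open>simp add: index\<close>)
    moreover have "colimit_map (nhd_system ?A n) ?i X = D.germ U (?i U x)"
      unfolding X
    proof (rule colimit_map_germ [OF C.directed_system_axioms D.directed_system_axioms])
      show "?i W \<in> hom (Obj (nhd_system ?Ac n) W) (Obj (nhd_system ?A n) W)" for W
        using I.cohomology_map_hom by (simp add: inclusion_map_def index)
      show "?i Z (Trans (nhd_system ?Ac n) W Z y) = Trans (nhd_system ?A n) W Z (?i W y)"
        if "Le (nhd_system ?Ac n) W Z" "y \<in> carrier (Obj (nhd_system ?Ac n) W)" for W Z y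
        using i_natural that by (simp only: index)
    qed (use U x in \<open>simp_all add: nhd_system_def\<close>)
    moreover have "colimit_desc (vertex_map ?A n) (D.germ U (?i U x)) = vertex_map ?A n U (?i U x)"
      using vertex_natural i_closed [OF x] U by (intro D.colimit_desc_germ) (simp_all add: index)
    ultimately show "colimit_desc (vertex_map ?Ac n) X = (colimit_desc (vertex_map ?A n) \<circ> colimit_map (nhd_system ?A n) ?i) X"
      using factor [OF x] by simp
  qed
qed

theorem theorem5p27:
  fixes n :: nat
    and Ac A :: "'g::topological_group_add set set \<Rightarrow>
      ((nat \<Rightarrow> 'g) \<Rightarrow> 'v::topological_ab_group_add) cochain_complex"
    and S :: "'g set set \<Rightarrow> (((nat \<Rightarrow> real) \<Rightarrow> 'g) \<Rightarrow> 'v) cochain_complex"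
    and Hsing :: "(((nat \<Rightarrow> real) \<Rightarrow> 'g) \<Rightarrow> 'v) set monoid"
  assumes "Ac = continuous_tuple_complex"
    and "A = tuple_complex"
    and "S = small_complex"
    and "Hsing = cohomology singular_complex n"
    and "locally_contractible_space (euclidean :: 'g topology)"
    and "loop_contractible TYPE('v)"
  shows "colimit_map (nhd_system A n) (inclusion_map n)
          \<in> iso (colimit (nhd_system Ac n)) (colimit (nhd_system A n)) \<and>
    (\<forall>U \<in> identity_nhds. small_restriction n (translate_cover U)
          \<in> iso Hsing (cohomology (S (translate_cover U)) n)) \<and>
    colimit_desc (vertex_map Ac n) \<in> iso (colimit (nhd_system Ac n)) Hsing \<and>
    colimit_desc (vertex_map A n) \<in> iso (colimit (nhd_system A n)) Hsing"
  unfolding assms(1-4)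
  using inclusion_colimit_iso [OF assms(6)] open_cover.small_restriction_iso [OF open_cover_translates]
    continuous_vertex_colimit_iso [OF assms(5,6)] vertex_colimit_iso(1) [OF assms(5)]
  by blast

end
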